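(* Let $(1,d_2,\ldots,d_n)$ be a sequence of positive integers satisfying $d_i\mid d_{i+1}$ for $i=2,\ldots,n-1$ and with $d_n>1$. Let $E$ be a (complex) elliptic curve for which there exists a primitive $d_n$-torsion point $P\in E[d_n]$ such that $E/\langle P\rangle$ is not isomorphic to $E$. Let $(B,\mathcal{L}_B)$ be a polarised complex abelian variety of type $(d_2,\ldots,d_n)$ such that $\mathrm{Hom}(E,B)=0$. Let $Q\in \ker\varphi_{\mathcal{L}_B}\cap B[d_n]$ be a primitive $d_n$-torsion point. Then the quotient $$A=(E\times B)/\langle (P,Q)\rangle = E\boxplus B$$ is a $(1,d_2,\ldots,d_n)$-polarised abelian variety (i.e. it carries a polarisation of type $(1,d_2,\ldots,d_n)$) such that the dual abelian variety $\hat{A}$ is not isomorphic to $A$.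
   Context: All abelian varieties are over $\mathbb{C}$. A polarisation on an abelian variety $X$ is the Néron–Severi class of an ample line bundle $\mathcal{L}$; the polarising isogeny is $\varphi_{\mathcal{L}}:X\to\hat X=\mathrm{Pic}^0(X)$, $x\mapsto t_x^*\mathcal{L}\otimes\mathcal{L}^{-1}$, where $t_x$ is translation by $x$. If $\dim X=m$, then $\ker\varphi_{\mathcal{L}}\cong(\mathbb{Z}_{\delta_1}\times\cdots\times\mathbb{Z}_{\delta_m})^2$ with positive integers $\delta_i\mid\delta_{i+1}$, and $(\delta_1,\ldots,\delta_m)$ is the type of the polarisation. $X[k]$ denotes the group of $k$-torsion points; a primitive $k$-torsion point is a point of order exactly $k$; $\langle x\rangle$ is the subgroup generated by $x$. "Isomorphic" means abstractly isomorphic as abelian varieties (no compatibility with polarisations is required). $\mathrm{Hom}$ denotes homomorphisms of abelian varieties. Notation $A=E\boxplus B$: $E$ and $B$ (here identified with the images of $E\times\{0\}$ and $\{0\}\times B$ in $A$) are complementary abelian subvarieties of $A$ with respect to the polarisation $\mathcal{L}$ on $A$, meaning that $\epsilon_E+\epsilon_B=1$ in $\mathrm{End}(A)\otimes\mathbb{Q}$, where for an abelian subvariety $\iota:C\hookrightarrow A$ the associated symmetric idempotent is $\epsilon_C=\iota\,\varphi_{\mathcal{L}|_C}^{-1}\,\hat\iota\,\varphi_{\mathcal{L}}\in\mathrm{End}(A)\otimes\mathbb{Q}$. *)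

theory Defs
  imports
    "HOL-Analysis.Analysis"
    "HOL-Algebra.Generated_Groups"
    "HOL-Algebra.Multiplicative_Group"
    "HOL-Algebra.Elementary_Groups"
    "HOL-Algebra.Product_Groups"
begin

text \<open>
  Complex abelian varieties are treated as projective complex tori \<open>X = V / \<Lambda>\<close>, where
  \<open>V = complex ^ 'n\<close> and \<open>\<Lambda>\<close> is a lattice in \<open>V\<close>. A torus is given by its lattice; its points
  are the cosets of \<open>\<Lambda>\<close>.
\<close>

section \<open>Holomorphic maps\<close>

definition holo :: "(complex ^ 'n) set \<Rightarrow> (complex ^ 'n \<Rightarrow> complex) \<Rightarrow> bool" where
  "holo U f \<longleftrightarrow>
     (\<forall>v\<in>U. \<exists>D. (f has_derivative D) (at v) \<and> (\<forall>c u. D (c *s u) = c * D u))"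

definition holo_map :: "(complex ^ 'n) set \<Rightarrow> (complex ^ 'n \<Rightarrow> complex ^ 'm) \<Rightarrow> bool" where
  "holo_map U F \<longleftrightarrow> (\<forall>i. holo U (\<lambda>v. F v $ i))"

abbreviation clinear :: "(complex ^ 'n \<Rightarrow> complex ^ 'm) \<Rightarrow> bool" where
  "clinear \<equiv> Vector_Spaces.linear (*s) (*s)"

section \<open>Complex tori\<close>

definition lattice :: "(complex ^ 'n) set \<Rightarrow> bool" where
  "lattice \<Lambda> \<longleftrightarrow>
     0 \<in> \<Lambda> \<and> (\<forall>x\<in>\<Lambda>. \<forall>y\<in>\<Lambda>. x - y \<in> \<Lambda>) \<and>
     (\<exists>e>0. \<forall>x\<in>\<Lambda>. x \<noteq> 0 \<longrightarrow> e \<le> norm x) \<and>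
     span \<Lambda> = UNIV"

definition additive_group :: "(complex ^ 'n) monoid" where
  "additive_group = \<lparr>carrier = UNIV, monoid.mult = (+), one = 0\<rparr>"

definition torus :: "(complex ^ 'n) set \<Rightarrow> (complex ^ 'n) set monoid" where
  "torus \<Lambda> = additive_group Mod \<Lambda>"

definition point :: "(complex ^ 'n) set \<Rightarrow> complex ^ 'n \<Rightarrow> (complex ^ 'n) set" where
  "point \<Lambda> v = \<Lambda> #>\<^bsub>additive_group\<^esub> v"

definition primitive_torsion_point :: "(complex ^ 'n) set \<Rightarrow> nat \<Rightarrow> (complex ^ 'n) set \<Rightarrow> bool" where
  "primitive_torsion_point \<Lambda> k x \<longleftrightarrow> x \<in> carrier (torus \<Lambda>) \<and> group.ord (torus \<Lambda>) x = k"

text \<open>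
  Homomorphisms of complex tori are holomorphic homomorphisms of groups. For projective tori
  these are the homomorphisms of abelian varieties.
\<close>

definition torus_hom ::
  "(complex ^ 'n) set \<Rightarrow> (complex ^ 'm) set \<Rightarrow> ((complex ^ 'n) set \<Rightarrow> (complex ^ 'm) set) \<Rightarrow> bool" where
  "torus_hom \<Lambda> \<Lambda>' f \<longleftrightarrow>
     f \<in> hom (torus \<Lambda>) (torus \<Lambda>') \<and>
     (\<forall>v. \<exists>U F. open U \<and> v \<in> U \<and> holo_map U F \<and> (\<forall>u\<in>U. f (point \<Lambda> u) = point \<Lambda>' (F u)))"

definition hom_trivial :: "(complex ^ 'n) set \<Rightarrow> (complex ^ 'm) set \<Rightarrow> bool" where
  "hom_trivial \<Lambda> \<Lambda>' \<longleftrightarrow>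
     (\<forall>f. torus_hom \<Lambda> \<Lambda>' f \<longrightarrow> (\<forall>x\<in>carrier (torus \<Lambda>). f x = \<one>\<^bsub>torus \<Lambda>'\<^esub>))"

definition torus_isomorphic :: "(complex ^ 'n) set \<Rightarrow> (complex ^ 'm) set \<Rightarrow> bool" where
  "torus_isomorphic \<Lambda> \<Lambda>' \<longleftrightarrow>
     (\<exists>f. torus_hom \<Lambda> \<Lambda>' f \<and>
          bij_betw f (carrier (torus \<Lambda>)) (carrier (torus \<Lambda>')) \<and>
          torus_hom \<Lambda>' \<Lambda> (inv_into (carrier (torus \<Lambda>)) f))"

text \<open>
  If \<open>S\<close> is a finite subgroup of \<open>V / \<Lambda>\<close>, then \<open>(V / \<Lambda>) / S = V / \<Union>S\<close>, because \<open>\<Union>S\<close> is the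
  preimage of \<open>S\<close> in \<open>V\<close>.
\<close>

definition quotient_by_point :: "(complex ^ 'n) set \<Rightarrow> (complex ^ 'n) set \<Rightarrow> (complex ^ 'n) set" where
  "quotient_by_point \<Lambda> x = \<Union> (generate (torus \<Lambda>) {x})"

definition vjoin :: "complex ^ 'n \<Rightarrow> complex ^ 'm \<Rightarrow> complex ^ ('n + 'm)" where
  "vjoin v w = (\<chi> i. case i of Inl j \<Rightarrow> v $ j | Inr j \<Rightarrow> w $ j)"

text \<open>
  Applied to two lattices this is the lattice of the product torus; applied to a point \<open>P\<close> of
  the first torus and a point \<open>Q\<close> of the second it is the point \<open>(P, Q)\<close> of the product.
\<close>

definition vprod :: "(complex ^ 'n) set \<Rightarrow> (complex ^ 'm) set \<Rightarrow> (complex ^ ('n + 'm)) set" where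
  "vprod S T = {vjoin v w | v w. v \<in> S \<and> w \<in> T}"

section \<open>Line bundles\<close>

text \<open>
  A line bundle on \<open>V / \<Lambda>\<close> is the quotient of \<open>V \<times> \<complex>\<close> by the action
  \<open>\<gamma> \<cdot> (v, t) = (v + \<gamma>, f \<gamma> v * t)\<close> of \<open>\<Lambda>\<close> for a factor of automorphy \<open>f\<close>. Pullback along the
  map induced by a linear map is composition, and tensor product and dual are pointwise product
  and inverse.
\<close>

type_synonym 'n factor = "complex ^ 'n \<Rightarrow> complex ^ 'n \<Rightarrow> complex"

definition trivial_bundle :: "'n factor" where
  "trivial_bundle = (\<lambda>\<gamma> v. 1)"

definition tensor :: "'n factor \<Rightarrow> 'n factor \<Rightarrow> 'n factor" where
  "tensor f g = (\<lambda>\<gamma> v. f \<gamma> v * g \<gamma> v)"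

definition dual_bundle :: "'n factor \<Rightarrow> 'n factor" where
  "dual_bundle f = (\<lambda>\<gamma> v. inverse (f \<gamma> v))"

definition tensor_power :: "'n factor \<Rightarrow> nat \<Rightarrow> 'n factor" where
  "tensor_power f k = (\<lambda>\<gamma> v. f \<gamma> v ^ k)"

definition translate_bundle :: "complex ^ 'n \<Rightarrow> 'n factor \<Rightarrow> 'n factor" where
  "translate_bundle x f = (\<lambda>\<gamma> v. f \<gamma> (v + x))"

definition pullback :: "(complex ^ 'n \<Rightarrow> complex ^ 'm) \<Rightarrow> 'm factor \<Rightarrow> 'n factor" where
  "pullback F f = (\<lambda>\<gamma> v. f (F \<gamma>) (F v))"

definition bundle_iso :: "(complex ^ 'n) set \<Rightarrow> 'n factor \<Rightarrow> 'n factor \<Rightarrow> bool" where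
  "bundle_iso \<Lambda> f g \<longleftrightarrow>
     (\<exists>h. holo UNIV h \<and> (\<forall>v. h v \<noteq> 0) \<and> (\<forall>\<gamma>\<in>\<Lambda>. \<forall>v. f \<gamma> v * h v = g \<gamma> v * h (v + \<gamma>)))"

text \<open>
  By the Appell--Humbert theorem every line bundle on \<open>V / \<Lambda>\<close> is isomorphic to exactly one
  bundle \<open>L(H, \<alpha>)\<close>, with \<open>H\<close> a Hermitian form (linear in the first argument) whose imaginary part
  is integral on \<open>\<Lambda>\<close>, and \<open>\<alpha>\<close> a semicharacter for \<open>H\<close>. Here line bundles are taken
  with the canonical factor of automorphy of \<open>L(H, \<alpha>)\<close>. The Neron--Severi class of
  \<open>L(H, \<alpha>)\<close> is \<open>H\<close>.
\<close>

definition neron_severi :: "(complex ^ 'n) set \<Rightarrow> (complex ^ 'n \<Rightarrow> complex ^ 'n \<Rightarrow> complex) \<Rightarrow> bool" where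
  "neron_severi \<Lambda> H \<longleftrightarrow>
     (\<forall>u v w. H (u + v) w = H u w + H v w) \<and>
     (\<forall>c v w. H (c *s v) w = c * H v w) \<and>
     (\<forall>v w. H w v = cnj (H v w)) \<and>
     (\<forall>\<gamma>\<in>\<Lambda>. \<forall>\<gamma>'\<in>\<Lambda>. Im (H \<gamma> \<gamma>') \<in> \<int>)"

definition semicharacter ::
  "(complex ^ 'n) set \<Rightarrow> (complex ^ 'n \<Rightarrow> complex ^ 'n \<Rightarrow> complex) \<Rightarrow> (complex ^ 'n \<Rightarrow> complex) \<Rightarrow> bool" where
  "semicharacter \<Lambda> H \<alpha> \<longleftrightarrow>
     (\<forall>\<gamma>\<in>\<Lambda>. norm (\<alpha> \<gamma>) = 1) \<and>
     (\<forall>\<gamma>\<in>\<Lambda>. \<forall>\<gamma>'\<in>\<Lambda>. \<alpha> (\<gamma> + \<gamma>') = \<alpha> \<gamma> * \<alpha> \<gamma>' * cis (pi * Im (H \<gamma> \<gamma>')))"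

definition appell_humbert ::
  "(complex ^ 'n \<Rightarrow> complex ^ 'n \<Rightarrow> complex) \<Rightarrow> (complex ^ 'n \<Rightarrow> complex) \<Rightarrow> 'n factor" where
  "appell_humbert H \<alpha> = (\<lambda>\<gamma> v. \<alpha> \<gamma> * exp (of_real pi * H v \<gamma> + of_real pi / 2 * H \<gamma> \<gamma>))"

definition line_bundle :: "(complex ^ 'n) set \<Rightarrow> 'n factor \<Rightarrow> bool" where
  "line_bundle \<Lambda> L \<longleftrightarrow>
     (\<exists>H \<alpha>. neron_severi \<Lambda> H \<and> semicharacter \<Lambda> H \<alpha> \<and> L = appell_humbert H \<alpha>)"

lemma line_bundle_cocycle:
  assumes "line_bundle \<Lambda> L" and "\<gamma> \<in> \<Lambda>" and "\<gamma>' \<in> \<Lambda>"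
  shows "L (\<gamma> + \<gamma>') v = L \<gamma> (v + \<gamma>') * L \<gamma>' v"
proof -
  obtain H \<alpha> where H: "neron_severi \<Lambda> H" and \<alpha>: "semicharacter \<Lambda> H \<alpha>"
    and L: "L = appell_humbert H \<alpha>"
    using assms(1) unfolding line_bundle_def by blast
  have add: "H (u + w) z = H u z + H w z" and herm: "H w u = cnj (H u w)" for u w z
    using H unfolding neron_severi_def by blast+
  have add2: "H z (u + w) = H z u + H z w" for u w z
    by (metis add herm complex_cnj_add)
  have "\<alpha> (\<gamma> + \<gamma>') = \<alpha> \<gamma> * \<alpha> \<gamma>' * cis (pi * Im (H \<gamma> \<gamma>'))"
    using \<alpha> assms unfolding semicharacter_def by blast
  moreover have "cis (pi * Im (H \<gamma> \<gamma>')) = cis (2 * pi * Im (H \<gamma> \<gamma>')) * cis (- (pi * Im (H \<gamma> \<gamma>')))"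
    by (simp add: cis_mult)
  moreover have "cis (2 * pi * Im (H \<gamma> \<gamma>')) = 1"
    using H assms unfolding neron_severi_def by (intro cis_multiple_2pi) blast
  ultimately have chi: "\<alpha> (\<gamma> + \<gamma>') = \<alpha> \<gamma> * \<alpha> \<gamma>' * exp (- \<i> * (pi * Im (H \<gamma> \<gamma>')))"
    by (simp add: cis_conv_exp)
  have im: "- \<i> * (pi * Im (H \<gamma> \<gamma>')) = pi / 2 * (H \<gamma>' \<gamma> - H \<gamma> \<gamma>')"
    by (subst herm[of \<gamma>' \<gamma>]) (simp add: complex_eq_iff)
  show ?thesis
    unfolding L appell_humbert_def chi im
    by (simp add: add add2 exp_add[symmetric] algebra_simps add_divide_distrib diff_divide_distrib)
qed

definition bundle_section :: "(complex ^ 'n) set \<Rightarrow> 'n factor \<Rightarrow> (complex ^ 'n \<Rightarrow> complex) \<Rightarrow> bool" where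
  "bundle_section \<Lambda> f s \<longleftrightarrow> holo UNIV s \<and> (\<forall>\<gamma>\<in>\<Lambda>. \<forall>v. s (v + \<gamma>) = f \<gamma> v * s v)"

text \<open>
  Very ample means that finitely many sections without common zero define an embedding into
  projective space. As \<open>V / \<Lambda>\<close> is compact, this means an injective immersion. The tangent space of
  projective space at the line spanned by \<open>z\<close> is the ambient space modulo that line.
\<close>

definition very_ample :: "(complex ^ 'n) set \<Rightarrow> 'n factor \<Rightarrow> bool" where
  "very_ample \<Lambda> f \<longleftrightarrow>
     (\<exists>(N::nat) s.
        (\<forall>i\<le>N. bundle_section \<Lambda> f (s i)) \<and>
        (\<forall>v. \<exists>i\<le>N. s i v \<noteq> 0) \<and>
        (\<forall>v w. (\<exists>c. \<forall>i\<le>N. s i v = c * s i w) \<longrightarrow> point \<Lambda> v = point \<Lambda> w) \<and>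
        (\<forall>v u. (\<exists>c. \<forall>i\<le>N. frechet_derivative (s i) (at v) u = c * s i v) \<longrightarrow> u = 0))"

definition ample :: "(complex ^ 'n) set \<Rightarrow> 'n factor \<Rightarrow> bool" where
  "ample \<Lambda> f \<longleftrightarrow> (\<exists>k\<ge>1. very_ample \<Lambda> (tensor_power f k))"

definition polarised :: "(complex ^ 'n) set \<Rightarrow> 'n factor \<Rightarrow> bool" where
  "polarised \<Lambda> L \<longleftrightarrow> lattice \<Lambda> \<and> line_bundle \<Lambda> L \<and> ample \<Lambda> L"

definition abelian_variety :: "(complex ^ 'n) set \<Rightarrow> bool" where
  "abelian_variety \<Lambda> \<longleftrightarrow> (\<exists>L. polarised \<Lambda> L)"

section \<open>Type of a polarisation\<close>

definition ker_polarising :: "(complex ^ 'n) set \<Rightarrow> 'n factor \<Rightarrow> (complex ^ 'n) set set" where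
  "ker_polarising \<Lambda> L =
     {point \<Lambda> x | x. bundle_iso \<Lambda> (tensor (translate_bundle x L) (dual_bundle L)) trivial_bundle}"

definition type_sequence :: "nat list \<Rightarrow> bool" where
  "type_sequence ds \<longleftrightarrow>
     (\<forall>d\<in>set ds. 0 < d) \<and> (\<forall>i. Suc i < length ds \<longrightarrow> ds ! i dvd ds ! Suc i)"

definition cyclic_product :: "nat list \<Rightarrow> (nat \<Rightarrow> int) monoid" where
  "cyclic_product ds = product_group {..<length ds} (\<lambda>i. integer_mod_group (ds ! i))"

definition polarisation_type :: "(complex ^ 'n) set \<Rightarrow> 'n factor \<Rightarrow> nat list \<Rightarrow> bool" where
  "polarisation_type \<Lambda> L ds \<longleftrightarrow>
     length ds = CARD('n) \<and> type_sequence ds \<and>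
     (torus \<Lambda>)\<lparr>carrier := ker_polarising \<Lambda> L\<rparr> \<cong> cyclic_product ds \<times>\<times> cyclic_product ds"

section \<open>Dual torus\<close>

text \<open>
  The dual torus \<open>Pic\<^sup>0(V / \<Lambda>)\<close> is the space of antilinear forms on \<open>V\<close> modulo the forms whose
  imaginary part is integral on \<open>\<Lambda>\<close>. The class of the antilinear form \<open>l\<close> is
  the bundle \<open>L(0, \<alpha>)\<close> with \<open>\<alpha> \<gamma> = exp (2 \<pi> \<i> Im (l \<gamma>))\<close>. Antilinear forms are written
  in coordinates: the vector \<open>l\<close> stands for the form \<open>apair l\<close>.
\<close>

definition apair :: "complex ^ 'n \<Rightarrow> complex ^ 'n \<Rightarrow> complex" where
  "apair l v = (\<Sum>i\<in>UNIV. l $ i * cnj (v $ i))"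

definition dual_torus :: "(complex ^ 'n) set \<Rightarrow> (complex ^ 'n) set" where
  "dual_torus \<Lambda> = {l. \<forall>\<gamma>\<in>\<Lambda>. Im (apair l \<gamma>) \<in> \<int>}"

definition pic0_bundle :: "complex ^ 'n \<Rightarrow> 'n factor" where
  "pic0_bundle l = appell_humbert (\<lambda>_ _. 0) (\<lambda>\<gamma>. cis (2 * pi * Im (apair l \<gamma>)))"

section \<open>Complementary abelian subvarieties\<close>

text \<open>
  Elements of \<open>Hom(X, Y) \<otimes> \<rat>\<close> are represented faithfully by the linear maps they induce on
  tangent spaces. In this representation the inverse of an isogeny is the inverse linear map, and
  the dual of the homomorphism induced by \<open>F\<close> is composition of antilinear forms with \<open>F\<close>.
\<close>

definition polarising_map :: "(complex ^ 'n) set \<Rightarrow> 'n factor \<Rightarrow> complex ^ 'n \<Rightarrow> complex ^ 'n" where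
  "polarising_map \<Lambda> L =
     (THE F. clinear F \<and>
        (\<forall>x. bundle_iso \<Lambda> (tensor (translate_bundle x L) (dual_bundle L)) (pic0_bundle (F x))))"

text \<open>For \<open>L(H, \<alpha>)\<close> the polarising map is \<open>x \<mapsto> H x \<cdot>\<close>.\<close>

lemma polarising_map_appell_humbert:
  fixes x :: "complex ^ 'n"
  assumes "neron_severi \<Lambda> H" and "semicharacter \<Lambda> H \<alpha>"
  shows "bundle_iso \<Lambda>
    (tensor (translate_bundle x (appell_humbert H \<alpha>)) (dual_bundle (appell_humbert H \<alpha>)))
    (pic0_bundle (\<chi> j. H x (axis j 1)))"
proof -
  have add: "H (u + w) z = H u z + H w z" and scale: "H (c *s u) z = c * H u z"
    and herm: "H w u = cnj (H u w)" for c u w z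
    using assms(1) unfolding neron_severi_def by blast+
  have zero: "H 0 z = 0" for z
    using add[of 0 0 z] by simp
  have expand: "H v z = (\<Sum>j\<in>UNIV. v $ j * H (axis j 1) z)" for v z
  proof -
    have sum: "H (\<Sum>j\<in>S. v $ j *s axis j 1) z = (\<Sum>j\<in>S. v $ j * H (axis j 1) z)" if "finite S" for S
      using that by induction (simp_all add: zero add scale)
    show ?thesis
      using sum[of UNIV] by (simp add: basis_expansion)
  qed
  have pair: "apair (\<chi> j. H x (axis j 1)) \<gamma> = H x \<gamma>" for \<gamma>
  proof -
    have "cnj (H \<gamma> x) = (\<Sum>j\<in>UNIV. cnj (\<gamma> $ j) * cnj (H (axis j 1) x))"
      by (subst expand) simp
    also have "\<dots> = apair (\<chi> j. H x (axis j 1)) \<gamma>"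
      unfolding apair_def by (intro sum.cong) (simp_all add: herm[symmetric] mult.commute)
    finally show ?thesis
      by (simp add: herm[symmetric])
  qed
  define h where "h v = exp (of_real pi * H v x)" for v
  have "holo UNIV h"
    unfolding holo_def
  proof
    fix v
    have "((\<lambda>v. of_real pi * H v x) has_derivative (\<lambda>v. of_real pi * H v x)) (at v)"
      by (subst (1 2) expand)
        (auto intro!: derivative_eq_intros bounded_linear_imp_has_derivative[OF bounded_linear_vec_nth])
    then have "(h has_derivative (\<lambda>u. h v * (of_real pi * H u x))) (at v)"
      unfolding h_def by (rule has_derivative_compose[OF _ DERIV_exp[unfolded has_field_derivative_def]])
    then show "\<exists>D. (h has_derivative D) (at v) \<and> (\<forall>c u. D (c *s u) = c * D u)"
      by (intro exI conjI) (auto simp: scale)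
  qed
  moreover have "h v \<noteq> 0" for v
    by (simp add: h_def)
  moreover have "tensor (translate_bundle x (appell_humbert H \<alpha>)) (dual_bundle (appell_humbert H \<alpha>)) \<gamma> v * h v
      = pic0_bundle (\<chi> j. H x (axis j 1)) \<gamma> v * h (v + \<gamma>)" if "\<gamma> \<in> \<Lambda>" for \<gamma> v
  proof -
    have nz: "\<alpha> \<gamma> \<noteq> 0"
      using assms(2) that unfolding semicharacter_def by force
    have "tensor (translate_bundle x (appell_humbert H \<alpha>)) (dual_bundle (appell_humbert H \<alpha>)) \<gamma> v
        = exp (of_real pi * H x \<gamma>)"
      using nz by (simp add: tensor_def translate_bundle_def dual_bundle_def appell_humbert_def
          exp_minus[symmetric] exp_add[symmetric] add algebra_simps)
    moreover have "of_real pi * H x \<gamma> =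
        \<i> * of_real (2 * pi * Im (H x \<gamma>)) + of_real pi * H \<gamma> x"
      by (subst (3) herm) (simp add: complex_eq_iff)
    moreover have "pic0_bundle (\<chi> j. H x (axis j 1)) \<gamma> v = exp (\<i> * of_real (2 * pi * Im (H x \<gamma>)))"
      by (simp add: pic0_bundle_def appell_humbert_def pair cis_conv_exp)
    moreover have "h (v + \<gamma>) = h v * exp (of_real pi * H \<gamma> x)"
      by (simp add: h_def add exp_add distrib_left)
    ultimately show ?thesis
      by (simp add: exp_add)
  qed
  ultimately show ?thesis
    unfolding bundle_iso_def by blast
qed

definition dual_map :: "(complex ^ 'n \<Rightarrow> complex ^ 'm) \<Rightarrow> complex ^ 'm \<Rightarrow> complex ^ 'n" where
  "dual_map F l = (\<chi> j. apair l (F (axis j 1)))"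

lemma apair_dual_map:
  assumes "clinear F"
  shows "apair (dual_map F l) v = apair l (F v)"
proof -
  have "F v = F (\<Sum>j\<in>UNIV. v $ j *s axis j 1)"
    by (simp add: basis_expansion)
  also have "\<dots> = (\<Sum>j\<in>UNIV. v $ j *s F (axis j 1))"
    using assms by (simp add: vec.linear_sum vec.linear_scale)
  finally have *: "F v $ i = (\<Sum>j\<in>UNIV. v $ j * F (axis j 1) $ i)" for i
    by simp
  show ?thesis
    unfolding apair_def dual_map_def * vec_lambda_beta
    by (simp add: sum_distrib_left sum_distrib_right, subst sum.swap) (simp add: mult_ac)
qed

text \<open>
  An abelian subvariety of \<open>V / \<Lambda>\<close> is given by an injective homomorphism from an abelian variety
  \<open>W / \<Gamma>\<close>, induced by the linear map \<open>\<iota>\<close>.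
\<close>

definition abelian_subvariety ::
  "(complex ^ 'k) set \<Rightarrow> (complex ^ 'k \<Rightarrow> complex ^ 'n) \<Rightarrow> (complex ^ 'n) set \<Rightarrow> bool" where
  "abelian_subvariety \<Gamma> \<iota> \<Lambda> \<longleftrightarrow>
     abelian_variety \<Gamma> \<and> clinear \<iota> \<and> (\<forall>v. \<iota> v \<in> \<Lambda> \<longleftrightarrow> v \<in> \<Gamma>)"

definition symmetric_idempotent ::
  "(complex ^ 'k) set \<Rightarrow> (complex ^ 'k \<Rightarrow> complex ^ 'n) \<Rightarrow> (complex ^ 'n) set \<Rightarrow> 'n factor \<Rightarrow>
   complex ^ 'n \<Rightarrow> complex ^ 'n" where
  "symmetric_idempotent \<Gamma> \<iota> \<Lambda> L =
     \<iota> \<circ> inv_into UNIV (polarising_map \<Gamma> (pullback \<iota> L)) \<circ> dual_map \<iota> \<circ> polarising_map \<Lambda> L"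

definition complementary ::
  "(complex ^ 'k) set \<Rightarrow> (complex ^ 'k \<Rightarrow> complex ^ 'n) \<Rightarrow>
   (complex ^ 'l) set \<Rightarrow> (complex ^ 'l \<Rightarrow> complex ^ 'n) \<Rightarrow>
   (complex ^ 'n) set \<Rightarrow> 'n factor \<Rightarrow> bool" where
  "complementary \<Gamma> \<iota> \<Delta> \<kappa> \<Lambda> L \<longleftrightarrow>
     abelian_subvariety \<Gamma> \<iota> \<Lambda> \<and> abelian_subvariety \<Delta> \<kappa> \<Lambda> \<and>
     (\<forall>v. symmetric_idempotent \<Gamma> \<iota> \<Lambda> L v + symmetric_idempotent \<Delta> \<kappa> \<Lambda> L v = v)"

end

theory Submission
  imports Defs "HOL-Complex_Analysis.Cauchy_Integral_Formula"
begin

text \<open>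
  Write \<open>A\<close> as \<open>V / \<Lambda>\<close>, where \<open>\<Lambda>\<close> is generated by the lattice of \<open>E \<times> B\<close> and a vector \<open>g = (p, q)\<close> over
  \<open>(P, Q)\<close>, and let \<open>d\<close> be the order of \<open>P\<close> and \<open>Q\<close>.

  Let \<open>H\<^sub>E\<close> be the principal form on \<open>E\<close>. The form \<open>H = d H\<^sub>E + H\<^sub>B\<close> on \<open>E \<times> B\<close> has
  \<open>g\<close> in its kernel, since \<open>P\<close> is \<open>d\<close>-torsion and \<open>Q\<close> lies in the kernel \<open>K(L\<^sub>B)\<close> of the given polarisation. A
  cyclic group is isotropic for an alternating form, so \<open>H\<close> is integral on \<open>\<Lambda>\<close>
  (\<open>neron_severi_H\<close>), and a semicharacter extends by extracting a \<open>d\<close>-th root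
  (\<open>semicharacter_extension\<close>). The form is the orthogonal sum of its restrictions to \<open>E\<close> and \<open>B\<close>, so these
  are complementary (\<open>complementary_A\<close>).

  Ampleness on \<open>A\<close> is deduced from ampleness on \<open>E\<close> and \<open>B\<close>, without constructing theta functions.
  The form of any ample bundle on \<open>E\<close> is a positive multiple of a principal one, and this fixes \<open>H\<^sub>E\<close>
  together with its sign (\<open>elliptic_unimodular_basis\<close>). Products of sections embed \<open>E \<times> B\<close>
  (\<open>embedding_sections_box\<close>). Averages of suitable products of sections over the group generated by
  \<open>(P, Q)\<close> are enough to embed the quotient (\<open>embedding_sections_quotient\<close>).

  The kernel of the polarisation on \<open>A\<close> is the orthogonal complement of \<open>g\<close> in
  \<open>E[d] \<times> K(L\<^sub>B)\<close> modulo \<open>g\<close>. As \<open>P\<close> has order exactly \<open>d\<close>, pairing with \<open>P\<close> maps \<open>E[d]\<close> onto \<open>\<int> / d\<close>;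
  thus every element of \<open>K(L\<^sub>B)\<close> can be completed to an element orthogonal to \<open>g\<close> by a multiple of a
  fixed element of \<open>E[d]\<close>, and every class modulo \<open>g\<close> contains exactly one such completion. Hence this kernel is isomorphic to \<open>K(L\<^sub>B)\<close> (\<open>kernel_isomorphic\<close>), which is of type
  \<open>(1, d\<^sub>2, \<dots>, d\<^sub>n)\<close> as soon as it is of type \<open>(d\<^sub>2, \<dots>, d\<^sub>n)\<close>.

  Because \<open>Hom(E, B) = 0\<close>, the elliptic curves isogenous to \<open>E\<close> in \<open>A\<close> and in the dual
  of \<open>A\<close> are unique: they are \<open>E\<close>, and the dual of \<open>A / B = E / \<langle>P\<rangle>\<close>, which is \<open>E / \<langle>P\<rangle>\<close> itself. An
  isomorphism between the dual of \<open>A\<close> and \<open>A\<close> would identify them (\<open>dual_not_isomorphic\<close>).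

  Two facts connect the analytic definitions with linear algebra. Holomorphic homomorphisms lift to
  complex linear maps (\<open>torus_hom_lift\<close>). Isomorphisms between bundles in \<open>Pic\<^sup>0\<close> have periodic
  modulus, hence are constant by Liouville's theorem (\<open>bundle_iso_pic0_bundle\<close>); so the kernel of a
  polarisation and the polarising map can be read off from the Hermitian form.
\<close>

section \<open>Points of a complex torus\<close>

definition add_subgroup :: "(complex ^ 'n) set \<Rightarrow> bool" where
  "add_subgroup \<Lambda> \<longleftrightarrow> 0 \<in> \<Lambda> \<and> (\<forall>x\<in>\<Lambda>. \<forall>y\<in>\<Lambda>. x - y \<in> \<Lambda>)"

lemma add_subgroup_lattice: "lattice \<Lambda> \<Longrightarrow> add_subgroup \<Lambda>"
  by (simp add: lattice_def add_subgroup_def)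

lemma add_subgroup_zero: "add_subgroup \<Lambda> \<Longrightarrow> 0 \<in> \<Lambda>"
  by (simp add: add_subgroup_def)

lemma add_subgroup_diff: "add_subgroup \<Lambda> \<Longrightarrow> x \<in> \<Lambda> \<Longrightarrow> y \<in> \<Lambda> \<Longrightarrow> x - y \<in> \<Lambda>"
  by (simp add: add_subgroup_def)

lemma add_subgroup_minus: "add_subgroup \<Lambda> \<Longrightarrow> x \<in> \<Lambda> \<Longrightarrow> - x \<in> \<Lambda>"
  using add_subgroup_diff[of \<Lambda> 0 x] by (simp add: add_subgroup_zero)

lemma add_subgroup_add: "add_subgroup \<Lambda> \<Longrightarrow> x \<in> \<Lambda> \<Longrightarrow> y \<in> \<Lambda> \<Longrightarrow> x + y \<in> \<Lambda>"
  using add_subgroup_diff[of \<Lambda> x "- y"] by (simp add: add_subgroup_minus)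

lemma add_subgroup_scale_nat: "add_subgroup \<Lambda> \<Longrightarrow> x \<in> \<Lambda> \<Longrightarrow> real k *\<^sub>R x \<in> \<Lambda>"
  by (induction k) (simp_all add: add_subgroup_zero add_subgroup_add scaleR_add_left)

lemma add_subgroup_scale_int: "add_subgroup \<Lambda> \<Longrightarrow> x \<in> \<Lambda> \<Longrightarrow> of_int k *\<^sub>R x \<in> \<Lambda>"
proof -
  assume *: "add_subgroup \<Lambda>" "x \<in> \<Lambda>"
  show ?thesis
  proof (cases "0 \<le> k")
    case True
    then show ?thesis
      using add_subgroup_scale_nat[OF *, of "nat k"] by simp
  next
    case False
    then have "of_int k *\<^sub>R x = - (real (nat (- k)) *\<^sub>R x)" by simp
    then show ?thesis
      using add_subgroup_minus[OF *(1) add_subgroup_scale_nat[OF *, of "nat (- k)"]] by simp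
  qed
qed

lemma add_subgroup_sum: "add_subgroup \<Lambda> \<Longrightarrow> (\<And>i. i \<in> I \<Longrightarrow> f i \<in> \<Lambda>) \<Longrightarrow> sum f I \<in> \<Lambda>"
  by (induction I rule: infinite_finite_induct) (simp_all add: add_subgroup_zero add_subgroup_add)

lemma comm_group_additive_group: "comm_group (additive_group :: (complex ^ 'n) monoid)"
  by (rule comm_groupI) (auto simp: additive_group_def algebra_simps intro: exI[of _ "- _"])

lemma inv_additive_group: "inv\<^bsub>additive_group\<^esub> x = - x" for x :: "complex ^ 'n"
proof -
  interpret comm_group "additive_group :: (complex ^ 'n) monoid"
    by (rule comm_group_additive_group)
  show ?thesis
    by (rule inv_equality) (auto simp: additive_group_def)
qed

lemma subgroup_additive_group:
  assumes "add_subgroup \<Lambda>"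
  shows "subgroup \<Lambda> additive_group"
proof -
  interpret comm_group "additive_group :: (complex ^ 'n) monoid"
    by (rule comm_group_additive_group)
  show ?thesis
    by (rule subgroupI)
      (use assms in \<open>auto simp: inv_additive_group add_subgroup_minus dest: add_subgroup_zero,
        auto simp: additive_group_def intro: add_subgroup_add\<close>)
qed

lemma comm_group_torus: "add_subgroup \<Lambda> \<Longrightarrow> comm_group (torus \<Lambda>)"
  unfolding torus_def
  by (rule comm_group.abelian_FactGroup[OF comm_group_additive_group subgroup_additive_group])

lemma group_torus: "add_subgroup \<Lambda> \<Longrightarrow> group (torus \<Lambda>)"
  by (rule comm_group.axioms(2)[OF comm_group_torus])

lemma point_eq: "point \<Lambda> v = {x. x - v \<in> \<Lambda>}"
  by (force simp: point_def r_coset_def additive_group_def)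

lemma in_point: "add_subgroup \<Lambda> \<Longrightarrow> v \<in> point \<Lambda> v"
  by (simp add: point_eq add_subgroup_zero)

lemma point_eq_iff:
  assumes "add_subgroup \<Lambda>"
  shows "point \<Lambda> v = point \<Lambda> w \<longleftrightarrow> v - w \<in> \<Lambda>"
proof
  assume "point \<Lambda> v = point \<Lambda> w"
  then show "v - w \<in> \<Lambda>"
    using in_point[OF assms, of v] by (simp add: point_eq)
next
  assume *: "v - w \<in> \<Lambda>"
  have "x - v \<in> \<Lambda> \<longleftrightarrow> x - w \<in> \<Lambda>" for x
    using add_subgroup_add[OF assms _ *, of "x - v"] add_subgroup_diff[OF assms _ *, of "x - w"] by auto
  then show "point \<Lambda> v = point \<Lambda> w"
    by (simp add: point_eq)
qed

lemma carrier_torus: "carrier (torus \<Lambda>) = range (point \<Lambda>)"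
  by (auto simp: torus_def FactGroup_def RCOSETS_def point_def additive_group_def)

lemma one_torus: "\<one>\<^bsub>torus \<Lambda>\<^esub> = point \<Lambda> 0"
  by (auto simp: torus_def FactGroup_def point_eq)

lemma mult_torus:
  assumes "add_subgroup \<Lambda>"
  shows "point \<Lambda> v \<otimes>\<^bsub>torus \<Lambda>\<^esub> point \<Lambda> w = point \<Lambda> (v + w)"
proof -
  have "x \<in> point \<Lambda> (v + w)" if "x = a + b" "a - v \<in> \<Lambda>" "b - w \<in> \<Lambda>" for x a b
    using add_subgroup_add[OF assms that(2,3)] that(1) by (simp add: point_eq algebra_simps)
  moreover have "\<exists>a b. a - v \<in> \<Lambda> \<and> b - w \<in> \<Lambda> \<and> x = a + b" if "x \<in> point \<Lambda> (v + w)" for x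
    using that add_subgroup_zero[OF assms]
    by (intro exI[of _ "x - w"] exI[of _ w]) (simp add: point_eq algebra_simps)
  ultimately show ?thesis
    by (auto simp: torus_def FactGroup_def set_mult_def point_eq additive_group_def)
qed

lemma pow_torus:
  assumes "add_subgroup \<Lambda>"
  shows "point \<Lambda> v [^]\<^bsub>torus \<Lambda>\<^esub> (k::nat) = point \<Lambda> (real k *\<^sub>R v)"
proof -
  interpret comm_group "torus \<Lambda>"
    by (rule comm_group_torus[OF assms])
  show ?thesis
    by (induction k) (simp_all add: one_torus mult_torus[OF assms] scaleR_add_left add.commute)
qed

lemma inv_torus:
  assumes "add_subgroup \<Lambda>"
  shows "inv\<^bsub>torus \<Lambda>\<^esub> (point \<Lambda> v) = point \<Lambda> (- v)"
proof -
  interpret comm_group "torus \<Lambda>"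
    by (rule comm_group_torus[OF assms])
  show ?thesis
    by (rule inv_equality) (auto simp: carrier_torus mult_torus[OF assms] one_torus)
qed

lemma int_pow_torus:
  assumes "add_subgroup \<Lambda>"
  shows "point \<Lambda> v [^]\<^bsub>torus \<Lambda>\<^esub> (k::int) = point \<Lambda> (of_int k *\<^sub>R v)"
  by (simp add: int_pow_def2 pow_torus[OF assms] inv_torus[OF assms])

lemma primitive_torsion_point_iff:
  assumes "add_subgroup \<Lambda>" and "primitive_torsion_point \<Lambda> d (point \<Lambda> v)"
  shows "of_int k *\<^sub>R v \<in> \<Lambda> \<longleftrightarrow> int d dvd k"
proof -
  interpret comm_group "torus \<Lambda>"
    by (rule comm_group_torus[OF assms(1)])
  have "int (ord (point \<Lambda> v)) dvd k \<longleftrightarrow> point \<Lambda> v [^]\<^bsub>torus \<Lambda>\<^esub> k = \<one>\<^bsub>torus \<Lambda>\<^esub>"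
    by (rule int_pow_eq_id[symmetric]) (simp add: carrier_torus)
  then show ?thesis
    using assms by (simp add: primitive_torsion_point_def int_pow_torus one_torus point_eq_iff)
qed

lemma quotient_by_point_eq:
  assumes "add_subgroup \<Lambda>"
  shows "quotient_by_point \<Lambda> (point \<Lambda> v) = {x + of_int k *\<^sub>R v | x k. x \<in> \<Lambda>}"
proof -
  interpret comm_group "torus \<Lambda>"
    by (rule comm_group_torus[OF assms])
  have "generate (torus \<Lambda>) {point \<Lambda> v} = {point \<Lambda> v [^]\<^bsub>torus \<Lambda>\<^esub> (k::int) | k. k \<in> UNIV}"
    by (rule generate_pow) (simp add: carrier_torus)
  then have "x \<in> quotient_by_point \<Lambda> (point \<Lambda> v) \<longleftrightarrow> (\<exists>k. x - of_int k *\<^sub>R v \<in> \<Lambda>)" for x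
    unfolding quotient_by_point_def int_pow_torus[OF assms] by (auto simp: point_eq)
  moreover have "(\<exists>k. x - of_int k *\<^sub>R v \<in> \<Lambda>) \<longleftrightarrow> x \<in> {y + of_int k *\<^sub>R v | y k. y \<in> \<Lambda>}" for x
  proof
    assume "\<exists>k. x - of_int k *\<^sub>R v \<in> \<Lambda>"
    then obtain k where "x - of_int k *\<^sub>R v \<in> \<Lambda>" ..
    moreover have "x = (x - of_int k *\<^sub>R v) + of_int k *\<^sub>R v" by simp
    ultimately show "x \<in> {y + of_int k *\<^sub>R v | y k. y \<in> \<Lambda>}" by blast
  next
    assume "x \<in> {y + of_int k *\<^sub>R v | y k. y \<in> \<Lambda>}"
    then obtain y k where "x = y + of_int k *\<^sub>R v" "y \<in> \<Lambda>" by blast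
    then have "x - of_int k *\<^sub>R v \<in> \<Lambda>" by simp
    then show "\<exists>k. x - of_int k *\<^sub>R v \<in> \<Lambda>" ..
  qed
  ultimately show ?thesis by blast
qed

text \<open>
  Every vector is congruent modulo \<open>\<Lambda>\<close> to a combination, with coefficients in \<open>[0, 1]\<close>, of a real
  basis of the space contained in \<open>\<Lambda>\<close>; these combinations are bounded.
\<close>

lemma bounded_representatives:
  fixes \<Lambda> :: "(complex ^ 'n) set"
  assumes "add_subgroup \<Lambda>" and "span \<Lambda> = UNIV"
  obtains r where "\<And>v. \<exists>\<gamma>\<in>\<Lambda>. norm (v + \<gamma>) \<le> r"
proof -
  obtain C where C: "C \<subseteq> \<Lambda>" "independent C" "\<Lambda> \<subseteq> span C"
    using maximal_independent_subset by blast
  have fin: "finite C"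
    using C(2) independent_imp_finite by blast
  have sp: "span C = UNIV"
    using assms(2) span_mono[OF C(3)] unfolding span_span by auto
  have "\<exists>\<gamma>\<in>\<Lambda>. norm (v + \<gamma>) \<le> (\<Sum>b\<in>C. norm b)" for v
  proof -
    obtain u where u: "v = (\<Sum>b\<in>C. u b *\<^sub>R b)"
      using sp span_finite[OF fin] by auto
    define \<gamma> where "\<gamma> = (\<Sum>b\<in>C. of_int (- \<lfloor>u b\<rfloor>) *\<^sub>R b)"
    have "\<gamma> \<in> \<Lambda>"
      unfolding \<gamma>_def using C(1) assms(1) by (intro add_subgroup_sum add_subgroup_scale_int) auto
    moreover have "v + \<gamma> = (\<Sum>b\<in>C. frac (u b) *\<^sub>R b)"
      by (simp add: u \<gamma>_def frac_def sum.distrib[symmetric] scaleR_diff_left)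
    then have "norm (v + \<gamma>) \<le> (\<Sum>b\<in>C. norm (frac (u b) *\<^sub>R b))"
      by (simp only: norm_sum)
    then have "norm (v + \<gamma>) \<le> (\<Sum>b\<in>C. norm b)"
      by (rule order_trans) (intro sum_mono, simp add: mult_left_le_one_le less_imp_le[OF frac_lt_1])
    ultimately show ?thesis by blast
  qed
  then show thesis by (rule that)
qed

section \<open>Holomorphic functions and factors of automorphy\<close>

lemma holo_differentiable: "holo U f \<Longrightarrow> v \<in> U \<Longrightarrow> f differentiable (at v)"
  unfolding holo_def differentiable_def by blast

lemma holo_continuous_on: "holo U f \<Longrightarrow> continuous_on U f"
  by (intro continuous_at_imp_continuous_on ballI differentiable_imp_continuous_within
      holo_differentiable)

lemma holo_has_derivative:
  "holo U f \<Longrightarrow> v \<in> U \<Longrightarrow> (f has_derivative frechet_derivative f (at v)) (at v)"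
  using holo_differentiable frechet_derivative_works by blast

lemma holo_const: "holo U (\<lambda>_. c)"
  unfolding holo_def
proof
  show "\<exists>D. ((\<lambda>_. c) has_derivative D) (at v) \<and> (\<forall>c u. D (c *s u) = c * D u)" for v
    by (rule exI[of _ "\<lambda>_. 0"]) (simp add: has_derivative_const)
qed

lemma holoI:
  assumes "\<And>v. v \<in> U \<Longrightarrow> (f has_derivative D v) (at v)" "\<And>v c u. v \<in> U \<Longrightarrow> D v (c *s u) = c * D v u"
  shows "holo U f"
  unfolding holo_def using assms by blast

lemma holo_frechet_scale:
  assumes "holo U f" "v \<in> U"
  shows "frechet_derivative f (at v) (c *s u) = c * frechet_derivative f (at v) u"
proof -
  obtain D where D: "(f has_derivative D) (at v)" "\<forall>c u. D (c *s u) = c * D u"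
    using assms unfolding holo_def by blast
  then have "frechet_derivative f (at v) = D"
    using frechet_derivative_at by blast
  then show ?thesis using D by simp
qed

lemma holo_mult:
  assumes "holo U f" "holo U g"
  shows "holo U (\<lambda>v. f v * g v)"
proof (rule holoI)
  fix v assume v: "v \<in> U"
  show "((\<lambda>v. f v * g v) has_derivative
    (\<lambda>u. f v * frechet_derivative g (at v) u + frechet_derivative f (at v) u * g v)) (at v)"
    by (rule has_derivative_mult[OF holo_has_derivative[OF assms(1) v] holo_has_derivative[OF assms(2) v]])
  show "f v * frechet_derivative g (at v) (c *s u) + frechet_derivative f (at v) (c *s u) * g v
     = c * (f v * frechet_derivative g (at v) u + frechet_derivative f (at v) u * g v)" for c u
    by (simp add: holo_frechet_scale[OF assms(1) v] holo_frechet_scale[OF assms(2) v] algebra_simps)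
qed

lemma holo_add:
  assumes "holo U f" "holo U g"
  shows "holo U (\<lambda>v. f v + g v)"
proof (rule holoI)
  fix v assume v: "v \<in> U"
  show "((\<lambda>v. f v + g v) has_derivative
    (\<lambda>u. frechet_derivative f (at v) u + frechet_derivative g (at v) u)) (at v)"
    by (rule has_derivative_add[OF holo_has_derivative[OF assms(1) v] holo_has_derivative[OF assms(2) v]])
  show "frechet_derivative f (at v) (c *s u) + frechet_derivative g (at v) (c *s u)
     = c * (frechet_derivative f (at v) u + frechet_derivative g (at v) u)" for c u
    by (simp add: holo_frechet_scale[OF assms(1) v] holo_frechet_scale[OF assms(2) v] algebra_simps)
qed

lemma holo_inverse:
  assumes "holo U f" "\<And>v. v \<in> U \<Longrightarrow> f v \<noteq> 0"
  shows "holo U (\<lambda>v. inverse (f v))"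
proof (rule holoI)
  fix v assume v: "v \<in> U"
  show "((\<lambda>v. inverse (f v)) has_derivative
    (\<lambda>u. - (inverse (f v) * frechet_derivative f (at v) u * inverse (f v)))) (at v)"
    by (rule Deriv.has_derivative_inverse[OF assms(2)[OF v] holo_has_derivative[OF assms(1) v]])
  show "- (inverse (f v) * frechet_derivative f (at v) (c *s u) * inverse (f v))
     = c * - (inverse (f v) * frechet_derivative f (at v) u * inverse (f v))" for c u
    by (simp add: holo_frechet_scale[OF assms(1) v])
qed

lemma holo_compose:
  fixes F :: "complex ^ 'n \<Rightarrow> complex ^ 'm"
  assumes "holo UNIV f" "\<And>v. (F has_derivative D) (at v)" "\<And>c u. D (c *s u) = c *s D u"
  shows "holo UNIV (\<lambda>v. f (F v))"
    and "frechet_derivative (\<lambda>v. f (F v)) (at v) u = frechet_derivative f (at (F v)) (D u)"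
proof -
  have *: "((\<lambda>v. f (F v)) has_derivative (\<lambda>u. frechet_derivative f (at (F v)) (D u))) (at v)" for v
    by (rule has_derivative_compose[OF assms(2) holo_has_derivative[OF assms(1) UNIV_I]])
  show "holo UNIV (\<lambda>v. f (F v))"
    by (rule holoI[OF *]) (simp add: assms(3) holo_frechet_scale[OF assms(1)])
  show "frechet_derivative (\<lambda>v. f (F v)) (at v) u = frechet_derivative f (at (F v)) (D u)"
    by (rule fun_cong[OF frechet_derivative_at[OF *, symmetric]])
qed

lemma scaleR_eq_of_real_vec: "r *\<^sub>R v = complex_of_real r *s v"
  by (simp add: vec_eq_iff) (simp add: scaleR_conv_of_real)

lemma has_derivative_scale_vec: "((\<lambda>z::complex. z *s u) has_derivative (\<lambda>z. z *s u)) (at z)"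
proof (rule bounded_linear_imp_has_derivative, rule linear_conv_bounded_linear[THEN iffD1], rule linearI)
  show "(a + b) *s u = a *s u + b *s u" for a b
    by (rule vector_sadd_rdistrib)
  show "(r *\<^sub>R b) *s u = r *\<^sub>R (b *s u)" for r b
    by (simp add: vec_eq_iff)
qed

lemma holo_line:
  assumes "holo UNIV h"
  shows "(\<lambda>z. h (v + z *s u)) holomorphic_on UNIV"
proof -
  have "((\<lambda>z. h (v + z *s u)) has_field_derivative frechet_derivative h (at (v + z *s u)) u) (at z)" for z
  proof -
    have "((\<lambda>z. v + z *s u) has_derivative (\<lambda>z. z *s u)) (at z)"
      using has_derivative_add[OF has_derivative_const[of v] has_derivative_scale_vec[of u z]] by simp
    from has_derivative_compose[OF this holo_has_derivative[OF assms UNIV_I]]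
    have "((\<lambda>z. h (v + z *s u)) has_derivative
      (\<lambda>y. frechet_derivative h (at (v + z *s u)) (y *s u))) (at z)" .
    moreover have "(\<lambda>y. frechet_derivative h (at (v + z *s u)) (y *s u))
      = (*) (frechet_derivative h (at (v + z *s u)) u)"
      by (rule ext) (simp add: holo_frechet_scale[OF assms] mult.commute)
    ultimately show ?thesis by (simp add: has_field_derivative_def)
  qed
  then show ?thesis
    unfolding holomorphic_on_def field_differentiable_def by blast
qed

text \<open>
  The modulus descends to the compact torus, so the function is bounded; Liouville's theorem on
  each complex line makes it constant.
\<close>

lemma holo_periodic_modulus_const:
  fixes \<Lambda> :: "(complex ^ 'n) set"
  assumes \<Lambda>: "add_subgroup \<Lambda>" "span \<Lambda> = UNIV" and h: "holo UNIV h"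
    and per: "\<And>\<gamma> v. \<gamma> \<in> \<Lambda> \<Longrightarrow> norm (h (v + \<gamma>)) = norm (h v)"
  shows "h v = h w"
proof -
  obtain r where r: "\<And>v. \<exists>\<gamma>\<in>\<Lambda>. norm (v + \<gamma>) \<le> r"
    by (rule bounded_representatives[OF \<Lambda>]) blast
  have "continuous_on (cball 0 r) h"
    by (rule continuous_on_subset[OF holo_continuous_on[OF h] subset_UNIV])
  then have "compact (h ` cball 0 r)"
    by (rule compact_continuous_image) simp
  from compact_imp_bounded[OF this] obtain K where "\<forall>y\<in>h ` cball 0 r. norm y \<le> K"
    unfolding bounded_iff ..
  then have K: "\<And>x. x \<in> cball 0 r \<Longrightarrow> norm (h x) \<le> K"
    by simp
  have bnd: "norm (h x) \<le> K" for x
  proof -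
    obtain \<gamma> where "\<gamma> \<in> \<Lambda>" "norm (x + \<gamma>) \<le> r" using r[of x] by blast
    then show ?thesis using K[of "x + \<gamma>"] per[of \<gamma> x] by simp
  qed
  have "bounded (range (\<lambda>z. h (v + z *s (w - v))))"
    using bnd by (auto simp: bounded_iff)
  from Liouville_theorem[OF holo_line[OF h] this]
  obtain c where c: "\<And>z. h (v + z *s (w - v)) = c"
    by (auto simp: constant_on_def)
  show ?thesis
    using c[of 0] c[of 1] by (simp add: vector_smult_lzero)
qed

lemma cis_2pi_eq_iff: "cis (2 * pi * a) = cis (2 * pi * b) \<longleftrightarrow> a - b \<in> \<int>"
proof -
  have "cis (2 * pi * a) = cis (2 * pi * b) \<longleftrightarrow> cis (2 * pi * (a - b)) = 1"
    by (simp add: right_diff_distrib cis_divide[symmetric])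
  also have "\<dots> \<longleftrightarrow> a - b \<in> \<int>"
  proof
    assume "cis (2 * pi * (a - b)) = 1"
    then have "cos (2 * pi * (a - b)) = 1" by (simp add: complex_eq_iff)
    then obtain k :: int where "2 * pi * (a - b) = of_int k * 2 * pi"
      unfolding cos_one_2pi_int by blast
    then have "pi * (a - b) = pi * of_int k" by (simp add: mult_ac)
    then have "a - b = of_int k" by (simp only: mult_cancel_left pi_neq_zero simp_thms)
    then show "a - b \<in> \<int>" by simp
  qed (rule cis_multiple_2pi)
  finally show ?thesis .
qed

lemma pic0_bundle_eq: "pic0_bundle l \<gamma> v = cis (2 * pi * Im (apair l \<gamma>))"
  by (simp add: pic0_bundle_def appell_humbert_def)

text \<open>
  The bundles in \<open>Pic\<^sup>0\<close> have constant factors of automorphy of modulus 1, so an isomorphism between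
  two of them is a function with periodic modulus, hence a constant.
\<close>

lemma bundle_iso_pic0_bundle:
  fixes \<Lambda> :: "(complex ^ 'n) set"
  assumes \<Lambda>: "add_subgroup \<Lambda>" "span \<Lambda> = UNIV"
  shows "bundle_iso \<Lambda> (pic0_bundle l) (pic0_bundle l') \<longleftrightarrow> (\<forall>\<gamma>\<in>\<Lambda>. Im (apair l \<gamma>) - Im (apair l' \<gamma>) \<in> \<int>)"
proof
  assume "bundle_iso \<Lambda> (pic0_bundle l) (pic0_bundle l')"
  then obtain h where h: "holo UNIV h" "\<And>v. h v \<noteq> 0"
    "\<And>\<gamma> v. \<gamma> \<in> \<Lambda> \<Longrightarrow> pic0_bundle l \<gamma> v * h v = pic0_bundle l' \<gamma> v * h (v + \<gamma>)"
    unfolding bundle_iso_def by blast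
  have const: "h v = h w" for v w
  proof (rule holo_periodic_modulus_const[OF \<Lambda> h(1)])
    fix \<gamma> v assume "\<gamma> \<in> \<Lambda>"
    then show "norm (h (v + \<gamma>)) = norm (h v)"
      using arg_cong[OF h(3)[of \<gamma> v], of norm] by (simp add: pic0_bundle_eq norm_mult)
  qed
  show "\<forall>\<gamma>\<in>\<Lambda>. Im (apair l \<gamma>) - Im (apair l' \<gamma>) \<in> \<int>"
  proof
    fix \<gamma> assume "\<gamma> \<in> \<Lambda>"
    then have *: "pic0_bundle l \<gamma> 0 * h 0 = pic0_bundle l' \<gamma> 0 * h (0 + \<gamma>)"
      by (rule h(3))
    have "pic0_bundle l \<gamma> 0 = pic0_bundle l' \<gamma> 0"
      by (rule iffD1[OF mult_right_cancel[OF h(2)] *[unfolded const[of "0 + \<gamma>" 0]]])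
    then show "Im (apair l \<gamma>) - Im (apair l' \<gamma>) \<in> \<int>"
      unfolding pic0_bundle_eq cis_2pi_eq_iff .
  qed
next
  assume "\<forall>\<gamma>\<in>\<Lambda>. Im (apair l \<gamma>) - Im (apair l' \<gamma>) \<in> \<int>"
  then have "\<forall>\<gamma>\<in>\<Lambda>. \<forall>v. pic0_bundle l \<gamma> v * 1 = pic0_bundle l' \<gamma> v * 1"
    unfolding pic0_bundle_eq mult_1_right cis_2pi_eq_iff by blast
  then show "bundle_iso \<Lambda> (pic0_bundle l) (pic0_bundle l')"
    unfolding bundle_iso_def by (intro exI[of _ "\<lambda>_. 1"] conjI allI holo_const) simp_all
qed

lemma bundle_iso_sym:
  assumes "bundle_iso \<Lambda> f g"
  shows "bundle_iso \<Lambda> g f"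
proof -
  obtain h where h: "holo UNIV h" "\<forall>v. h v \<noteq> 0" "\<forall>\<gamma>\<in>\<Lambda>. \<forall>v. f \<gamma> v * h v = g \<gamma> v * h (v + \<gamma>)"
    using assms unfolding bundle_iso_def by blast
  have "g \<gamma> v * inverse (h v) = f \<gamma> v * inverse (h (v + \<gamma>))" if "\<gamma> \<in> \<Lambda>" for \<gamma> v
    using h(2,3) that by (simp add: field_simps)
  moreover have "holo UNIV (\<lambda>v. inverse (h v))"
    using holo_inverse[OF h(1)] h(2) by blast
  ultimately show ?thesis
    unfolding bundle_iso_def using h(2) by (intro exI[of _ "\<lambda>v. inverse (h v)"]) simp
qed

lemma bundle_iso_trans:
  assumes "bundle_iso \<Lambda> f g" "bundle_iso \<Lambda> g k"
  shows "bundle_iso \<Lambda> f k"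
proof -
  obtain h where h: "holo UNIV h" "\<forall>v. h v \<noteq> 0" "\<forall>\<gamma>\<in>\<Lambda>. \<forall>v. f \<gamma> v * h v = g \<gamma> v * h (v + \<gamma>)"
    using assms unfolding bundle_iso_def by blast
  obtain h' where h': "holo UNIV h'" "\<forall>v. h' v \<noteq> 0" "\<forall>\<gamma>\<in>\<Lambda>. \<forall>v. g \<gamma> v * h' v = k \<gamma> v * h' (v + \<gamma>)"
    using assms unfolding bundle_iso_def by blast
  have "f \<gamma> v * (h v * h' v) = k \<gamma> v * (h (v + \<gamma>) * h' (v + \<gamma>))" if "\<gamma> \<in> \<Lambda>" for \<gamma> v
  proof -
    have "f \<gamma> v * (h v * h' v) = (f \<gamma> v * h v) * h' v" by simp
    also have "\<dots> = (g \<gamma> v * h' v) * h (v + \<gamma>)" using h(3) that by (simp add: mult_ac)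
    also have "\<dots> = k \<gamma> v * (h (v + \<gamma>) * h' (v + \<gamma>))" using h'(3) that by (simp add: mult_ac)
    finally show ?thesis .
  qed
  moreover have "holo UNIV (\<lambda>v. h v * h' v)"
    by (rule holo_mult[OF h(1) h'(1)])
  ultimately show ?thesis
    unfolding bundle_iso_def using h(2) h'(2) by (intro exI[of _ "\<lambda>v. h v * h' v"]) simp
qed

section \<open>Hermitian forms and the polarising isogeny\<close>

lemma
  assumes "neron_severi \<Lambda> H"
  shows neron_severi_add_left: "H (u + v) w = H u w + H v w"
    and neron_severi_scale_left: "H (c *s v) w = c * H v w"
    and neron_severi_cnj: "H w v = cnj (H v w)"
    and neron_severi_integral: "\<gamma> \<in> \<Lambda> \<Longrightarrow> \<gamma>' \<in> \<Lambda> \<Longrightarrow> Im (H \<gamma> \<gamma>') \<in> \<int>"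
  using assms unfolding neron_severi_def by blast+

lemma
  assumes "neron_severi \<Lambda> H"
  shows neron_severi_add_right: "H w (u + v) = H w u + H w v"
    and neron_severi_scale_right: "H w (c *s v) = cnj c * H w v"
    and neron_severi_zero_left: "H 0 w = 0"
    and neron_severi_zero_right: "H w 0 = 0"
    and neron_severi_Im_swap: "Im (H w v) = - Im (H v w)"
    and neron_severi_Im_same: "Im (H v v) = 0"
proof -
  show *: "H w (u + v) = H w u + H w v" for u v w
    by (subst (1 2 3) neron_severi_cnj[OF assms]) (simp add: neron_severi_add_left[OF assms])
  show "H w (c *s v) = cnj c * H w v"
    by (subst (1 2) neron_severi_cnj[OF assms]) (simp add: neron_severi_scale_left[OF assms])
  show "H 0 w = 0" using neron_severi_add_left[OF assms, of 0 0 w] by simp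
  show "H w 0 = 0" using *[of w 0 0] by simp
  show sw: "Im (H w v) = - Im (H v w)" for v w
    by (subst neron_severi_cnj[OF assms]) simp
  show "Im (H v v) = 0" using sw[of v v] by simp
qed

lemma
  assumes "neron_severi \<Lambda> H"
  shows neron_severi_scaleR_left: "H (r *\<^sub>R v) w = of_real r * H v w"
    and neron_severi_scaleR_right: "H v (r *\<^sub>R w) = of_real r * H v w"
    and neron_severi_minus_left: "H (- v) w = - H v w"

    and neron_severi_diff_left: "H (u - v) w = H u w - H v w"

proof -
  show l: "H (r *\<^sub>R v) w = of_real r * H v w" for r v w
    by (simp add: scaleR_eq_of_real_vec neron_severi_scale_left[OF assms])
  show "H v (r *\<^sub>R w) = of_real r * H v w"
    by (simp add: scaleR_eq_of_real_vec neron_severi_scale_right[OF assms])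
  show ml: "H (- v) w = - H v w" for v w using l[of "-1" v w] by simp

  show "H (u - v) w = H u w - H v w"
    using neron_severi_add_left[OF assms, of u "- v" w] by (simp add: ml)

qed

lemmas neron_severi_linear = neron_severi_add_left neron_severi_add_right neron_severi_scaleR_left
  neron_severi_scaleR_right neron_severi_minus_left neron_severi_diff_left neron_severi_Im_same

lemma neron_severi_subset: "neron_severi \<Lambda> H \<Longrightarrow> \<Gamma> \<subseteq> \<Lambda> \<Longrightarrow> neron_severi \<Gamma> H"
  unfolding neron_severi_def by blast


lemma apair_polarising:
  assumes "neron_severi \<Lambda> H"
  shows "apair (\<chi> j. H x (axis j 1)) v = H x v"
proof -
  have sum: "H x (\<Sum>j\<in>S. v $ j *s axis j 1) = (\<Sum>j\<in>S. cnj (v $ j) * H x (axis j 1))" if "finite S" for S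
    using that
    by induction (simp_all add: neron_severi_zero_right[OF assms] neron_severi_add_right[OF assms]
        neron_severi_scale_right[OF assms])
  then show ?thesis
    using sum[of UNIV] by (simp add: basis_expansion apair_def mult.commute)
qed


lemma apair_diff_left: "apair (l - l') v = apair l v - apair l' v"
  by (simp add: apair_def sum_subtractf algebra_simps)

lemma apair_scale_left: "apair (c *s l) v = c * apair l v"
  by (simp add: apair_def sum_distrib_left algebra_simps)

lemma apair_add_right: "apair l (u + v) = apair l u + apair l v"
  by (simp add: apair_def sum.distrib algebra_simps)

lemma apair_scale_right: "apair l (c *s v) = cnj c * apair l v"
  by (simp add: apair_def sum_distrib_left algebra_simps)

lemma apair_axis: "apair l (axis j c) = l $ j * cnj c"
proof -
  have "apair l (axis j c) = (\<Sum>i\<in>UNIV. if i = j then l $ j * cnj c else 0)"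
    unfolding apair_def by (rule sum.cong) (auto simp: axis_def)
  then show ?thesis by simp
qed

text \<open>
  An antilinear form is determined by its imaginary part: its value at \<open>\<i> v\<close> recovers the real part.
\<close>

lemma apair_eq_zero:
  fixes \<Lambda> :: "(complex ^ 'n) set"
  assumes "span \<Lambda> = UNIV" and "\<And>\<gamma>. \<gamma> \<in> \<Lambda> \<Longrightarrow> Im (apair l \<gamma>) = 0"
  shows "l = 0"
proof -
  have Im0: "Im (apair l v) = 0" for v
  proof -
    have "v \<in> span \<Lambda>" using assms(1) by simp
    then show ?thesis
    proof (induction rule: span_induct_alt)
      case base then show ?case by (simp add: apair_def)
    next
      case (step c x y)
      then show ?case
        by (simp add: apair_add_right scaleR_eq_of_real_vec apair_scale_right assms(2))
    qed
  qed
  have "l $ j = 0" for j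
  proof -
    have *: "Im (z * cnj (\<i> * z)) = - (Re z ^ 2 + Im z ^ 2)" for z
      by (simp add: power2_eq_square)
    have "Re (l $ j) ^ 2 + Im (l $ j) ^ 2 = 0"
      using Im0[of "axis j (\<i> * l $ j)"] *[of "l $ j"] unfolding apair_axis by linarith
    then show ?thesis by (simp add: complex_eq_iff sum_power2_eq_zero_iff)
  qed
  then show ?thesis by (simp add: vec_eq_iff)
qed

lemma ker_polarising_appell_humbert:
  fixes \<Lambda> :: "(complex ^ 'n) set"
  assumes \<Lambda>: "add_subgroup \<Lambda>" "span \<Lambda> = UNIV" and H: "neron_severi \<Lambda> H" and \<alpha>: "semicharacter \<Lambda> H \<alpha>"
  shows "ker_polarising \<Lambda> (appell_humbert H \<alpha>) = point \<Lambda> ` {x. \<forall>\<gamma>\<in>\<Lambda>. Im (H x \<gamma>) \<in> \<int>}"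
proof -
  let ?L = "appell_humbert H \<alpha>"
  have triv: "trivial_bundle = pic0_bundle 0"
    by (rule ext, rule ext) (simp add: trivial_bundle_def pic0_bundle_eq apair_def)
  have "bundle_iso \<Lambda> (tensor (translate_bundle x ?L) (dual_bundle ?L)) trivial_bundle
      \<longleftrightarrow> (\<forall>\<gamma>\<in>\<Lambda>. Im (H x \<gamma>) \<in> \<int>)" for x
  proof -
    note iso = polarising_map_appell_humbert[OF H \<alpha>, of x]
    have "bundle_iso \<Lambda> (tensor (translate_bundle x ?L) (dual_bundle ?L)) trivial_bundle
      \<longleftrightarrow> bundle_iso \<Lambda> (pic0_bundle (\<chi> j. H x (axis j 1))) trivial_bundle"
      using bundle_iso_trans[OF iso] bundle_iso_trans[OF bundle_iso_sym[OF iso]] by blast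
    then show ?thesis
      unfolding triv bundle_iso_pic0_bundle[OF \<Lambda>] apair_polarising[OF H] by (simp add: apair_def)
  qed
  then show ?thesis
    unfolding ker_polarising_def by blast
qed

lemma Ints_scale_imp_zero:
  fixes a :: real
  assumes "\<And>t. t * a \<in> \<int>"
  shows "a = 0"
proof (rule ccontr)
  assume "a \<noteq> 0"
  then have "(1 / 2 :: real) \<in> \<int>" using assms[of "1 / (2 * a)"] by simp
  then obtain k :: int where k: "(1 / 2 :: real) = of_int k" by (rule Ints_cases)
  then have "of_int (2 * k) = (1 :: real)" by simp
  then have "2 * k = 1" by linarith
  then show False by presburger
qed

text \<open>
  Two linear maps inducing the same homomorphism to \<open>Pic\<^sup>0\<close> differ by a linear map all of whose values
  are forms with integral imaginary part on \<open>\<Lambda>\<close>; these values can be scaled, so they vanish.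
\<close>

lemma polarising_map_eq:
  fixes \<Lambda> :: "(complex ^ 'n) set"
  assumes \<Lambda>: "add_subgroup \<Lambda>" "span \<Lambda> = UNIV" and H: "neron_severi \<Lambda> H" and \<alpha>: "semicharacter \<Lambda> H \<alpha>"
  shows "polarising_map \<Lambda> (appell_humbert H \<alpha>) = (\<lambda>x. \<chi> j. H x (axis j 1))"
  unfolding polarising_map_def
proof (rule the_equality)
  let ?L = "appell_humbert H \<alpha>" and ?F = "\<lambda>x. \<chi> j. H x (axis j 1)"
  have "clinear ?F"
    by unfold_locales
      (simp_all add: vec_eq_iff neron_severi_add_left[OF H] neron_severi_scale_left[OF H] algebra_simps)
  then show "clinear ?F \<and> (\<forall>x. bundle_iso \<Lambda> (tensor (translate_bundle x ?L) (dual_bundle ?L)) (pic0_bundle (?F x)))"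
    using polarising_map_appell_humbert[OF H \<alpha>] by blast
  fix G
  assume G: "clinear G \<and> (\<forall>x. bundle_iso \<Lambda> (tensor (translate_bundle x ?L) (dual_bundle ?L)) (pic0_bundle (G x)))"
  show "G = ?F"
  proof
    fix x
    have "G x - ?F x = 0"
    proof (rule apair_eq_zero[OF \<Lambda>(2)])
      fix \<gamma> assume \<gamma>: "\<gamma> \<in> \<Lambda>"
      show "Im (apair (G x - ?F x) \<gamma>) = 0"
      proof (rule Ints_scale_imp_zero)
        fix t :: real
        let ?y = "of_real t *s x"
        have "bundle_iso \<Lambda> (pic0_bundle (G ?y)) (pic0_bundle (?F ?y))"
          by (rule bundle_iso_trans[OF bundle_iso_sym polarising_map_appell_humbert[OF H \<alpha>]])
            (use G in blast)
        then have "Im (apair (G ?y) \<gamma>) - Im (apair (?F ?y) \<gamma>) \<in> \<int>"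
          using \<gamma> unfolding bundle_iso_pic0_bundle[OF \<Lambda>] by blast
        then have "Im (apair (G ?y) \<gamma>) - Im (H ?y \<gamma>) \<in> \<int>"
          unfolding apair_polarising[OF H] .
        moreover have "G ?y = of_real t *s G x"
          using G vec.linear_scale by blast
        ultimately show "t * Im (apair (G x - ?F x) \<gamma>) \<in> \<int>"
          by (simp add: apair_diff_left apair_scale_left apair_polarising[OF H]
              neron_severi_scale_left[OF H] right_diff_distrib)
      qed
    qed
    then show "G x = ?F x" by simp
  qed
qed

section \<open>Homomorphisms of tori and linear maps\<close>

definition discrete_vectors :: "(complex ^ 'n) set \<Rightarrow> bool" where
  "discrete_vectors \<Lambda> \<longleftrightarrow> (\<exists>e>0. \<forall>x\<in>\<Lambda>. x \<noteq> 0 \<longrightarrow> e \<le> norm x)"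

lemma discrete_lattice: "lattice \<Lambda> \<Longrightarrow> discrete_vectors \<Lambda>"
  by (simp add: lattice_def discrete_vectors_def)

lemma clinearI:
  assumes "\<And>u v. F (u + v) = F u + F v" "\<And>c v. F (c *s v) = c *s F v"
  shows "clinear F"
  by unfold_locales (simp_all add: assms algebra_simps)

lemma clinear_scaleR: "clinear F \<Longrightarrow> F (r *\<^sub>R v) = r *\<^sub>R F v"
  by (simp add: scaleR_eq_of_real_vec vec.linear_scale)

lemma clinear_has_derivative:
  fixes F :: "complex ^ 'n \<Rightarrow> complex ^ 'm"
  assumes "clinear F"
  shows "(F has_derivative F) (at v)"
proof (rule bounded_linear_imp_has_derivative, rule linear_conv_bounded_linear[THEN iffD1], rule linearI)
  show "F (a + b) = F a + F b" for a b
    by (rule vec.linear_add[OF assms])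
  show "F (r *\<^sub>R b) = r *\<^sub>R F b" for r b
    by (rule clinear_scaleR[OF assms])
qed

lemma clinear_holo_map:
  assumes "clinear F"
  shows "holo_map U F"
  unfolding holo_map_def
proof
  fix i
  show "holo U (\<lambda>v. F v $ i)"
  proof (rule holoI)
    show "((\<lambda>v. F v $ i) has_derivative (\<lambda>v. F v $ i)) (at v)" for v
      by (rule bounded_linear.has_derivative[OF bounded_linear_vec_nth clinear_has_derivative[OF assms]])
    show "F (c *s u) $ i = c * F u $ i" for c u
      by (simp add: vec.linear_scale[OF assms])
  qed
qed

text \<open>A nonzero value could be scaled to be shorter than every nonzero vector of \<open>\<Lambda>\<close>.\<close>

lemma clinear_discrete_zero:
  assumes "clinear F" and "discrete_vectors \<Lambda>" and "\<And>v. F v \<in> \<Lambda>"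
  shows "F v = 0"
proof (rule ccontr)
  assume nz: "F v \<noteq> 0"
  obtain e where e: "e > 0" "\<And>x. x \<in> \<Lambda> \<Longrightarrow> x \<noteq> 0 \<Longrightarrow> e \<le> norm x"
    using assms(2) unfolding discrete_vectors_def by blast
  have "e \<le> norm (F ((e / (2 * norm (F v))) *\<^sub>R v))"
    using e(1) nz by (intro e(2) assms(3)) (simp add: clinear_scaleR[OF assms(1)])
  then show False
    using e(1) nz by (simp add: clinear_scaleR[OF assms(1)])
qed

text \<open>
  Near the origin a homomorphism lifts to a holomorphic map \<open>F\<close> of vector spaces. It is additive up to
  elements of the discrete target lattice, and small ones vanish, so \<open>F - F 0\<close> is additive on a ball.
  Rescaling by powers of 2 identifies it there with its derivative at the origin, which is complex
  linear; divisibility of the torus extends the identity from the ball to all points.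
\<close>

lemma torus_hom_lift:
  fixes \<Lambda> :: "(complex ^ 'n) set" and \<Lambda>' :: "(complex ^ 'm) set"
  assumes \<Lambda>: "add_subgroup \<Lambda>" and \<Lambda>': "add_subgroup \<Lambda>'" "discrete_vectors \<Lambda>'"
    and f: "torus_hom \<Lambda> \<Lambda>' f"
  obtains M where "clinear M" "\<And>v. f (point \<Lambda> v) = point \<Lambda>' (M v)"
proof -
  obtain U F where U: "open U" "0 \<in> U" and F: "holo_map U F"
    and fF: "\<And>u. u \<in> U \<Longrightarrow> f (point \<Lambda> u) = point \<Lambda>' (F u)"
    using f unfolding torus_hom_def by blast
  have hom: "f \<in> hom (torus \<Lambda>) (torus \<Lambda>')"
    using f unfolding torus_hom_def by blast
  interpret group_hom "torus \<Lambda>" "torus \<Lambda>'" f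
    by (intro group_hom.intro group_torus \<Lambda> \<Lambda>' group_hom_axioms.intro hom)
  \<comment> \<open>Only \<open>F 0 \<in> \<Lambda>'\<close> is known, since \<open>F\<close> is determined up to lattice vectors.\<close>
  define G where "G u = F u - F 0" for u
  define M where "M u = (\<chi> i. frechet_derivative (\<lambda>v. F v $ i) (at 0) u)" for u
  have hi: "holo U (\<lambda>v. F v $ i)" for i
    using F unfolding holo_map_def by blast
  have D: "((\<lambda>v. F v $ i) has_derivative (\<lambda>u. M u $ i)) (at 0)" for i
    using holo_has_derivative[OF hi U(2)] by (simp add: M_def)
  have lin: "clinear M"
  proof (rule clinearI)
    show "M (u + v) = M u + M v" for u v
      using linear_add[OF has_derivative_linear[OF D]] by (simp add: vec_eq_iff)
    show "M (c *s v) = c *s M v" for c v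
      by (simp add: vec_eq_iff M_def holo_frechet_scale[OF hi U(2)])
  qed
  have F0: "F 0 \<in> \<Lambda>'"
    using hom_one fF[OF U(2)] by (simp add: one_torus point_eq_iff[OF \<Lambda>'(1)])
  obtain e where e: "e > 0" "\<And>x. x \<in> \<Lambda>' \<Longrightarrow> x \<noteq> 0 \<Longrightarrow> e \<le> norm x"
    using \<Lambda>'(2) unfolding discrete_vectors_def by blast
  have "((\<lambda>u. \<chi> i. F u $ i) \<longlongrightarrow> (\<chi> i. F 0 $ i)) (at 0)"
  proof (rule vec_tendstoI)
    fix i
    show "((\<lambda>x. (\<chi> i. F x $ i) $ i) \<longlongrightarrow> (\<chi> i. F 0 $ i) $ i) (at 0)"
      using has_derivative_continuous[OF D[of i]] by (simp add: continuous_within)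
  qed
  then have "(F \<longlongrightarrow> F 0) (at 0)"
    by (simp only: vec_nth_inverse)
  then have "isCont F 0"
    by (simp only: isCont_def)
  moreover have "0 < e / 3" using e(1) by simp
  ultimately obtain s where s: "s > 0" "\<And>u. dist u 0 < s \<Longrightarrow> dist (F u) (F 0) < e / 3"
    unfolding continuous_at_eps_delta by blast
  obtain r where r: "r > 0" "ball 0 r \<subseteq> U"
    using U open_contains_ball by blast
  define \<delta> where "\<delta> = min r s"
  have \<delta>: "\<delta> > 0" "\<And>u. norm u < \<delta> \<Longrightarrow> u \<in> U" "\<And>u. norm u < \<delta> \<Longrightarrow> norm (G u) < e / 3"
    using r s by (auto simp: \<delta>_def G_def dist_norm subset_eq)
  have add: "G (u + v) = G u + G v" if uv: "norm u < \<delta>" "norm v < \<delta>" "norm (u + v) < \<delta>" for u v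
  proof -
    have "point \<Lambda>' (F (u + v)) = f (point \<Lambda> u \<otimes>\<^bsub>torus \<Lambda>\<^esub> point \<Lambda> v)"
      by (simp add: mult_torus[OF \<Lambda>] fF \<delta>(2) uv)
    also have "\<dots> = f (point \<Lambda> u) \<otimes>\<^bsub>torus \<Lambda>'\<^esub> f (point \<Lambda> v)"
      by (rule hom_mult) (simp_all add: carrier_torus)
    also have "\<dots> = point \<Lambda>' (F u + F v)"
      by (simp add: mult_torus[OF \<Lambda>'(1)] fF \<delta>(2) uv)
    finally have "F (u + v) - (F u + F v) \<in> \<Lambda>'"
      by (simp add: point_eq_iff[OF \<Lambda>'(1)])
    then have "F (u + v) - (F u + F v) + F 0 \<in> \<Lambda>'"
      by (rule add_subgroup_add[OF \<Lambda>'(1) _ F0])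
    moreover have "F (u + v) - (F u + F v) + F 0 = G (u + v) - (G u + G v)"
      by (simp add: G_def)
    ultimately have *: "G (u + v) - (G u + G v) \<in> \<Lambda>'" by simp
    have "norm (G (u + v) - (G u + G v)) \<le> norm (G (u + v)) + (norm (G u) + norm (G v))"
      by (rule order_trans[OF norm_triangle_ineq4]) (simp add: norm_triangle_ineq)
    also have "\<dots> < e"
      using \<delta>(3)[OF uv(1)] \<delta>(3)[OF uv(2)] \<delta>(3)[OF uv(3)] by linarith
    finally show ?thesis
      using e(2)[OF *] by force
  qed
  have halve: "G u = 2 ^ k *\<^sub>R G ((1 / 2) ^ k *\<^sub>R u)" if "norm u < \<delta>" for u k
  proof (induction k)
    case (Suc k)
    let ?w = "(1 / 2) ^ Suc k *\<^sub>R u"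
    have le: "norm ((1 / 2) ^ j *\<^sub>R u) < \<delta>" for j :: nat
    proof -
      have "norm ((1 / 2) ^ j *\<^sub>R u) \<le> norm u"
        by (simp add: mult_left_le_one_le power_le_one)
      then show ?thesis using that by linarith
    qed
    have sum: "?w + ?w = (1 / 2) ^ k *\<^sub>R u"
      by (simp add: scaleR_left_distrib[symmetric])
    have "G ((1 / 2) ^ k *\<^sub>R u) = G ?w + G ?w"
      using add[of ?w ?w] le[of "Suc k"] le[of k] unfolding sum by blast
    then show ?case
      using Suc by (simp add: scaleR_2[symmetric] mult.commute)
  qed simp
  have GM: "G u = M u" if "norm u < \<delta>" for u
  proof (cases "u = 0")
    case True
    then show ?thesis
      using vec.linear_0[OF lin] by (simp add: G_def)
  next
    case False
    have "G u $ i = M u $ i" for i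
    proof -
      let ?y = "\<lambda>k::nat. (1 / 2 :: real) ^ k *\<^sub>R u"
      have "((\<lambda>y. norm (F y $ i - F 0 $ i - M y $ i) / norm y) \<longlongrightarrow> 0) (at 0)"
        using D[of i] by (simp add: has_derivative_iff_norm)
      moreover have "filterlim ?y (at 0) sequentially"
      proof -
        have "?y \<longlonglongrightarrow> 0 *\<^sub>R u"
          by (intro tendsto_scaleR LIMSEQ_realpow_zero tendsto_const) auto
        then show ?thesis using False by (simp add: filterlim_at)
      qed
      ultimately have "(\<lambda>k. norm (F (?y k) $ i - F 0 $ i - M (?y k) $ i) / norm (?y k)) \<longlonglongrightarrow> 0"
        by (rule filterlim_compose)
      moreover have "norm (F (?y k) $ i - F 0 $ i - M (?y k) $ i) / norm (?y k)
          = norm (G u $ i - M u $ i) / norm u" for k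
      proof -
        have "F (?y k) $ i - F 0 $ i = (1 / 2) ^ k *\<^sub>R (G u $ i)"
          by (subst halve[OF that, of k]) (simp add: G_def power_mult_distrib[symmetric])
        then have "F (?y k) $ i - F 0 $ i - M (?y k) $ i = (1 / 2) ^ k *\<^sub>R (G u $ i - M u $ i)"
          by (simp add: clinear_scaleR[OF lin] scaleR_diff_right)
        then show ?thesis by simp
      qed
      ultimately have "norm (G u $ i - M u $ i) / norm u = 0"
        by (simp add: LIMSEQ_const_iff)
      then show ?thesis using False by simp
    qed
    then show ?thesis by (simp add: vec_eq_iff)
  qed
  have "f (point \<Lambda> v) = point \<Lambda>' (M v)" for v
  proof -
    obtain N :: nat where N: "norm v / \<delta> < real N"
      using reals_Archimedean2 by blast
    have Npos: "0 < real N"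
      using N \<delta>(1) by (metis divide_nonneg_pos le_less_trans norm_ge_zero)
    define w where "w = (1 / real N) *\<^sub>R v"
    have w: "norm w < \<delta>"
      using N Npos \<delta>(1) by (simp add: w_def field_simps)
    have v: "v = real N *\<^sub>R w"
      using Npos by (simp add: w_def)
    have "f (point \<Lambda> v) = f (point \<Lambda> w [^]\<^bsub>torus \<Lambda>\<^esub> N)"
      by (simp add: pow_torus[OF \<Lambda>] v)
    also have "\<dots> = f (point \<Lambda> w) [^]\<^bsub>torus \<Lambda>'\<^esub> N"
      by (rule hom_nat_pow) (simp add: carrier_torus)
    also have "\<dots> = point \<Lambda>' (real N *\<^sub>R F w)"
      by (simp add: fF \<delta>(2) w pow_torus[OF \<Lambda>'(1)])
    also have "\<dots> = point \<Lambda>' (M v)"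
    proof -
      have "real N *\<^sub>R F w - M v = real N *\<^sub>R F 0"
        using GM[OF w] by (simp add: v clinear_scaleR[OF lin] G_def algebra_simps)
      then show ?thesis
        by (simp add: point_eq_iff[OF \<Lambda>'(1)] add_subgroup_scale_nat[OF \<Lambda>'(1) F0])
    qed
    finally show ?thesis .
  qed
  with lin show thesis by (rule that)
qed

lemma torus_hom_of_clinear:
  fixes \<Lambda> :: "(complex ^ 'n) set" and \<Lambda>' :: "(complex ^ 'm) set"
  assumes "add_subgroup \<Lambda>" "add_subgroup \<Lambda>'" "clinear M" and f: "\<And>v. f (point \<Lambda> v) = point \<Lambda>' (M v)"
  shows "torus_hom \<Lambda> \<Lambda>' f"
  unfolding torus_hom_def
proof (intro conjI homI allI)
  fix x assume "x \<in> carrier (torus \<Lambda>)"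
  then show "f x \<in> carrier (torus \<Lambda>')" by (auto simp: carrier_torus f)
next
  fix x y assume "x \<in> carrier (torus \<Lambda>)" "y \<in> carrier (torus \<Lambda>)"
  then obtain v w where [simp]: "x = point \<Lambda> v" "y = point \<Lambda> w" by (auto simp: carrier_torus)
  show "f (x \<otimes>\<^bsub>torus \<Lambda>\<^esub> y) = f x \<otimes>\<^bsub>torus \<Lambda>'\<^esub> f y"
    by (simp add: mult_torus assms vec.linear_add[OF assms(3)])
next
  fix v
  show "\<exists>U F. open U \<and> v \<in> U \<and> holo_map U F \<and> (\<forall>u\<in>U. f (point \<Lambda> u) = point \<Lambda>' (F u))"
    using clinear_holo_map[OF assms(3), of UNIV] f by (intro exI[of _ UNIV] exI[of _ M]) simp
qed

lemma induced_torus_map: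
  fixes \<Lambda> :: "(complex ^ 'n) set" and \<Lambda>' :: "(complex ^ 'm) set"
  assumes "add_subgroup \<Lambda>" "add_subgroup \<Lambda>'" "clinear M" "M ` \<Lambda> \<subseteq> \<Lambda>'"
  obtains f where "\<And>v. f (point \<Lambda> v) = point \<Lambda>' (M v)"
proof
  define f where "f x = point \<Lambda>' (M (SOME v. v \<in> x))" for x
  fix v
  have "(SOME v'. v' \<in> point \<Lambda> v) \<in> point \<Lambda> v"
    using in_point[OF assms(1)] by (rule someI)
  then have "(SOME v'. v' \<in> point \<Lambda> v) - v \<in> \<Lambda>" by (simp add: point_eq)
  then have "M (SOME v'. v' \<in> point \<Lambda> v) - M v \<in> \<Lambda>'"
    using assms(4) by (auto simp: vec.linear_diff[OF assms(3), symmetric])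
  then show "f (point \<Lambda> v) = point \<Lambda>' (M v)"
    by (simp add: f_def point_eq_iff[OF assms(2)])
qed

lemma torus_isomorphicI:
  fixes \<Lambda> :: "(complex ^ 'n) set" and \<Lambda>' :: "(complex ^ 'm) set"
  assumes \<Lambda>: "add_subgroup \<Lambda>" "add_subgroup \<Lambda>'"
    and M: "clinear M" "M ` \<Lambda> \<subseteq> \<Lambda>'" and N: "clinear N" "N ` \<Lambda>' \<subseteq> \<Lambda>"
    and inv: "\<And>v. N (M v) = v" "\<And>w. M (N w) = w"
  shows "torus_isomorphic \<Lambda> \<Lambda>'"
proof -
  obtain f where f: "\<And>v. f (point \<Lambda> v) = point \<Lambda>' (M v)"
    using induced_torus_map[OF \<Lambda> M] by auto
  obtain h where h: "\<And>w. h (point \<Lambda>' w) = point \<Lambda> (N w)"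
    using induced_torus_map[OF \<Lambda>(2,1) N] by auto
  have bij: "bij_betw f (carrier (torus \<Lambda>)) (carrier (torus \<Lambda>'))"
    by (rule bij_betw_byWitness[of _ h]) (auto simp: carrier_torus f h inv)
  have "inv_into (carrier (torus \<Lambda>)) f (point \<Lambda>' w) = point \<Lambda> (N w)" for w
    using inv_into_f_f[OF bij_betw_imp_inj_on[OF bij], of "point \<Lambda> (N w)"]
    by (simp add: f inv carrier_torus)
  then have "torus_hom \<Lambda>' \<Lambda> (inv_into (carrier (torus \<Lambda>)) f)"
    by (rule torus_hom_of_clinear[OF \<Lambda>(2,1) N(1)])
  moreover have "torus_hom \<Lambda> \<Lambda>' f"
    by (rule torus_hom_of_clinear[OF \<Lambda> M(1) f])
  ultimately show ?thesis
    unfolding torus_isomorphic_def using bij by blast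
qed

lemma torus_isomorphicE:
  fixes \<Lambda> :: "(complex ^ 'n) set" and \<Lambda>' :: "(complex ^ 'm) set"
  assumes \<Lambda>: "add_subgroup \<Lambda>" "discrete_vectors \<Lambda>" and \<Lambda>': "add_subgroup \<Lambda>'" "discrete_vectors \<Lambda>'"
    and iso: "torus_isomorphic \<Lambda> \<Lambda>'"
  obtains M N where "clinear M" "M ` \<Lambda> \<subseteq> \<Lambda>'" "clinear N" "N ` \<Lambda>' \<subseteq> \<Lambda>" "\<And>v. N (M v) = v"
proof -
  obtain f where f: "torus_hom \<Lambda> \<Lambda>' f" "bij_betw f (carrier (torus \<Lambda>)) (carrier (torus \<Lambda>'))"
    "torus_hom \<Lambda>' \<Lambda> (inv_into (carrier (torus \<Lambda>)) f)"
    using iso unfolding torus_isomorphic_def by blast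
  let ?g = "inv_into (carrier (torus \<Lambda>)) f"
  obtain M where M: "clinear M" "\<And>v. f (point \<Lambda> v) = point \<Lambda>' (M v)"
    using torus_hom_lift[OF \<Lambda>(1) \<Lambda>' f(1)] by blast
  obtain N where N: "clinear N" "\<And>v. ?g (point \<Lambda>' v) = point \<Lambda> (N v)"
    using torus_hom_lift[OF \<Lambda>'(1) \<Lambda> f(3)] by blast
  have image: "F ` \<Gamma> \<subseteq> \<Gamma>'"
    if F: "clinear F" "\<And>v. h (point \<Gamma> v) = point \<Gamma>' (F v)" and "add_subgroup \<Gamma>" "add_subgroup \<Gamma>'"
    for F :: "complex ^ 'k \<Rightarrow> complex ^ 'l" and h \<Gamma> \<Gamma>'
  proof
    fix y assume "y \<in> F ` \<Gamma>"
    then obtain v where v: "v \<in> \<Gamma>" "y = F v" by blast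
    then have "point \<Gamma> v = point \<Gamma> 0" by (simp add: point_eq_iff[OF that(3)])
    then have "point \<Gamma>' (F v) = point \<Gamma>' (F 0)" using F(2) by metis
    then show "y \<in> \<Gamma>'" using v by (simp add: point_eq_iff[OF that(4)] vec.linear_0[OF F(1)])
  qed
  have "N (M v) - v = 0" for v
  proof (rule clinear_discrete_zero[of "\<lambda>v. N (M v) - v", OF _ \<Lambda>(2)])
    show "clinear (\<lambda>v. N (M v) - v)"
      by (rule clinearI) (simp_all add: vec.linear_add[OF M(1)] vec.linear_add[OF N(1)]
          vec.linear_scale[OF M(1)] vec.linear_scale[OF N(1)] vector_ssub_ldistrib)
    fix v
    have "point \<Lambda> v \<in> carrier (torus \<Lambda>)" by (simp add: carrier_torus)
    from bij_betw_inv_into_left[OF f(2) this] have "point \<Lambda> (N (M v)) = point \<Lambda> v"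
      unfolding M(2) N(2) .
    then show "N (M v) - v \<in> \<Lambda>" by (simp add: point_eq_iff[OF \<Lambda>(1)])
  qed
  then have "N (M v) = v" for v by simp
  then show thesis
    by (rule that[OF M(1) image[OF M \<Lambda>(1) \<Lambda>'(1)] N(1) image[OF N \<Lambda>'(1) \<Lambda>(1)]])
qed

lemma hom_trivialD:
  fixes \<Lambda> :: "(complex ^ 'n) set" and \<Lambda>' :: "(complex ^ 'm) set"
  assumes "hom_trivial \<Lambda> \<Lambda>'" "add_subgroup \<Lambda>" "add_subgroup \<Lambda>'" "discrete_vectors \<Lambda>'"
    and M: "clinear M" "M ` \<Lambda> \<subseteq> \<Lambda>'"
  shows "M v = 0"
proof (rule clinear_discrete_zero[OF M(1) assms(4)])
  fix v
  obtain f where f: "\<And>v. f (point \<Lambda> v) = point \<Lambda>' (M v)"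
    using induced_torus_map[OF assms(2,3) M] by auto
  have "f (point \<Lambda> v) = \<one>\<^bsub>torus \<Lambda>'\<^esub>"
    using assms(1) torus_hom_of_clinear[OF assms(2,3) M(1) f]
    unfolding hom_trivial_def carrier_torus by blast
  then show "M v \<in> \<Lambda>'"
    by (simp add: f one_torus point_eq_iff[OF assms(3)])
qed

section \<open>Very ample bundles\<close>

text \<open>
  The span is given by closure rules, so that closure under products and averages, and the transfer
  of identities from generators, are inductions.
\<close>

inductive_set fspan :: "('a \<Rightarrow> complex) set \<Rightarrow> ('a \<Rightarrow> complex) set" for S where
  fspan_base: "s \<in> S \<Longrightarrow> s \<in> fspan S"
| fspan_add: "s \<in> fspan S \<Longrightarrow> t \<in> fspan S \<Longrightarrow> (\<lambda>v. s v + t v) \<in> fspan S"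
| fspan_scale: "s \<in> fspan S \<Longrightarrow> (\<lambda>v. c * s v) \<in> fspan S"

lemma fspan_mult_compose:
  assumes "s \<in> fspan S" "t \<in> fspan T"
  shows "(\<lambda>x. s (f x) * t (g x)) \<in> fspan {\<lambda>x. a (f x) * b (g x) | a b. a \<in> S \<and> b \<in> T}"
proof -
  let ?P = "{\<lambda>x. a (f x) * b (g x) | a b. a \<in> S \<and> b \<in> T}"
  have *: "(\<lambda>x. a (f x) * t (g x)) \<in> fspan ?P" if "a \<in> S" for a
    using assms(2)
  proof induction
    case (fspan_base b)
    then show ?case using that by (intro fspan.fspan_base) blast
  next
    case (fspan_add t t')
    show ?case using fspan.fspan_add[OF fspan_add.IH] by (simp add: distrib_left)
  next
    case (fspan_scale t c)
    show ?case using fspan.fspan_scale[OF fspan_scale.IH, of c] by (simp add: mult_ac)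
  qed
  show ?thesis
    using assms(1)
  proof induction
    case (fspan_base a)
    then show ?case by (rule *)
  next
    case (fspan_add s s')
    show ?case using fspan.fspan_add[OF fspan_add.IH] by (simp add: distrib_right)
  next
    case (fspan_scale s c)
    show ?case using fspan.fspan_scale[OF fspan_scale.IH, of c] by (simp add: mult_ac)
  qed
qed

lemma holo_fspan:
  assumes "\<And>s. s \<in> S \<Longrightarrow> holo U s" and "s \<in> fspan S"
  shows "holo U s"
  using assms(2)
  by induction (simp_all add: assms(1) holo_add holo_mult[OF holo_const])

lemma frechet_derivative_mult:
  assumes "holo U s" "holo U t" "v \<in> U"
  shows "frechet_derivative (\<lambda>v. s v * t v) (at v) u
    = s v * frechet_derivative t (at v) u + frechet_derivative s (at v) u * t v"
  by (rule fun_cong[OF frechet_derivative_at[symmetric, OF has_derivative_mult]])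
    (rule holo_has_derivative[OF assms(1,3)], rule holo_has_derivative[OF assms(2,3)])

lemma frechet_derivative_add:
  assumes "holo U s" "holo U t" "v \<in> U"
  shows "frechet_derivative (\<lambda>v. s v + t v) (at v) u
    = frechet_derivative s (at v) u + frechet_derivative t (at v) u"
  by (rule fun_cong[OF frechet_derivative_at[symmetric, OF has_derivative_add]])
    (rule holo_has_derivative[OF assms(1,3)], rule holo_has_derivative[OF assms(2,3)])

lemma frechet_derivative_cmult:
  assumes "holo U s" "v \<in> U"
  shows "frechet_derivative (\<lambda>v. c * s v) (at v) u = c * frechet_derivative s (at v) u"
  by (rule fun_cong[OF frechet_derivative_at[symmetric, OF has_derivative_mult_right]])
    (rule holo_has_derivative[OF assms])

text \<open>
  Proportionality of the values of finitely many sections at two points passes to their linear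
  combinations, and two vectors are not proportional when a linear form kills only one of them. So
  very ampleness amounts to finding, in the span, sections that vanish at one point and not at
  another, or that vanish at a point but not along a given tangent vector. In this form it is
  compatible with products and averages.
\<close>

definition embedding_sections ::
  "(complex ^ 'n) set \<Rightarrow> 'n factor \<Rightarrow> (complex ^ 'n \<Rightarrow> complex) set \<Rightarrow> bool" where
  "embedding_sections \<Lambda> f S \<longleftrightarrow> finite S \<and> (\<forall>s\<in>S. bundle_section \<Lambda> f s) \<and>
     (\<forall>v. \<exists>s\<in>fspan S. s v \<noteq> 0) \<and>
     (\<forall>v w. point \<Lambda> v \<noteq> point \<Lambda> w \<longrightarrow> (\<exists>s\<in>fspan S. s v \<noteq> 0 \<and> s w = 0)) \<and>
     (\<forall>v u. u \<noteq> 0 \<longrightarrow> (\<exists>s\<in>fspan S. s v = 0 \<and> frechet_derivative s (at v) u \<noteq> 0))"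

lemma embedding_sectionsD:
  assumes "embedding_sections \<Lambda> f S"
  shows "finite S" and "\<And>s. s \<in> S \<Longrightarrow> bundle_section \<Lambda> f s" and "\<And>v. \<exists>s\<in>fspan S. s v \<noteq> 0"
    and "\<And>v w. point \<Lambda> v \<noteq> point \<Lambda> w \<Longrightarrow> \<exists>s\<in>fspan S. s v \<noteq> 0 \<and> s w = 0"
    and "\<And>v u. u \<noteq> 0 \<Longrightarrow> \<exists>s\<in>fspan S. s v = 0 \<and> frechet_derivative s (at v) u \<noteq> 0"
  using assms unfolding embedding_sections_def by blast+

lemma embedding_sections_holo:
  "embedding_sections \<Lambda> f S \<Longrightarrow> s \<in> fspan S \<Longrightarrow> holo UNIV s"
  by (rule holo_fspan) (auto simp: embedding_sections_def bundle_section_def)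

lemma very_ample_imp_embedding_sections:
  fixes \<Lambda> :: "(complex ^ 'n) set"
  assumes "very_ample \<Lambda> f"
  obtains S where "embedding_sections \<Lambda> f S"
proof -
  obtain N :: nat and s where s: "\<And>i. i \<le> N \<Longrightarrow> bundle_section \<Lambda> f (s i)"
    "\<And>v. \<exists>i\<le>N. s i v \<noteq> 0"
    "\<And>v w c. \<forall>i\<le>N. s i v = c * s i w \<Longrightarrow> point \<Lambda> v = point \<Lambda> w"
    "\<And>v u c. \<forall>i\<le>N. frechet_derivative (s i) (at v) u = c * s i v \<Longrightarrow> u = 0"
    using assms unfolding very_ample_def by blast
  define S where "S = s ` {..N}"
  have sp: "s i \<in> fspan S" if "i \<le> N" for i
    using that by (intro fspan_base) (simp add: S_def)
  have ho: "holo UNIV (s i)" if "i \<le> N" for i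
    using s(1)[OF that] by (simp add: bundle_section_def)
  have comb: "(\<lambda>v. s i v * a + s j v * b) \<in> fspan S" if "i \<le> N" "j \<le> N" for i j a b
    using fspan_add[OF fspan_scale[OF sp[OF that(1)], of a] fspan_scale[OF sp[OF that(2)], of b]]
    by (simp add: mult.commute)
  have "embedding_sections \<Lambda> f S"
    unfolding embedding_sections_def
  proof (intro conjI allI impI ballI)
    show "finite S" by (simp add: S_def)
    show "bundle_section \<Lambda> f t" if "t \<in> S" for t using that s(1) by (auto simp: S_def)
    show "\<exists>s\<in>fspan S. s v \<noteq> 0" for v
      using s(2)[of v] sp by blast
    fix v w assume ne: "point \<Lambda> v \<noteq> point \<Lambda> w"
    obtain j where j: "j \<le> N" "s j w \<noteq> 0" using s(2) by blast
    have "\<not> (\<forall>i\<le>N. s i v = (s j v / s j w) * s i w)"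
      using s(3) ne by blast
    then obtain i where i: "i \<le> N" "s i v \<noteq> (s j v / s j w) * s i w" by blast
    have "s i v * s j w + s j v * - s i w \<noteq> 0"
      using i(2) j(2) by (simp add: field_simps)
    then show "\<exists>s\<in>fspan S. s v \<noteq> 0 \<and> s w = 0"
      by (intro bexI[OF _ comb[OF i(1) j(1), of "s j w" "- s i w"]]) (simp add: mult.commute)
  next
    fix v and u :: "complex ^ 'n" assume ne: "u \<noteq> 0"
    obtain j where j: "j \<le> N" "s j v \<noteq> 0" using s(2) by blast
    let ?D = "\<lambda>i. frechet_derivative (s i) (at v) u"
    have "\<not> (\<forall>i\<le>N. ?D i = (?D j / s j v) * s i v)"
      using s(4) ne by blast
    then obtain i where i: "i \<le> N" "?D i \<noteq> (?D j / s j v) * s i v" by blast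
    have "frechet_derivative (\<lambda>v'. s i v' * s j v + s j v' * - s i v) (at v) u = ?D i * s j v + ?D j * - s i v"
      using frechet_derivative_add[OF holo_mult[OF ho[OF i(1)] holo_const] holo_mult[OF ho[OF j(1)] holo_const]
          UNIV_I, of "s j v" "- s i v" v u]
        frechet_derivative_cmult[OF ho[OF i(1)] UNIV_I, of "s j v" v u]
        frechet_derivative_cmult[OF ho[OF j(1)] UNIV_I, of "- s i v" v u]
      by (simp only: mult.commute)
    also have "\<dots> \<noteq> 0"
      using i(2) j(2) by (simp add: field_simps)
    finally show "\<exists>s\<in>fspan S. s v = 0 \<and> frechet_derivative s (at v) u \<noteq> 0"
      by (intro bexI[OF _ comb[OF i(1) j(1), of "s j v" "- s i v"]]) (simp add: mult.commute)
  qed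
  then show thesis by (rule that)
qed

lemma embedding_sections_imp_very_ample:
  fixes \<Lambda> :: "(complex ^ 'n) set"
  assumes "embedding_sections \<Lambda> f S"
  shows "very_ample \<Lambda> f"
proof -
  note S = embedding_sectionsD[OF assms]
  have ho: "holo UNIV s" if "s \<in> fspan S" for s
    using embedding_sections_holo[OF assms that] .
  have proportional: "s v = c * s w" if "\<And>s. s \<in> S \<Longrightarrow> s v = c * s w" "s \<in> fspan S" for s v w c
    using that(2) by induction (simp_all add: that(1) distrib_left)
  have tangent: "frechet_derivative s (at v) u = c * s v"
    if "\<And>s. s \<in> S \<Longrightarrow> frechet_derivative s (at v) u = c * s v" "s \<in> fspan S" for s v u c
    using that(2)
  proof induction
    case (fspan_base s) then show ?case by (rule that(1))
  next
    case (fspan_add s t)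
    then show ?case
      by (simp add: frechet_derivative_add[OF ho ho UNIV_I] distrib_left)
  next
    case (fspan_scale s a)
    then show ?case
      by (simp add: frechet_derivative_cmult[OF ho UNIV_I])
  qed
  have nonvanishing: "\<exists>s\<in>S. s v \<noteq> 0" for v
  proof (rule ccontr)
    assume "\<not> ?thesis"
    then have "s v = 0 * s v" if "s \<in> fspan S" for s using proportional[of v 0 v s] that by simp
    then show False using S(3)[of v] by auto
  qed
  obtain h where h: "S = h ` {i::nat. i < card S}"
    using finite_imp_nat_seg_image_inj_on[OF S(1)] card_image
    by (metis card_Collect_less_nat)
  have "S \<noteq> {}" using nonvanishing by blast
  then have card: "card S = Suc (card S - 1)" using S(1) by (simp add: card_gt_0_iff)
  define N where "N = card S - 1"
  have hS: "h i \<in> S" if "i \<le> N" for i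
    using that card h unfolding N_def by (metis (mono_tags, lifting) imageI le_imp_less_Suc mem_Collect_eq)
  have Sh: "\<exists>i\<le>N. s = h i" if "s \<in> S" for s
    using that card h unfolding N_def by (metis (mono_tags, lifting) imageE less_Suc_eq_le mem_Collect_eq)
  show ?thesis
    unfolding very_ample_def
  proof (rule exI[of _ N], rule exI[of _ h], intro conjI allI impI)
    show "bundle_section \<Lambda> f (h i)" if "i \<le> N" for i using hS[OF that] by (rule S(2))
    show "\<exists>i\<le>N. h i v \<noteq> 0" for v
    proof -
      obtain s where s: "s \<in> S" "s v \<noteq> 0" using nonvanishing by blast
      obtain i where "i \<le> N" "s = h i" using Sh[OF s(1)] by blast
      then show ?thesis using s(2) by blast
    qed
    show "point \<Lambda> v = point \<Lambda> w" if pr: "\<exists>c. \<forall>i\<le>N. h i v = c * h i w" for v w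
    proof (rule ccontr)
      assume "point \<Lambda> v \<noteq> point \<Lambda> w"
      then obtain s where s: "s \<in> fspan S" "s v \<noteq> 0" "s w = 0" using S(4) by blast
      obtain c where "\<forall>i\<le>N. h i v = c * h i w" using pr by blast
      then have "t v = c * t w" if "t \<in> S" for t using Sh[OF that] by blast
      then have "s v = c * s w" by (rule proportional[OF _ s(1)])
      then show False using s by simp
    qed
    show "u = 0" if pr: "\<exists>c. \<forall>i\<le>N. frechet_derivative (h i) (at v) u = c * h i v" for v u
    proof (rule ccontr)
      assume "u \<noteq> 0"
      then obtain s where s: "s \<in> fspan S" "s v = 0" "frechet_derivative s (at v) u \<noteq> 0"
        using S(5) by blast
      obtain c where "\<forall>i\<le>N. frechet_derivative (h i) (at v) u = c * h i v" using pr by blast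
      then have "frechet_derivative t (at v) u = c * t v" if "t \<in> S" for t using Sh[OF that] by blast
      then have "frechet_derivative s (at v) u = c * s v" by (rule tangent[OF _ s(1)])
      then show False using s by simp
    qed
  qed
qed

lemma embedding_sections_cong:
  assumes "embedding_sections \<Lambda> f S" "\<And>\<gamma> v. \<gamma> \<in> \<Lambda> \<Longrightarrow> f \<gamma> v = g \<gamma> v"
  shows "embedding_sections \<Lambda> g S"
  using assms unfolding embedding_sections_def bundle_section_def by auto

primrec monomials :: "('a \<Rightarrow> complex) set \<Rightarrow> nat \<Rightarrow> ('a \<Rightarrow> complex) set" where
  "monomials S 0 = {\<lambda>_. 1}"
| "monomials S (Suc n) = {\<lambda>v. a v * b v | a b. a \<in> S \<and> b \<in> monomials S n}"

lemma finite_products: "finite S \<Longrightarrow> finite T \<Longrightarrow> finite {\<lambda>x. a (f x) * b (g x) | a b. a \<in> S \<and> b \<in> T}"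
  using finite_image_set2[of "\<lambda>a. a \<in> S" "\<lambda>b. b \<in> T" "\<lambda>a b x. a (f x) * b (g x)"] by simp

lemma finite_monomials: "finite S \<Longrightarrow> finite (monomials S n)"
  by (induction n) (simp_all add: finite_products[where f = "\<lambda>x. x" and g = "\<lambda>x. x"])

lemma prod_in_fspan_monomials:
  assumes "finite I" "\<And>i. i \<in> I \<Longrightarrow> t i \<in> fspan S"
  shows "(\<lambda>v. \<Prod>i\<in>I. t i v) \<in> fspan (monomials S (card I))"
  using assms
proof (induction I rule: finite_induct)
  case empty
  then show ?case by (simp add: fspan_base)
next
  case (insert i I)
  then show ?case
    using fspan_mult_compose[of "t i" S "\<lambda>v. \<Prod>i\<in>I. t i v" "monomials S (card I)" "\<lambda>x. x" "\<lambda>x. x"]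
    by simp
qed

lemma bundle_section_mult:
  "bundle_section \<Lambda> f s \<Longrightarrow> bundle_section \<Lambda> g t \<Longrightarrow> bundle_section \<Lambda> (tensor f g) (\<lambda>v. s v * t v)"
  by (simp add: bundle_section_def tensor_def holo_mult mult_ac)

lemma bundle_section_monomials:
  assumes "\<And>s. s \<in> S \<Longrightarrow> bundle_section \<Lambda> f s" "t \<in> monomials S n"
  shows "bundle_section \<Lambda> (tensor_power f n) t"
  using assms(2)
proof (induction n arbitrary: t)
  case 0
  then show ?case by (simp add: bundle_section_def tensor_power_def holo_const)
next
  case (Suc n)
  then obtain a b where ab: "t = (\<lambda>v. a v * b v)" "a \<in> S" "b \<in> monomials S n" by auto
  have "tensor_power f (Suc n) = tensor f (tensor_power f n)"
    by (simp add: tensor_power_def tensor_def)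
  then show ?case
    using bundle_section_mult[OF assms(1)[OF ab(2)] Suc.IH[OF ab(3)]] by (simp add: ab(1))
qed

lemma embedding_sections_power:
  fixes \<Lambda> :: "(complex ^ 'n) set"
  assumes emb: "embedding_sections \<Lambda> f S" and "n \<ge> 1"
  shows "embedding_sections \<Lambda> (tensor_power f n) (monomials S n)"
proof -
  note S = embedding_sectionsD[OF emb]
  have ho: "holo UNIV s" if "s \<in> fspan S" for s
    using embedding_sections_holo[OF emb that] .
  obtain m where m: "n = Suc m" using \<open>n \<ge> 1\<close> by (cases n) auto
  have pow: "(\<lambda>v. t v ^ k) \<in> fspan (monomials S k)" if "t \<in> fspan S" for t k
    using prod_in_fspan_monomials[of "{..<k}" "\<lambda>_. t" S] that by simp
  have mult: "(\<lambda>v. s v * t v ^ m) \<in> fspan (monomials S n)" if "s \<in> fspan S" "t \<in> fspan S" for s t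
    using fspan_mult_compose[OF that(1) pow[OF that(2), of m], of "\<lambda>x. x" "\<lambda>x. x"] by (simp add: m)
  have ho_pow: "holo UNIV (\<lambda>v. t v ^ k)" if "t \<in> fspan S" for t k
    using ho[OF that] by (induction k) (simp_all add: holo_const holo_mult)
  show ?thesis
    unfolding embedding_sections_def
  proof (intro conjI allI impI ballI)
    show "finite (monomials S n)" by (rule finite_monomials[OF S(1)])
    show "bundle_section \<Lambda> (tensor_power f n) t" if "t \<in> monomials S n" for t
      using bundle_section_monomials[OF S(2) that] .
    show "\<exists>s\<in>fspan (monomials S n). s v \<noteq> 0" for v
    proof -
      obtain s where "s \<in> fspan S" "s v \<noteq> 0" using S(3) by blast
      then show ?thesis by (intro bexI[OF _ mult[of s s]]) simp_all
    qed
    show "\<exists>s\<in>fspan (monomials S n). s v \<noteq> 0 \<and> s w = 0" if ne: "point \<Lambda> v \<noteq> point \<Lambda> w" for v w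
    proof -
      obtain s where "s \<in> fspan S" "s v \<noteq> 0" "s w = 0" using S(4) ne by blast
      then show ?thesis by (intro bexI[OF _ mult[of s s]]) simp_all
    qed
    fix v and u :: "complex ^ 'n" assume "u \<noteq> 0"
    then obtain s where s: "s \<in> fspan S" "s v = 0" "frechet_derivative s (at v) u \<noteq> 0" using S(5) by blast
    obtain t where t: "t \<in> fspan S" "t v \<noteq> 0" using S(3) by blast
    have "frechet_derivative (\<lambda>v. s v * t v ^ m) (at v) u = frechet_derivative s (at v) u * t v ^ m"
      by (simp add: frechet_derivative_mult[OF ho[OF s(1)] ho_pow[OF t(1)] UNIV_I] s(2))
    then show "\<exists>s\<in>fspan (monomials S n). s v = 0 \<and> frechet_derivative s (at v) u \<noteq> 0"
      using s t by (intro bexI[OF _ mult[OF s(1) t(1)]]) simp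
  qed
qed

subsection \<open>Products\<close>

definition vfst :: "complex ^ ('n + 'm::finite) \<Rightarrow> complex ^ 'n" where
  "vfst x = (\<chi> i. x $ Inl i)"

definition vsnd :: "complex ^ ('n::finite + 'm) \<Rightarrow> complex ^ 'm" where
  "vsnd x = (\<chi> i. x $ Inr i)"

lemma vfst_vjoin [simp]: "vfst (vjoin v w) = v"
  by (simp add: vfst_def vjoin_def)

lemma vsnd_vjoin [simp]: "vsnd (vjoin v w) = w"
  by (simp add: vsnd_def vjoin_def)

lemma vjoin_vfst_vsnd [simp]: "vjoin (vfst x) (vsnd x) = x"
  by (simp add: vfst_def vsnd_def vjoin_def vec_eq_iff split: sum.split)

lemma vprod_iff: "x \<in> vprod S T \<longleftrightarrow> vfst x \<in> S \<and> vsnd x \<in> T"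
proof
  assume "vfst x \<in> S \<and> vsnd x \<in> T"
  moreover have "x = vjoin (vfst x) (vsnd x)" by simp
  ultimately show "x \<in> vprod S T" unfolding vprod_def by blast
qed (auto simp: vprod_def)

lemma clinear_vfst: "clinear vfst" and clinear_vsnd: "clinear vsnd"
  by (rule clinearI; simp add: vfst_def vsnd_def vec_eq_iff)+

lemma clinear_vjoin: "clinear F \<Longrightarrow> clinear G \<Longrightarrow> clinear (\<lambda>x. vjoin (F x) (G x))"
  by (rule clinearI) (auto simp: vjoin_def vec_eq_iff vec.linear_add vec.linear_scale split: sum.split)

lemma clinear_zero: "clinear (\<lambda>_. 0)" and clinear_ident: "clinear (\<lambda>x. x)"
  by (rule clinearI; simp)+

lemmas vfst_simps [simp] = vec.linear_add[OF clinear_vfst] vec.linear_diff[OF clinear_vfst]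
  vec.linear_neg[OF clinear_vfst] vec.linear_0[OF clinear_vfst] vec.linear_scale[OF clinear_vfst]
  clinear_scaleR[OF clinear_vfst]

lemmas vsnd_simps [simp] = vec.linear_add[OF clinear_vsnd] vec.linear_diff[OF clinear_vsnd]
  vec.linear_neg[OF clinear_vsnd] vec.linear_0[OF clinear_vsnd] vec.linear_scale[OF clinear_vsnd]
  clinear_scaleR[OF clinear_vsnd]

lemma add_subgroup_vprod: "add_subgroup S \<Longrightarrow> add_subgroup T \<Longrightarrow> add_subgroup (vprod S T)"
  by (simp add: add_subgroup_def vprod_iff)

lemma norm_vfst_le: "norm (vfst x) \<le> norm x" and norm_vsnd_le: "norm (vsnd x) \<le> norm x"
proof -
  have sum: "(\<Sum>i\<in>UNIV. (norm (x $ i))\<^sup>2) = (\<Sum>i\<in>UNIV. (norm (x $ Inl i))\<^sup>2) + (\<Sum>i\<in>UNIV. (norm (x $ Inr i))\<^sup>2)"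
    by (subst UNIV_Plus_UNIV[symmetric], subst sum.Plus) simp_all
  show "norm (vfst x) \<le> norm x" "norm (vsnd x) \<le> norm x"
    unfolding norm_vec_def L2_set_def sum by (simp_all add: vfst_def vsnd_def sum_nonneg)
qed

lemma vjoin_zero [simp]: "vjoin 0 0 = 0"
  by (auto simp: vjoin_def vec_eq_iff split: sum.split)

lemma eq_zero_vjoin:
  fixes x :: "complex ^ ('n::finite + 'm::finite)"
  shows "vfst x = 0 \<Longrightarrow> vsnd x = 0 \<Longrightarrow> x = 0"
  using vjoin_vfst_vsnd[of x] by simp

lemma lattice_vprod:
  fixes S :: "(complex ^ 'n) set" and T :: "(complex ^ 'm) set"
  assumes "lattice S" "lattice T"
  shows "lattice (vprod S T)"
proof -
  have sub: "add_subgroup (vprod S T)"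
    using assms by (simp add: add_subgroup_vprod add_subgroup_lattice)
  obtain e where e: "e > 0" "\<And>x. x \<in> S \<Longrightarrow> x \<noteq> 0 \<Longrightarrow> e \<le> norm x"
    using discrete_lattice[OF assms(1)] unfolding discrete_vectors_def by blast
  obtain e' where e': "e' > 0" "\<And>x. x \<in> T \<Longrightarrow> x \<noteq> 0 \<Longrightarrow> e' \<le> norm x"
    using discrete_lattice[OF assms(2)] unfolding discrete_vectors_def by blast
  have "min e e' \<le> norm x" if "x \<in> vprod S T" "x \<noteq> 0" for x
  proof (cases "vfst x = 0")
    case True
    then have "vsnd x \<noteq> 0"
      using that(2) eq_zero_vjoin[of x] by blast
    then have "e' \<le> norm (vsnd x)" using that(1) by (intro e'(2)) (simp_all add: vprod_iff)
    then show ?thesis using norm_vsnd_le[of x] by linarith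
  next
    case False
    then have "e \<le> norm (vfst x)" using that(1) by (intro e(2)) (simp_all add: vprod_iff)
    then show ?thesis using norm_vfst_le[of x] by linarith
  qed
  moreover have "min e e' > 0" using e(1) e'(1) by simp
  moreover have "span (vprod S T) = UNIV"
  proof -
    have real_linear: "linear F" if "clinear F" for F :: "complex ^ 'k \<Rightarrow> complex ^ 'l"
      by (rule linearI) (simp_all add: vec.linear_add[OF that] clinear_scaleR[OF that])
    have 1: "vjoin v 0 \<in> span (vprod S T)" for v
    proof -
      have "vjoin v 0 \<in> (\<lambda>v. vjoin v 0) ` span S" using assms(1) by (simp add: lattice_def)
      also have "\<dots> = span ((\<lambda>v. vjoin v 0) ` S)"
        by (rule linear_span_image[symmetric]) (rule real_linear[OF clinear_vjoin[OF clinear_ident clinear_zero]])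
      also have "\<dots> \<subseteq> span (vprod S T)"
        using assms(2) by (intro span_mono) (auto simp: vprod_iff lattice_def)
      finally show ?thesis .
    qed
    have 2: "vjoin 0 w \<in> span (vprod S T)" for w
    proof -
      have "vjoin 0 w \<in> (\<lambda>w. vjoin 0 w) ` span T" using assms(2) by (simp add: lattice_def)
      also have "\<dots> = span ((\<lambda>w. vjoin 0 w) ` T)"
        by (rule linear_span_image[symmetric]) (rule real_linear[OF clinear_vjoin[OF clinear_zero clinear_ident]])
      also have "\<dots> \<subseteq> span (vprod S T)"
        using assms(1) by (intro span_mono) (auto simp: vprod_iff lattice_def)
      finally show ?thesis .
    qed
    have "x = vjoin (vfst x) 0 + vjoin 0 (vsnd x)" for x :: "complex ^ ('n + 'm)"
      by (auto simp: vfst_def vsnd_def vjoin_def vec_eq_iff split: sum.split)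
    then have "x \<in> span (vprod S T)" for x by (metis 1 2 span_add)
    then show ?thesis by blast
  qed
  ultimately show ?thesis
    using sub unfolding lattice_def add_subgroup_def by (intro conjI) blast+
qed

lemma frechet_derivative_compose_clinear:
  assumes "holo UNIV f" "clinear F"
  shows "holo UNIV (\<lambda>v. f (F v))"
    and "frechet_derivative (\<lambda>v. f (F v)) (at v) u = frechet_derivative f (at (F v)) (F u)"
  by (rule holo_compose[OF assms(1) clinear_has_derivative[OF assms(2)]],
      rule vec.linear_scale[OF assms(2)])+

definition box_bundle :: "('n::finite) factor \<Rightarrow> ('m::finite) factor \<Rightarrow> ('n + 'm) factor" where
  "box_bundle f g = (\<lambda>\<gamma> v. f (vfst \<gamma>) (vfst v) * g (vsnd \<gamma>) (vsnd v))"

definition box_sections ::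
  "(complex ^ 'n \<Rightarrow> complex) set \<Rightarrow> (complex ^ 'm \<Rightarrow> complex) set \<Rightarrow> (complex ^ ('n + 'm) \<Rightarrow> complex) set" where
  "box_sections S T = {\<lambda>x. s (vfst x) * t (vsnd x) | s t. s \<in> S \<and> t \<in> T}"

text \<open>
  Two points, or a point and a tangent vector, are already separated in one of the coordinates; the
  other coordinate contributes a section that does not vanish.
\<close>

lemma embedding_sections_box:
  fixes \<Lambda> :: "(complex ^ 'n) set" and \<Gamma> :: "(complex ^ 'm) set"
  assumes \<Lambda>: "add_subgroup \<Lambda>" "add_subgroup \<Gamma>"
    and S: "embedding_sections \<Lambda> f S" and T: "embedding_sections \<Gamma> g T"
  shows "embedding_sections (vprod \<Lambda> \<Gamma>) (box_bundle f g) (box_sections S T)"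
proof -
  note S' = embedding_sectionsD[OF S]
  note T' = embedding_sectionsD[OF T]
  have box: "(\<lambda>x. s (vfst x) * t (vsnd x)) \<in> fspan (box_sections S T)" if "s \<in> fspan S" "t \<in> fspan T" for s t
    unfolding box_sections_def using fspan_mult_compose[OF that] .
  note ho1 = frechet_derivative_compose_clinear[OF embedding_sections_holo[OF S] clinear_vfst]
  note ho2 = frechet_derivative_compose_clinear[OF embedding_sections_holo[OF T] clinear_vsnd]
  have D: "frechet_derivative (\<lambda>x. s (vfst x) * t (vsnd x)) (at x) u
      = s (vfst x) * frechet_derivative t (at (vsnd x)) (vsnd u)
      + frechet_derivative s (at (vfst x)) (vfst u) * t (vsnd x)"
    if "s \<in> fspan S" "t \<in> fspan T" for s t x u
    using frechet_derivative_mult[OF ho1(1)[OF that(1)] ho2(1)[OF that(2)] UNIV_I]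
    by (simp add: ho1(2)[OF that(1)] ho2(2)[OF that(2)])
  show ?thesis
    unfolding embedding_sections_def
  proof (intro conjI allI impI ballI)
    show "finite (box_sections S T)"
      unfolding box_sections_def by (rule finite_products[OF S'(1) T'(1)])
    show "bundle_section (vprod \<Lambda> \<Gamma>) (box_bundle f g) s" if s: "s \<in> box_sections S T" for s
    proof -
      obtain a b where ab: "s = (\<lambda>x. a (vfst x) * b (vsnd x))" "a \<in> S" "b \<in> T"
        using s unfolding box_sections_def by blast
      have "holo UNIV s"
        unfolding ab(1) by (rule holo_mult[OF ho1(1) ho2(1)]) (simp_all add: fspan_base ab)
      then show ?thesis
        using S'(2)[OF ab(2)] T'(2)[OF ab(3)]
        by (simp add: bundle_section_def box_bundle_def ab(1) vprod_iff)
    qed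
    show "\<exists>s\<in>fspan (box_sections S T). s x \<noteq> 0" for x
    proof -
      obtain s t where "s \<in> fspan S" "s (vfst x) \<noteq> 0" "t \<in> fspan T" "t (vsnd x) \<noteq> 0"
        using S'(3) T'(3) by blast
      then show ?thesis by (intro bexI[OF _ box[of s t]]) simp_all
    qed
    show "\<exists>s\<in>fspan (box_sections S T). s x \<noteq> 0 \<and> s y = 0"
      if ne: "point (vprod \<Lambda> \<Gamma>) x \<noteq> point (vprod \<Lambda> \<Gamma>) y" for x y
    proof -
      obtain s t where st: "s \<in> fspan S" "t \<in> fspan T" "s (vfst x) \<noteq> 0" "t (vsnd x) \<noteq> 0"
        "s (vfst y) * t (vsnd y) = 0"
      proof (cases "vfst x - vfst y \<in> \<Lambda>")
        case True
        then have "point \<Gamma> (vsnd x) \<noteq> point \<Gamma> (vsnd y)"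
          using ne by (simp add: point_eq_iff[OF \<Lambda>(2)] point_eq_iff[OF add_subgroup_vprod[OF \<Lambda>]] vprod_iff)
        then obtain t where "t \<in> fspan T" "t (vsnd x) \<noteq> 0" "t (vsnd y) = 0" using T'(4) by blast
        moreover obtain s where "s \<in> fspan S" "s (vfst x) \<noteq> 0" using S'(3) by blast
        ultimately show thesis by (intro that[of s t]) simp_all
      next
        case False
        then have "point \<Lambda> (vfst x) \<noteq> point \<Lambda> (vfst y)"
          by (simp add: point_eq_iff[OF \<Lambda>(1)])
        then obtain s where "s \<in> fspan S" "s (vfst x) \<noteq> 0" "s (vfst y) = 0" using S'(4) by blast
        moreover obtain t where "t \<in> fspan T" "t (vsnd x) \<noteq> 0" using T'(3) by blast
        ultimately show thesis by (intro that[of s t]) simp_all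
      qed
      then show ?thesis by (intro bexI[OF _ box[of s t]]) simp_all
    qed
    fix x u :: "complex ^ ('n + 'm)" assume "u \<noteq> 0"
    then consider "vfst u \<noteq> 0" | "vfst u = 0" "vsnd u \<noteq> 0"
      using eq_zero_vjoin[of u] by blast
    then show "\<exists>s\<in>fspan (box_sections S T). s x = 0 \<and> frechet_derivative s (at x) u \<noteq> 0"
    proof cases
      case 1
      then obtain s where s: "s \<in> fspan S" "s (vfst x) = 0" "frechet_derivative s (at (vfst x)) (vfst u) \<noteq> 0"
        using S'(5)[OF 1, of "vfst x"] by blast
      obtain t where t: "t \<in> fspan T" "t (vsnd x) \<noteq> 0" using T'(3) by blast
      show ?thesis
        using s t by (intro bexI[OF _ box[OF s(1) t(1)]]) (simp add: D)
    next
      case 2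
      then obtain t where t: "t \<in> fspan T" "t (vsnd x) = 0" "frechet_derivative t (at (vsnd x)) (vsnd u) \<noteq> 0"
        using T'(5)[OF 2(2), of "vsnd x"] by blast
      obtain s where s: "s \<in> fspan S" "s (vfst x) \<noteq> 0" using S'(3) by blast
      show ?thesis
        using s t by (intro bexI[OF _ box[OF s(1) t(1)]]) (simp add: D)
    qed
  qed
qed

subsection \<open>Quotients by finite groups\<close>

text \<open>
  The trivial coset is represented by 0, where a factor of automorphy is 1: an average contains the
  averaged section itself as a summand.
\<close>

definition coset_representatives :: "(complex ^ 'n) set \<Rightarrow> (complex ^ 'n) set \<Rightarrow> (complex ^ 'n) set \<Rightarrow> bool" where
  "coset_representatives \<Lambda> A R \<longleftrightarrow> finite R \<and> 0 \<in> R \<and> R \<subseteq> A \<and>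
     (\<forall>\<gamma>\<in>A. \<exists>r\<in>R. \<gamma> - r \<in> \<Lambda>) \<and> (\<forall>r\<in>R. \<forall>r'\<in>R. r - r' \<in> \<Lambda> \<longrightarrow> r = r')"

definition factor_of_automorphy :: "(complex ^ 'n) set \<Rightarrow> 'n factor \<Rightarrow> bool" where
  "factor_of_automorphy \<Lambda> f \<longleftrightarrow> (\<forall>\<gamma>\<in>\<Lambda>. holo UNIV (f \<gamma>) \<and> (\<forall>v. f \<gamma> v \<noteq> 0)) \<and>
     (\<forall>\<gamma>\<in>\<Lambda>. \<forall>\<gamma>'\<in>\<Lambda>. \<forall>v. f (\<gamma> + \<gamma>') v = f \<gamma> (v + \<gamma>') * f \<gamma>' v)"

lemma holo_exp: "holo U f \<Longrightarrow> holo U (\<lambda>v. exp (f v))"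
proof (rule holoI)
  fix v assume f: "holo U f" and v: "v \<in> U"
  show "((\<lambda>v. exp (f v)) has_derivative (\<lambda>u. exp (f v) * frechet_derivative f (at v) u)) (at v)"
    using has_derivative_compose[OF holo_has_derivative[OF f v] DERIV_exp[unfolded has_field_derivative_def]]
    by simp
  show "exp (f v) * frechet_derivative f (at v) (c *s u) = c * (exp (f v) * frechet_derivative f (at v) u)" for c u
    by (simp add: holo_frechet_scale[OF f v])
qed

lemma factor_of_automorphy_appell_humbert:
  fixes \<Lambda> :: "(complex ^ 'n) set"
  assumes K: "neron_severi \<Lambda> K" and \<alpha>: "semicharacter \<Lambda> K \<alpha>"
  shows "factor_of_automorphy \<Lambda> (appell_humbert K \<alpha>)"
  unfolding factor_of_automorphy_def
proof (intro conjI ballI allI)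
  fix \<gamma> assume "\<gamma> \<in> \<Lambda>"
  then have "norm (\<alpha> \<gamma>) = 1" using \<alpha> unfolding semicharacter_def by blast
  then show "appell_humbert K \<alpha> \<gamma> v \<noteq> 0" for v by (auto simp: appell_humbert_def)
  have "clinear (\<lambda>v. (\<chi> i. K v \<gamma>) :: complex ^ 1)"
    by (rule clinearI) (simp_all add: vec_eq_iff neron_severi_add_left[OF K] neron_severi_scale_left[OF K])
  then have "holo UNIV (\<lambda>v. ((\<chi> i. K v \<gamma>) :: complex ^ 1) $ 1)"
    using clinear_holo_map unfolding holo_map_def by blast
  then have "holo UNIV (\<lambda>v. K v \<gamma>)" by simp
  then show "holo UNIV (appell_humbert K \<alpha> \<gamma>)"
    unfolding appell_humbert_def by (intro holo_mult holo_add holo_exp holo_const)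
next
  fix \<gamma> \<gamma>' v assume "\<gamma> \<in> \<Lambda>" "\<gamma>' \<in> \<Lambda>"
  moreover have "line_bundle \<Lambda> (appell_humbert K \<alpha>)"
    unfolding line_bundle_def using K \<alpha> by blast
  ultimately show "appell_humbert K \<alpha> (\<gamma> + \<gamma>') v = appell_humbert K \<alpha> \<gamma> (v + \<gamma>') * appell_humbert K \<alpha> \<gamma>' v"
    by (intro line_bundle_cocycle)
qed

text \<open>
  The quotient \<open>A / \<Lambda>\<close> acts on the sections of the pullback of \<open>f\<close> to \<open>V / \<Lambda>\<close>, where \<open>r\<close> sends \<open>s\<close> to
  \<open>\<lambda>v. inverse (f r v) * s (v + r)\<close>; this is the sum over an orbit.
\<close>

definition average_section ::
  "(complex ^ 'n) set \<Rightarrow> 'n factor \<Rightarrow> (complex ^ 'n \<Rightarrow> complex) \<Rightarrow> complex ^ 'n \<Rightarrow> complex" where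
  "average_section R f s = (\<lambda>v. \<Sum>r\<in>R. inverse (f r v) * s (v + r))"

lemma factor_of_automorphy_power:
  assumes "factor_of_automorphy \<Lambda> f"
  shows "factor_of_automorphy \<Lambda> (tensor_power f n)"
proof -
  have "holo UNIV (\<lambda>v. f \<gamma> v ^ n)" if "\<gamma> \<in> \<Lambda>" for \<gamma>
    using assms that unfolding factor_of_automorphy_def
    by (induction n) (simp_all add: holo_const holo_mult)
  then show ?thesis
    using assms unfolding factor_of_automorphy_def tensor_power_def by (auto simp: power_mult_distrib)
qed

lemma factor_of_automorphy_zero:
  assumes "factor_of_automorphy \<Lambda> f" "0 \<in> \<Lambda>"
  shows "f 0 v = 1"
proof -
  have "f (0 + 0) v = f 0 (v + 0) * f 0 v" "f 0 v \<noteq> 0"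
    using assms unfolding factor_of_automorphy_def by blast+
  then show ?thesis by simp
qed

lemma holo_sum: "(\<And>i. i \<in> I \<Longrightarrow> holo U (f i)) \<Longrightarrow> holo U (\<lambda>v. \<Sum>i\<in>I. f i v)"
  by (induction I rule: infinite_finite_induct) (simp_all add: holo_const holo_add)

lemma holo_prod: "(\<And>i. i \<in> I \<Longrightarrow> holo U (f i)) \<Longrightarrow> holo U (\<lambda>v. \<Prod>i\<in>I. f i v)"
  by (induction I rule: infinite_finite_induct) (simp_all add: holo_const holo_mult)

lemma frechet_derivative_sum:
  assumes "\<And>i. i \<in> I \<Longrightarrow> holo UNIV (f i)"
  shows "frechet_derivative (\<lambda>v. \<Sum>i\<in>I. f i v) (at v) u = (\<Sum>i\<in>I. frechet_derivative (f i) (at v) u)"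
  using fun_cong[OF frechet_derivative_at[symmetric, OF has_derivative_sum[of I f "\<lambda>i. frechet_derivative (f i) (at v)" "at v"]]]
    holo_has_derivative[OF assms UNIV_I] by blast

lemma holo_translate:
  assumes "holo UNIV f"
  shows "holo UNIV (\<lambda>v. f (v + r))"
    and "frechet_derivative (\<lambda>v. f (v + r)) (at v) u = frechet_derivative f (at (v + r)) u"
proof -
  have D: "((\<lambda>v. v + r) has_derivative (\<lambda>u. u)) (at v)" for v
    by (auto intro!: derivative_eq_intros)
  show "holo UNIV (\<lambda>v. f (v + r))"
    by (rule holo_compose(1)[OF assms D]) simp
  show "frechet_derivative (\<lambda>v. f (v + r)) (at v) u = frechet_derivative f (at (v + r)) u"
    by (rule holo_compose(2)[OF assms D]) simp
qed

lemma average_section_fspan: "s \<in> fspan S \<Longrightarrow> average_section R f s \<in> fspan (average_section R f ` S)"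
proof (induction rule: fspan.induct)
  case (fspan_base s)
  then show ?case by (intro fspan.fspan_base) simp
next
  case (fspan_add s t)
  then show ?case
    using fspan.fspan_add[OF fspan_add.IH] by (simp add: average_section_def sum.distrib distrib_left)
next
  case (fspan_scale s c)
  then show ?case
    using fspan.fspan_scale[OF fspan_scale.IH, of c] by (simp add: average_section_def sum_distrib_left mult_ac)
qed

text \<open>
  Adding \<open>\<gamma> \<in> A\<close> to the representatives permutes the cosets by \<open>\<sigma>\<close>; the error \<open>l = \<gamma> + r - \<sigma> r\<close> lies in
  \<open>\<Lambda>\<close>, where \<open>s\<close> transforms by the factor \<open>f l\<close>, and the cocycle condition absorbs it.
\<close>

lemma average_section:
  fixes \<Lambda> A :: "(complex ^ 'n) set"
  assumes \<Lambda>: "add_subgroup \<Lambda>" and A: "add_subgroup A" "\<Lambda> \<subseteq> A" and R: "coset_representatives \<Lambda> A R"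
    and f: "factor_of_automorphy A f" and s: "bundle_section \<Lambda> f s"
  shows "bundle_section A f (average_section R f s)"
proof -
  have R': "finite R" "R \<subseteq> A" "\<And>\<gamma>. \<gamma> \<in> A \<Longrightarrow> \<exists>r\<in>R. \<gamma> - r \<in> \<Lambda>"
    "\<And>r r'. r \<in> R \<Longrightarrow> r' \<in> R \<Longrightarrow> r - r' \<in> \<Lambda> \<Longrightarrow> r = r'"
    using R unfolding coset_representatives_def by blast+
  have f': "holo UNIV (f \<gamma>)" "f \<gamma> v \<noteq> 0" if "\<gamma> \<in> A" for \<gamma> v
    using f that unfolding factor_of_automorphy_def by blast+
  have cocycle: "f (\<gamma> + \<gamma>') v = f \<gamma> (v + \<gamma>') * f \<gamma>' v" if "\<gamma> \<in> A" "\<gamma>' \<in> A" for \<gamma> \<gamma>' v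
    using f that unfolding factor_of_automorphy_def by blast
  have s': "holo UNIV s" "\<And>\<gamma> v. \<gamma> \<in> \<Lambda> \<Longrightarrow> s (v + \<gamma>) = f \<gamma> v * s v"
    using s unfolding bundle_section_def by blast+
  have "holo UNIV (average_section R f s)"
    unfolding average_section_def
    using R'(2) f' s'(1) by (intro holo_sum holo_mult holo_inverse holo_translate) (auto dest: subsetD)
  moreover have "average_section R f s (v + \<gamma>) = f \<gamma> v * average_section R f s v" if \<gamma>: "\<gamma> \<in> A" for \<gamma> v
  proof -
    define \<sigma> where "\<sigma> r = (SOME r'. r' \<in> R \<and> (\<gamma> + r) - r' \<in> \<Lambda>)" for r
    have \<sigma>: "\<sigma> r \<in> R" "(\<gamma> + r) - \<sigma> r \<in> \<Lambda>" if "r \<in> R" for r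
    proof -
      have "\<exists>r'. r' \<in> R \<and> (\<gamma> + r) - r' \<in> \<Lambda>"
        using R'(3)[of "\<gamma> + r"] add_subgroup_add[OF A(1) \<gamma>] R'(2) that by blast
      from someI_ex[OF this] show "\<sigma> r \<in> R" "(\<gamma> + r) - \<sigma> r \<in> \<Lambda>"
        unfolding \<sigma>_def by blast+
    qed
    have inj: "inj_on \<sigma> R"
    proof (rule inj_onI)
      fix r r' assume r: "r \<in> R" "r' \<in> R" "\<sigma> r = \<sigma> r'"
      have "((\<gamma> + r) - \<sigma> r) - ((\<gamma> + r') - \<sigma> r') \<in> \<Lambda>"
        by (rule add_subgroup_diff[OF \<Lambda> \<sigma>(2)[OF r(1)] \<sigma>(2)[OF r(2)]])
      then show "r = r'" using R'(4)[OF r(1,2)] r(3) by simp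
    qed
    have image: "\<sigma> ` R = R"
      using endo_inj_surj[OF R'(1) _ inj] \<sigma>(1) by blast
    have term_eq: "inverse (f r (v + \<gamma>)) * s (v + \<gamma> + r) = f \<gamma> v * (inverse (f (\<sigma> r) v) * s (v + \<sigma> r))"
      if r: "r \<in> R" for r
    proof -
      define l where "l = (\<gamma> + r) - \<sigma> r"
      have l: "l \<in> \<Lambda>" "l \<in> A" using \<sigma>(2)[OF r] A(2) by (auto simp: l_def)
      have rA: "r \<in> A" "\<sigma> r \<in> A" using R'(2) r \<sigma>(1)[OF r] by blast+
      have "r + \<gamma> = l + \<sigma> r" by (simp add: l_def)
      then have eq: "f r (v + \<gamma>) * f \<gamma> v = f l (v + \<sigma> r) * f (\<sigma> r) v"
        using cocycle[OF rA(1) \<gamma>, of v] cocycle[OF l(2) rA(2), of v] by simp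
      have "v + \<gamma> + r = (v + \<sigma> r) + l" by (simp add: l_def)
      then have sl: "s (v + \<gamma> + r) = f l (v + \<sigma> r) * s (v + \<sigma> r)"
        using s'(2)[OF l(1), of "v + \<sigma> r"] by (simp only:)
      have "a * b = c * d \<Longrightarrow> a \<noteq> 0 \<Longrightarrow> d \<noteq> 0 \<Longrightarrow> inverse a * (c * e) = b * (inverse d * e)"
        for a b c d e :: complex
        by (simp add: field_simps)
      from this[OF eq f'(2)[OF rA(1)] f'(2)[OF rA(2)]] show ?thesis
        unfolding sl .
    qed
    have "average_section R f s (v + \<gamma>) = (\<Sum>r\<in>R. f \<gamma> v * (inverse (f (\<sigma> r) v) * s (v + \<sigma> r)))"
      unfolding average_section_def by (rule sum.cong[OF refl term_eq])
    also have "\<dots> = (\<Sum>r\<in>\<sigma> ` R. f \<gamma> v * (inverse (f r v) * s (v + r)))"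
      by (simp add: sum.reindex[OF inj])
    also have "\<dots> = f \<gamma> v * average_section R f s v"
      unfolding image average_section_def by (simp add: sum_distrib_left)
    finally show ?thesis .
  qed
  ultimately show ?thesis by (simp add: bundle_section_def)
qed

text \<open>
  A product of sections, two for each group element, can be made to vanish on the orbits of two
  given points except at one of these points. Its average then has the same value at this point and
  vanishes at the other one. To test a tangent vector at a point, the product vanishes simply there and
  doubly on the rest of the orbit, and its average has the same first derivative. So averages
  separate points and tangent vectors of the quotient.
\<close>

lemma embedding_sections_quotient:
  fixes \<Lambda> A :: "(complex ^ 'n) set"
  assumes \<Lambda>: "add_subgroup \<Lambda>" and A: "add_subgroup A" "\<Lambda> \<subseteq> A" and R: "coset_representatives \<Lambda> A R"
    and f: "factor_of_automorphy A f" and emb: "embedding_sections \<Lambda> f S"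
  shows "embedding_sections A (tensor_power f (2 * card R))
    (average_section R (tensor_power f (2 * card R)) ` monomials (monomials S 2) (card R))"
proof -
  define F where "F = tensor_power f (2 * card R)"
  have F: "factor_of_automorphy A F"
    unfolding F_def by (rule factor_of_automorphy_power[OF f])
  have R': "finite R" "0 \<in> R" "R \<subseteq> A" "\<And>r r'. r \<in> R \<Longrightarrow> r' \<in> R \<Longrightarrow> r - r' \<in> \<Lambda> \<Longrightarrow> r = r'"
    using R unfolding coset_representatives_def by blast+
  let ?M = "monomials S 2" and ?N = "monomials (monomials S 2) (card R)"
  note S = embedding_sectionsD[OF emb]
  have ho: "holo UNIV s" if "s \<in> fspan S" for s
    by (rule embedding_sections_holo[OF emb that])
  have two: "(\<lambda>v. s v * t v) \<in> fspan ?M" if "s \<in> fspan S" "t \<in> fspan S" for s t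
    using prod_in_fspan_monomials[of "{..<2}" "\<lambda>i::nat. if i = 0 then s else t" S] that
    by (simp add: numeral_2_eq_2 lessThan_Suc mult.commute)
  have prod: "(\<lambda>v. \<Prod>r\<in>R. t r v) \<in> fspan ?N" if "\<And>r. r \<in> R \<Longrightarrow> t r \<in> fspan ?M" for t
    by (rule prod_in_fspan_monomials[OF R'(1) that])
  have secN: "bundle_section \<Lambda> F t" if "t \<in> ?N" for t
    using bundle_section_monomials[OF bundle_section_monomials[OF S(2)] that]
    by (simp add: F_def tensor_power_def power_mult)
  have hoN: "holo UNIV t" if "t \<in> fspan ?N" for t
    using that by (rule holo_fspan[rotated]) (use secN in \<open>simp add: bundle_section_def\<close>)
  have F0: "F 0 v = 1" for v
    by (rule factor_of_automorphy_zero[OF F add_subgroup_zero[OF A(1)]])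
  have avg: "average_section R F t \<in> fspan (average_section R F ` ?N)" if "t \<in> fspan ?N" for t
    by (rule average_section_fspan[OF that])
  have off: "point \<Lambda> w \<noteq> point \<Lambda> (w + r)" if "r \<in> R" "r \<noteq> 0" for w r
    using R'(4)[OF R'(2) that(1)] that(2) by (auto simp: point_eq_iff[OF \<Lambda>])
  have avg_value: "average_section R F t w = t w"
    if "\<And>r. r \<in> R \<Longrightarrow> r \<noteq> 0 \<Longrightarrow> t (w + r) = 0" for t w
  proof -
    have "average_section R F t w = (\<Sum>r\<in>R. if r = 0 then t w else 0)"
      unfolding average_section_def by (rule sum.cong) (auto simp: that F0)
    then show ?thesis using R' by simp
  qed
  have avg_derivative: "frechet_derivative (average_section R F t) (at w) u = frechet_derivative t (at w) u"
    if t: "t \<in> fspan ?N" and zero: "\<And>r. r \<in> R \<Longrightarrow> r \<noteq> 0 \<Longrightarrow> t (w + r) = 0 \<and> frechet_derivative t (at (w + r)) u = 0"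
    for t w u
  proof -
    have inv: "holo UNIV (\<lambda>v. inverse (F r v))" if "r \<in> R" for r
      using F R'(3) that by (intro holo_inverse) (auto simp: factor_of_automorphy_def dest: subsetD)
    note tr = holo_translate[OF hoN[OF t]]
    have "frechet_derivative (average_section R F t) (at w) u
        = (\<Sum>r\<in>R. frechet_derivative (\<lambda>v. inverse (F r v) * t (v + r)) (at w) u)"
      unfolding average_section_def by (rule frechet_derivative_sum) (rule holo_mult[OF inv tr(1)])
    also have "\<dots> = (\<Sum>r\<in>R. if r = 0 then frechet_derivative t (at w) u else 0)"
    proof (rule sum.cong[OF refl])
      fix r assume r: "r \<in> R"
      show "frechet_derivative (\<lambda>v. inverse (F r v) * t (v + r)) (at w) u
          = (if r = 0 then frechet_derivative t (at w) u else 0)"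
      proof (cases "r = 0")
        case True then show ?thesis by (simp add: F0)
      next
        case False
        then show ?thesis
          using zero[OF r False] by (simp add: frechet_derivative_mult[OF inv[OF r] tr(1) UNIV_I] tr(2))
      qed
    qed
    finally show ?thesis using R' by simp
  qed
  have "embedding_sections A F (average_section R F ` ?N)"
    unfolding embedding_sections_def
  proof (intro conjI allI impI ballI)
    show "finite (average_section R F ` ?N)"
      by (simp add: finite_monomials S(1))
    show "bundle_section A F t" if "t \<in> average_section R F ` ?N" for t
      using that average_section[OF \<Lambda> A R F secN] by blast
    show sep: "\<exists>s\<in>fspan (average_section R F ` ?N). s w \<noteq> 0 \<and> s v = 0"
      if ne: "point A w \<noteq> point A v" for v w
    proof -
      have "\<exists>a b. a \<in> fspan S \<and> b \<in> fspan S \<and> a w \<noteq> 0 \<and> b w \<noteq> 0 \<and> a (v + r) = 0 \<and> (r \<noteq> 0 \<longrightarrow> b (w + r) = 0)"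
        if r: "r \<in> R" for r
      proof -
        have "w - (v + r) \<notin> \<Lambda>"
        proof
          assume "w - (v + r) \<in> \<Lambda>"
          then have "(w - (v + r)) + r \<in> A" using A(2) R'(3) r by (blast intro: add_subgroup_add[OF A(1)])
          then show False using ne by (simp add: point_eq_iff[OF A(1)])
        qed
        then have "point \<Lambda> w \<noteq> point \<Lambda> (v + r)" by (simp add: point_eq_iff[OF \<Lambda>])
        then obtain a where "a \<in> fspan S" "a w \<noteq> 0" "a (v + r) = 0" using S(4) by blast
        moreover obtain b where "b \<in> fspan S" "b w \<noteq> 0" "r \<noteq> 0 \<longrightarrow> b (w + r) = 0"
          using S(3)[of w] S(4)[OF off[OF r]] by blast
        ultimately show ?thesis by blast
      qed
      then obtain a b where ab: "\<And>r. r \<in> R \<Longrightarrow> a r \<in> fspan S \<and> b r \<in> fspan S \<and> a r w \<noteq> 0 \<and> b r w \<noteq> 0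
          \<and> a r (v + r) = 0 \<and> (r \<noteq> 0 \<longrightarrow> b r (w + r) = 0)"
        by metis
      define t where "t x = (\<Prod>r\<in>R. a r x * b r x)" for x
      have t: "t \<in> fspan ?N"
        unfolding t_def by (rule prod[OF two]) (use ab in blast)+
      have "t w \<noteq> 0" using ab R'(1) by (simp add: t_def)
      moreover have zero: "t x = 0" if "r \<in> R" "a r x = 0 \<or> b r x = 0" for x r
        unfolding t_def using that R'(1) by (intro prod_zero) auto
      have "average_section R F t w = t w"
        by (rule avg_value) (use ab zero in blast)
      moreover have "average_section R F t v = 0"
        unfolding average_section_def by (rule sum.neutral) (use ab zero in auto)
      ultimately show ?thesis by (intro bexI[OF _ avg[OF t]]) simp
    qed
    have rest: "\<exists>b. \<forall>r\<in>R. b r \<in> fspan S \<and> b r w \<noteq> 0 \<and> (r \<noteq> 0 \<longrightarrow> b r (w + r) = 0)" for w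
    proof (rule bchoice, rule ballI)
      fix r assume "r \<in> R"
      then show "\<exists>b. b \<in> fspan S \<and> b w \<noteq> 0 \<and> (r \<noteq> 0 \<longrightarrow> b (w + r) = 0)"
        using S(3)[of w] S(4)[OF off[of r w]] by blast
    qed
    show "\<exists>s\<in>fspan (average_section R F ` ?N). s w \<noteq> 0" for w
    proof -
      obtain b where b: "\<forall>r\<in>R. b r \<in> fspan S \<and> b r w \<noteq> 0 \<and> (r \<noteq> 0 \<longrightarrow> b r (w + r) = 0)"
        using rest by blast
      define t where "t x = (\<Prod>r\<in>R. b r x * b r x)" for x
      have t: "t \<in> fspan ?N"
        unfolding t_def by (rule prod[OF two]) (use b in blast)+
      have "average_section R F t w = t w"
      proof (rule avg_value)
        fix r assume "r \<in> R" "r \<noteq> 0"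
        then show "t (w + r) = 0" unfolding t_def using b R'(1) by (intro prod_zero) auto
      qed
      moreover have "t w \<noteq> 0" using b R'(1) by (simp add: t_def)
      ultimately show ?thesis by (intro bexI[OF _ avg[OF t]]) simp
    qed
    fix w and u :: "complex ^ 'n" assume "u \<noteq> 0"
    then obtain s where s: "s \<in> fspan S" "s w = 0" "frechet_derivative s (at w) u \<noteq> 0" using S(5) by blast
    obtain b where b: "\<forall>r\<in>R. b r \<in> fspan S \<and> b r w \<noteq> 0 \<and> (r \<noteq> 0 \<longrightarrow> b r (w + r) = 0)"
      using rest by blast
    \<comment> \<open>The product vanishes simply at \<open>w\<close>, through \<open>s\<close>, and doubly at the other points of the orbit.\<close>
    define c where "c r = (if r = 0 then s else b r)" for r
    have c: "c r \<in> fspan S" if "r \<in> R" for r using that b s(1) by (simp add: c_def)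
    define t where "t x = (\<Prod>r\<in>R. b r x * c r x)" for x
    have t: "t \<in> fspan ?N"
      unfolding t_def by (rule prod[OF two]) (use b c in blast)+
    have split: "t = (\<lambda>x. c r x * (b r x * (\<Prod>r\<in>R - {r}. b r x * c r x)))" if "r \<in> R" for r
      by (rule ext) (simp add: t_def prod.remove[OF R'(1) that] mult_ac)
    have ho_rest: "holo UNIV (\<lambda>x. b r x * (\<Prod>r\<in>R - {r}. b r x * c r x))" if "r \<in> R" for r
      using b c that by (intro holo_mult holo_prod ho) auto
    have D: "frechet_derivative t (at x) u = c r x * frechet_derivative (\<lambda>x. b r x * (\<Prod>r\<in>R - {r}. b r x * c r x)) (at x) u
        + frechet_derivative (c r) (at x) u * (b r x * (\<Prod>r\<in>R - {r}. b r x * c r x))" if "r \<in> R" for r x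
      by (subst split[OF that], rule frechet_derivative_mult[OF ho[OF c[OF that]] ho_rest[OF that] UNIV_I])
    have zero: "t (w + r) = 0 \<and> frechet_derivative t (at (w + r)) u = 0" if "r \<in> R" "r \<noteq> 0" for r
      using b that by (simp add: D[OF that(1)] fun_cong[OF split[OF that(1)]] c_def)
    have "(\<Prod>r\<in>R - {0}. b r w * c r w) \<noteq> 0"
      using b R'(1) by (auto simp: c_def)
    then have "frechet_derivative t (at w) u \<noteq> 0"
      using b R'(2) s by (simp add: D[OF R'(2)] c_def)
    moreover have "average_section R F t w = 0"
      using avg_value[of t w] zero s(2) by (simp add: fun_cong[OF split[OF R'(2)]] c_def)
    ultimately show "\<exists>s\<in>fspan (average_section R F ` ?N). s w = 0 \<and> frechet_derivative s (at w) u \<noteq> 0"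
      using avg_derivative[OF t zero] by (intro bexI[OF _ avg[OF t]]) simp
  qed
  then show ?thesis by (simp only: F_def)
qed

section \<open>Elliptic curves\<close>

text \<open>
  If the form vanishes, the factors of automorphy are constants of modulus 1. Then all sections of
  powers of the bundle have periodic modulus, so they are constant and do not define an immersion.
\<close>

lemma ample_imp_form_nonzero:
  fixes \<Lambda> :: "(complex ^ 'n) set"
  assumes \<Lambda>: "add_subgroup \<Lambda>" "span \<Lambda> = UNIV"
    and H: "neron_severi \<Lambda> H" and \<alpha>: "semicharacter \<Lambda> H \<alpha>" and ample: "ample \<Lambda> (appell_humbert H \<alpha>)"
  shows "\<exists>v w. H v w \<noteq> 0"
proof (rule ccontr)
  assume "\<not> ?thesis"
  then have H0: "H v w = 0" for v w by blast
  obtain k where "very_ample \<Lambda> (tensor_power (appell_humbert H \<alpha>) k)"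
    using ample unfolding ample_def by blast
  then obtain S where S: "embedding_sections \<Lambda> (tensor_power (appell_humbert H \<alpha>) k) S"
    by (rule very_ample_imp_embedding_sections)
  let ?u = "axis undefined 1 :: complex ^ 'n"
  have "?u \<noteq> 0" by (simp add: axis_eq_0_iff)
  then obtain s where s: "s \<in> fspan S" "frechet_derivative s (at 0) ?u \<noteq> 0"
    using S unfolding embedding_sections_def by blast
  have sec: "s (v + \<gamma>) = \<alpha> \<gamma> ^ k * s v" if "s \<in> fspan S" "\<gamma> \<in> \<Lambda>" for s v \<gamma>
    using that(1)
  proof induction
    case (fspan_base s)
    then show ?case
      using S that(2) unfolding embedding_sections_def bundle_section_def
      by (simp add: tensor_power_def appell_humbert_def H0)
  qed (simp_all add: algebra_simps)
  have "norm (\<alpha> \<gamma>) = 1" if "\<gamma> \<in> \<Lambda>" for \<gamma>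
    using \<alpha> that unfolding semicharacter_def by blast
  then have per: "norm (s (v + \<gamma>)) = norm (s v)" if "\<gamma> \<in> \<Lambda>" for v \<gamma>
    using sec[OF s(1) that] that by (simp add: norm_mult norm_power)
  have "s v = s 0" for v
    by (rule holo_periodic_modulus_const[OF \<Lambda> embedding_sections_holo[OF S s(1)]]) (rule per)
  then have "s = (\<lambda>_. s 0)" by blast
  then have "frechet_derivative s (at 0) = (\<lambda>_. 0)"
    using frechet_derivative_const[of "s 0" "0 :: complex ^ 'n"] by simp
  then show False using s(2) by simp
qed

lemma elliptic_form:
  fixes H :: "complex ^ 1 \<Rightarrow> complex ^ 1 \<Rightarrow> complex"
  assumes "neron_severi \<Lambda> H"
  obtains h :: real where "\<And>v w. H v w = of_real h * (v $ 1 * cnj (w $ 1))"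
proof -
  define h where "h = Re (H 1 1)"
  have "Im (H 1 1) = 0" by (rule neron_severi_Im_same[OF assms])
  then have h: "H 1 1 = of_real h" by (simp add: h_def complex_eq_iff)
  have vec: "v = v $ 1 *s 1" for v :: "complex ^ 1"
    by (simp add: vec_eq_iff forall_1)
  have "H v w = of_real h * (v $ 1 * cnj (w $ 1))" for v w
  proof -
    have "H (v $ 1 *s 1) (w $ 1 *s 1) = of_real h * (v $ 1 * cnj (w $ 1))"
      by (simp add: neron_severi_scale_left[OF assms] neron_severi_scale_right[OF assms] h)
    then show ?thesis using vec[of v] vec[of w] by simp
  qed
  then show thesis by (rule that)
qed

text \<open>Cramer's rule: on a real plane every alternating form is a multiple of the determinant.\<close>

lemma elliptic_form_relation:
  fixes H :: "complex ^ 1 \<Rightarrow> complex ^ 1 \<Rightarrow> complex"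
  assumes "neron_severi \<Lambda> H"
  shows "Im (H x y) *\<^sub>R z = Im (H z y) *\<^sub>R x + Im (H x z) *\<^sub>R y"
proof -
  obtain h :: real where h: "\<And>v w. H v w = of_real h * (v $ 1 * cnj (w $ 1))"
    by (rule elliptic_form[OF assms]) blast
  show ?thesis
    by (simp add: vec_eq_iff forall_1 h complex_eq_iff) (simp add: algebra_simps)
qed

definition unimodular_basis ::
  "(complex ^ 1) set \<Rightarrow> (complex ^ 1 \<Rightarrow> complex ^ 1 \<Rightarrow> complex) \<Rightarrow> complex ^ 1 \<Rightarrow> complex ^ 1 \<Rightarrow> bool" where
  "unimodular_basis E H e\<^sub>1 e\<^sub>2 \<longleftrightarrow> e\<^sub>1 \<in> E \<and> e\<^sub>2 \<in> E \<and> Im (H e\<^sub>1 e\<^sub>2) = 1 \<and>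
     (\<forall>\<gamma>\<in>E. \<exists>a b :: int. \<gamma> = of_int a *\<^sub>R e\<^sub>1 + of_int b *\<^sub>R e\<^sub>2)"

text \<open>
  A pair of lattice vectors on which the alternating form takes its least positive value \<open>c\<close> is a
  basis: remainders modulo \<open>c\<close> of the values of the form are again values, hence 0. So the
  form is \<open>c\<close> times a principal polarisation.
\<close>

lemma elliptic_unimodular_basis:
  fixes E :: "(complex ^ 1) set"
  assumes E: "add_subgroup E" "span E = UNIV" and H: "neron_severi E H" and nz: "H v w \<noteq> 0"
  obtains c :: nat and H' e\<^sub>1 e\<^sub>2 where "c > 0" "neron_severi E H'" "unimodular_basis E H' e\<^sub>1 e\<^sub>2"
    "\<And>v w. H v w = of_nat c * H' v w"
proof -
  define V where "V c \<longleftrightarrow> c > 0 \<and> (\<exists>x\<in>E. \<exists>y\<in>E. Im (H x y) = real c)" for c :: nat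
  have "\<exists>c. V c"
  proof (rule ccontr)
    assume none: "\<not> ?thesis"
    have "Im (H x y) = 0" if xy: "x \<in> E" "y \<in> E" for x y
    proof (rule ccontr)
      assume ne: "Im (H x y) \<noteq> 0"
      obtain k :: int where k: "Im (H x y) = of_int k"
        using neron_severi_integral[OF H xy] by (auto elim: Ints_cases)
      have "Im (H y x) = of_int (- k)" using neron_severi_Im_swap[OF H, of y x] k by simp
      then have "0 < nat \<bar>k\<bar>" "Im (H x y) = real (nat \<bar>k\<bar>) \<or> Im (H y x) = real (nat \<bar>k\<bar>)"
        using ne k by auto
      then have "V (nat \<bar>k\<bar>)"
        using xy unfolding V_def by blast
      then show False using none by blast
    qed
    then have "(\<chi> j. H x (axis j 1)) = 0" if "x \<in> E" for x
      using that by (intro apair_eq_zero[OF E(2)]) (simp add: apair_polarising[OF H])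
    then have Hx: "H x y = 0" if "x \<in> E" for x y
      using that apair_polarising[OF H, of x y] by (simp add: apair_def)
    have "(\<chi> j. H v (axis j 1)) = 0"
      by (rule apair_eq_zero[OF E(2)])
        (simp add: apair_polarising[OF H] neron_severi_Im_swap[OF H, of v] Hx)
    then show False
      using nz apair_polarising[OF H, of v w] by (simp add: apair_def)
  qed
  define c where "c = (LEAST c. V c)"
  have c: "V c" unfolding c_def using \<open>\<exists>c. V c\<close> by (rule LeastI_ex)
  have least: "c \<le> c'" if "V c'" for c' unfolding c_def using that by (rule Least_le)
  have cpos: "c > 0" using c by (simp add: V_def)
  obtain e\<^sub>1 e\<^sub>2 where e: "e\<^sub>1 \<in> E" "e\<^sub>2 \<in> E" "Im (H e\<^sub>1 e\<^sub>2) = real c"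
    using c unfolding V_def by blast
  have minimal: "\<exists>a :: int. Im (H x y) = of_int a * real c"
    if xy: "x \<in> E" "y \<in> E" and u: "u \<in> E" "Im (H u y) = real c" for x y u
  proof -
    obtain k :: int where k: "Im (H x y) = of_int k"
      using neron_severi_integral[OF H xy] by (auto elim: Ints_cases)
    define x' where "x' = x - of_int (k div int c) *\<^sub>R u"
    have x': "x' \<in> E"
      unfolding x'_def using E(1) xy(1) u(1) by (intro add_subgroup_diff add_subgroup_scale_int)
    have "Im (H x' y) = of_int k - of_int (k div int c) * real c"
      by (simp add: x'_def neron_severi_linear[OF H] k u(2))
    also have "\<dots> = of_int (k - k div int c * int c)" by simp
    also have "\<dots> = of_int (k mod int c)" by (simp add: minus_div_mult_eq_mod)
    finally have v: "Im (H x' y) = of_int (k mod int c)" .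
    have "k mod int c = 0"
    proof (rule ccontr)
      assume "k mod int c \<noteq> 0"
      moreover have "0 \<le> k mod int c" "k mod int c < int c" using cpos by simp_all
      ultimately have m: "0 < k mod int c" "k mod int c < int c" by linarith+
      then have "V (nat (k mod int c))"
        unfolding V_def using v x' xy(2) by auto
      then show False using least[of "nat (k mod int c)"] m by linarith
    qed
    then have "k = (k div int c) * int c" by (metis minus_div_mult_eq_mod diff_zero eq_iff_diff_eq_0)
    then have "of_int k = of_int (k div int c) * real c" by (metis of_int_mult of_int_of_nat_eq)
    then show ?thesis using k by metis
  qed
  have basis: "\<exists>a b :: int. \<gamma> = of_int a *\<^sub>R e\<^sub>1 + of_int b *\<^sub>R e\<^sub>2" if \<gamma>: "\<gamma> \<in> E" for \<gamma>
  proof -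
    obtain a :: int where a: "Im (H \<gamma> e\<^sub>2) = of_int a * real c"
      using minimal[OF \<gamma> e(2) e(1,3)] by blast
    have "Im (H (- e\<^sub>2) e\<^sub>1) = real c"
      using e(3) neron_severi_Im_swap[OF H, of e\<^sub>2 e\<^sub>1] by (simp add: neron_severi_minus_left[OF H])
    then obtain b :: int where b: "Im (H \<gamma> e\<^sub>1) = of_int b * real c"
      using minimal[OF \<gamma> e(1) add_subgroup_minus[OF E(1) e(2)]] by blast
    have "Im (H e\<^sub>1 \<gamma>) = of_int (- b) * real c"
      using b neron_severi_Im_swap[OF H, of e\<^sub>1 \<gamma>] by simp
    then have "real c *\<^sub>R \<gamma> = (of_int a * real c) *\<^sub>R e\<^sub>1 + (of_int (- b) * real c) *\<^sub>R e\<^sub>2"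
      using elliptic_form_relation[OF H, of e\<^sub>1 e\<^sub>2 \<gamma>] unfolding e(3) a by simp
    also have "\<dots> = real c *\<^sub>R (of_int a *\<^sub>R e\<^sub>1 + of_int (- b) *\<^sub>R e\<^sub>2)"
      by (simp only: scaleR_add_right scaleR_scaleR mult.commute)
    finally have "\<gamma> = of_int a *\<^sub>R e\<^sub>1 + of_int (- b) *\<^sub>R e\<^sub>2"
      using cpos by (simp only: scaleR_cancel_left of_nat_eq_0_iff) simp
    then show ?thesis by blast
  qed
  define H' where "H' v w = H v w / of_nat c" for v w
  have H': "H v w = of_nat c * H' v w" for v w
    using cpos by (simp add: H'_def)
  have Im': "Im (H' v w) = Im (H v w) / real c" for v w
    by (simp add: H'_def)
  have integral: "Im (H' \<gamma> \<gamma>') \<in> \<int>" if \<gamma>: "\<gamma> \<in> E" "\<gamma>' \<in> E" for \<gamma> \<gamma>'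
  proof -
    obtain a b a' b' :: int where ab: "\<gamma> = of_int a *\<^sub>R e\<^sub>1 + of_int b *\<^sub>R e\<^sub>2" "\<gamma>' = of_int a' *\<^sub>R e\<^sub>1 + of_int b' *\<^sub>R e\<^sub>2"
      using basis[OF \<gamma>(1)] basis[OF \<gamma>(2)] by metis
    have "Im (H \<gamma> \<gamma>') = of_int (a * b' - b * a') * real c"
      unfolding ab
      by (simp add: neron_severi_linear[OF H] neron_severi_Im_swap[OF H, of e\<^sub>2 e\<^sub>1] e(3)
          algebra_simps)
    then have "Im (H' \<gamma> \<gamma>') = of_int (a * b' - b * a')" using cpos by (simp add: Im')
    then show ?thesis by (simp only: Ints_of_int)
  qed
  have "neron_severi E H'"
    unfolding neron_severi_def
  proof (intro conjI allI ballI)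
    show "H' (u + v) w = H' u w + H' v w" for u v w
      by (simp add: H'_def neron_severi_add_left[OF H] add_divide_distrib)
    show "H' (a *s v) w = a * H' v w" for a v w
      by (simp add: H'_def neron_severi_scale_left[OF H])
    show "H' w v = cnj (H' v w)" for v w
      by (simp add: H'_def neron_severi_cnj[OF H, of w v])
  qed (rule integral)
  moreover have "unimodular_basis E H' e\<^sub>1 e\<^sub>2"
    using e basis cpos by (simp add: unimodular_basis_def Im')
  ultimately show thesis
    using that[OF cpos _ _ H'] by blast
qed

lemma neron_severi_multiple:
  assumes "neron_severi \<Lambda> H"
  shows "neron_severi \<Lambda> (\<lambda>v w. of_nat n * H v w)"
  unfolding neron_severi_def
proof (intro conjI allI ballI)
  show "of_nat n * H (u + v) w = of_nat n * H u w + of_nat n * H v w" for u v w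
    by (simp add: neron_severi_add_left[OF assms] distrib_left)
  show "of_nat n * H (a *s v) w = a * (of_nat n * H v w)" for a v w
    by (simp add: neron_severi_scale_left[OF assms])
  show "of_nat n * H w v = cnj (of_nat n * H v w)" for v w
    by (simp add: neron_severi_cnj[OF assms, of w v])
  show "Im (of_nat n * H \<gamma> \<gamma>') \<in> \<int>" if "\<gamma> \<in> \<Lambda>" "\<gamma>' \<in> \<Lambda>" for \<gamma> \<gamma>'
    using neron_severi_integral[OF assms that] by simp
qed

lemma semicharacter_power:
  assumes "semicharacter \<Lambda> H \<alpha>"
  shows "semicharacter \<Lambda> (\<lambda>v w. of_nat n * H v w) (\<lambda>\<gamma>. \<alpha> \<gamma> ^ n)"
  unfolding semicharacter_def
proof (intro conjI ballI)
  show "norm (\<alpha> \<gamma> ^ n) = 1" if "\<gamma> \<in> \<Lambda>" for \<gamma>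
    using assms that by (simp add: semicharacter_def norm_power)
  fix \<gamma> \<gamma>' assume "\<gamma> \<in> \<Lambda>" "\<gamma>' \<in> \<Lambda>"
  then have "\<alpha> (\<gamma> + \<gamma>') = \<alpha> \<gamma> * \<alpha> \<gamma>' * cis (pi * Im (H \<gamma> \<gamma>'))"
    using assms unfolding semicharacter_def by blast
  then have "\<alpha> (\<gamma> + \<gamma>') ^ n = \<alpha> \<gamma> ^ n * \<alpha> \<gamma>' ^ n * cis (real n * (pi * Im (H \<gamma> \<gamma>')))"
    by (simp only: power_mult_distrib Complex.DeMoivre)
  then show "\<alpha> (\<gamma> + \<gamma>') ^ n = \<alpha> \<gamma> ^ n * \<alpha> \<gamma>' ^ n * cis (pi * Im (of_nat n * H \<gamma> \<gamma>'))"
    by (simp add: mult.left_commute)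
qed

lemma tensor_power_appell_humbert:
  "tensor_power (appell_humbert H \<alpha>) n = appell_humbert (\<lambda>v w. of_nat n * H v w) (\<lambda>\<gamma>. \<alpha> \<gamma> ^ n)"
  by (rule ext, rule ext)
    (simp add: tensor_power_def appell_humbert_def power_mult_distrib exp_of_nat_mult[symmetric] algebra_simps)

text \<open>
  In the coordinates \<open>a, b\<close> of the basis the form is \<open>n (a b' - b a')\<close>. The polarisation of the quadratic
  phase \<open>n a b\<close> is \<open>n (a b' + b a')\<close>, which agrees with it modulo 2.
\<close>

lemma elliptic_semicharacter:
  fixes E :: "(complex ^ 1) set"
  assumes H: "neron_severi E H" and basis: "unimodular_basis E H e\<^sub>1 e\<^sub>2"
  obtains \<alpha> where "semicharacter E (\<lambda>v w. of_nat n * H v w) \<alpha>" "\<alpha> e\<^sub>1 = cis \<theta>\<^sub>1" "\<alpha> e\<^sub>2 = cis \<theta>\<^sub>2"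
proof -
  define a b where "a \<gamma> = Im (H \<gamma> e\<^sub>2)" and "b \<gamma> = Im (H e\<^sub>1 \<gamma>)" for \<gamma>
  have e: "e\<^sub>1 \<in> E" "e\<^sub>2 \<in> E" "Im (H e\<^sub>1 e\<^sub>2) = 1"
    using basis by (simp_all add: unimodular_basis_def)
  define \<alpha> where "\<alpha> \<gamma> = cis (\<theta>\<^sub>1 * a \<gamma> + \<theta>\<^sub>2 * b \<gamma> + pi * real n * (a \<gamma> * b \<gamma>))" for \<gamma>
  have coords: "\<gamma> = a \<gamma> *\<^sub>R e\<^sub>1 + b \<gamma> *\<^sub>R e\<^sub>2" for \<gamma>
    using elliptic_form_relation[OF H, of e\<^sub>1 e\<^sub>2 \<gamma>] by (simp add: e a_def b_def)
  have add: "a (\<gamma> + \<gamma>') = a \<gamma> + a \<gamma>'" "b (\<gamma> + \<gamma>') = b \<gamma> + b \<gamma>'" for \<gamma> \<gamma>'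
    by (simp_all add: a_def b_def neron_severi_linear[OF H])
  have "semicharacter E (\<lambda>v w. of_nat n * H v w) \<alpha>"
    unfolding semicharacter_def
  proof (intro conjI ballI)
    fix \<gamma> \<gamma>' assume \<gamma>: "\<gamma> \<in> E" "\<gamma>' \<in> E"
    have "Im (H \<gamma> \<gamma>') = Im (H (a \<gamma> *\<^sub>R e\<^sub>1 + b \<gamma> *\<^sub>R e\<^sub>2) (a \<gamma>' *\<^sub>R e\<^sub>1 + b \<gamma>' *\<^sub>R e\<^sub>2))"
      by (simp only: coords[symmetric])
    also have "\<dots> = a \<gamma> * b \<gamma>' - b \<gamma> * a \<gamma>'"
      by (simp add: neron_severi_linear[OF H] neron_severi_Im_swap[OF H, of e\<^sub>2 e\<^sub>1] e(3))
    finally have form: "Im (of_nat n * H \<gamma> \<gamma>') = real n * (a \<gamma> * b \<gamma>' - b \<gamma> * a \<gamma>')" by simp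
    have "\<alpha> (\<gamma> + \<gamma>') = cis ((\<theta>\<^sub>1 * a \<gamma> + \<theta>\<^sub>2 * b \<gamma> + pi * real n * (a \<gamma> * b \<gamma>))
        + (\<theta>\<^sub>1 * a \<gamma>' + \<theta>\<^sub>2 * b \<gamma>' + pi * real n * (a \<gamma>' * b \<gamma>'))
        + pi * (real n * (a \<gamma> * b \<gamma>' - b \<gamma> * a \<gamma>')) + 2 * pi * (real n * (b \<gamma> * a \<gamma>')))"
      unfolding \<alpha>_def add by (rule arg_cong[of _ _ cis]) (simp add: algebra_simps)
    also have "\<dots> = \<alpha> \<gamma> * \<alpha> \<gamma>' * cis (pi * Im (of_nat n * H \<gamma> \<gamma>')) * cis (2 * pi * (real n * (b \<gamma> * a \<gamma>')))"
      unfolding \<alpha>_def form cis_mult ..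
    also have "cis (2 * pi * (real n * (b \<gamma> * a \<gamma>'))) = 1"
      unfolding a_def b_def using \<gamma> e by (intro cis_multiple_2pi Ints_mult neron_severi_integral[OF H]) auto
    finally show "\<alpha> (\<gamma> + \<gamma>') = \<alpha> \<gamma> * \<alpha> \<gamma>' * cis (pi * Im (of_nat n * H \<gamma> \<gamma>'))" by simp
  qed (simp add: \<alpha>_def)
  moreover have "\<alpha> e\<^sub>1 = cis \<theta>\<^sub>1" "\<alpha> e\<^sub>2 = cis \<theta>\<^sub>2"
    by (simp_all add: \<alpha>_def a_def b_def e neron_severi_Im_same[OF H])
  ultimately show thesis by (rule that)
qed

lemma semicharacter_eqI:
  fixes E :: "(complex ^ 1) set"
  assumes E: "add_subgroup E" and basis: "unimodular_basis E H e\<^sub>1 e\<^sub>2"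
    and \<alpha>: "semicharacter E K \<alpha>" and \<beta>: "semicharacter E K \<beta>" and eq: "\<alpha> e\<^sub>1 = \<beta> e\<^sub>1" "\<alpha> e\<^sub>2 = \<beta> e\<^sub>2"
    and "\<gamma> \<in> E"
  shows "\<alpha> \<gamma> = \<beta> \<gamma>"
proof -
  have nz: "\<alpha> x \<noteq> 0" "\<beta> x \<noteq> 0" if "x \<in> E" for x
  proof -
    have "norm (\<alpha> x) = 1" "norm (\<beta> x) = 1"
      using \<alpha> \<beta> that unfolding semicharacter_def by blast+
    then show "\<alpha> x \<noteq> 0" "\<beta> x \<noteq> 0" by auto
  qed
  have \<alpha>_add: "\<alpha> (x + y) = \<alpha> x * \<alpha> y * cis (pi * Im (K x y))"
    and \<beta>_add: "\<beta> (x + y) = \<beta> x * \<beta> y * cis (pi * Im (K x y))" if "x \<in> E" "y \<in> E" for x y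
    using \<alpha> \<beta> that unfolding semicharacter_def by blast+
  define X where "X = {x \<in> E. \<alpha> x = \<beta> x}"
  have X: "add_subgroup X"
    unfolding add_subgroup_def
  proof (intro conjI ballI)
    have cancel: "c * c' * k = b * c' * k \<Longrightarrow> c' \<noteq> 0 \<Longrightarrow> k \<noteq> 0 \<Longrightarrow> c = b" for c c' b k :: complex
      by simp
    have a0: "\<alpha> 0 * cis (pi * Im (K 0 0)) = 1" "\<beta> 0 * cis (pi * Im (K 0 0)) = 1"
      using \<alpha>_add[of 0 0] \<beta>_add[of 0 0] nz[of 0] add_subgroup_zero[OF E] by (simp_all add: mult.assoc)
    then have "\<alpha> 0 = \<beta> 0"
      by (metis cis_neq_zero mult_right_cancel)
    then show "0 \<in> X" using add_subgroup_zero[OF E] by (simp add: X_def)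
    fix x y assume xy: "x \<in> X" "y \<in> X"
    then have E': "x \<in> E" "y \<in> E" "x - y \<in> E" using add_subgroup_diff[OF E] by (auto simp: X_def)
    have "\<alpha> (x - y) * \<alpha> y * cis (pi * Im (K (x - y) y)) = \<beta> (x - y) * \<alpha> y * cis (pi * Im (K (x - y) y))"
      using \<alpha>_add[OF E'(3,2)] \<beta>_add[OF E'(3,2)] xy by (simp add: X_def)
    from cancel[OF this nz(1)[OF E'(2)] cis_neq_zero] show "x - y \<in> X" using E' by (simp add: X_def)
  qed
  obtain a b :: int where "\<gamma> = of_int a *\<^sub>R e\<^sub>1 + of_int b *\<^sub>R e\<^sub>2"
    using basis \<open>\<gamma> \<in> E\<close> unfolding unimodular_basis_def by blast
  moreover have "e\<^sub>1 \<in> X" "e\<^sub>2 \<in> X" using basis eq by (simp_all add: X_def unimodular_basis_def)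
  ultimately have "\<gamma> \<in> X" using X by (simp add: add_subgroup_add add_subgroup_scale_int)
  then show ?thesis by (simp add: X_def)
qed

lemma semicharacter_isotropic_line:
  fixes \<Lambda> :: "(complex ^ 'n) set"
  assumes \<alpha>: "semicharacter \<Lambda> K \<alpha>" and \<Lambda>: "add_subgroup \<Lambda>" and K: "neron_severi \<Lambda> K"
    and x: "x \<in> \<Lambda>" "\<alpha> x = cis \<theta>"
  shows "\<alpha> (of_int j *\<^sub>R x) = cis (of_int j * \<theta>)"
proof -
  have mult: "\<alpha> (of_int i *\<^sub>R x + of_int j *\<^sub>R x) = \<alpha> (of_int i *\<^sub>R x) * \<alpha> (of_int j *\<^sub>R x)" for i j
  proof -
    have "of_int i *\<^sub>R x \<in> \<Lambda>" "of_int j *\<^sub>R x \<in> \<Lambda>"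
      using \<Lambda> x(1) by (simp_all add: add_subgroup_scale_int)
    then have "\<alpha> (of_int i *\<^sub>R x + of_int j *\<^sub>R x) = \<alpha> (of_int i *\<^sub>R x) * \<alpha> (of_int j *\<^sub>R x)
        * cis (pi * Im (K (of_int i *\<^sub>R x) (of_int j *\<^sub>R x)))"
      using \<alpha> unfolding semicharacter_def by blast
    then show ?thesis
      by (simp add: neron_severi_linear[OF K])
  qed
  have step: "\<alpha> (of_int (i + 1) *\<^sub>R x) = \<alpha> (of_int i *\<^sub>R x) * cis \<theta>" for i
    using mult[of i 1] x(2) by (simp add: scaleR_add_left)
  show ?thesis
  proof (induction j rule: int_induct[where k = 0])
    case base
    have "\<alpha> (of_int 0 *\<^sub>R x) * cis \<theta> = cis \<theta>" using step[of 0] x(2) by simp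
    then show ?case by simp
  next
    case (step1 i)
    then show ?case using step[of i] by (simp add: cis_mult distrib_right)
  next
    case (step2 i)
    have "\<alpha> (of_int (i - 1) *\<^sub>R x) * cis \<theta> = cis (of_int (i - 1) * \<theta>) * cis \<theta>"
      using step[of "i - 1"] step2 by (simp add: cis_mult algebra_simps)
    then show ?case by simp
  qed
qed

text \<open>
  On an elliptic curve all ample bundles are, up to powers, multiples of one principal polarisation.
  Taking roots of the phases of a given semicharacter on a basis, the bundle of degree \<open>d\<close> can be
  chosen so that a common power with the given ample bundle exists exactly, not just up to translation.
\<close>

lemma elliptic_ample_multiple:
  fixes E :: "(complex ^ 1) set"
  assumes E: "add_subgroup E" and H: "neron_severi E H" and basis: "unimodular_basis E H e\<^sub>1 e\<^sub>2"
    and c: "c > 0" and d: "d > (0::nat)"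
    and \<alpha>: "semicharacter E (\<lambda>v w. of_nat c * H v w) \<alpha>"
    and ample: "ample E (appell_humbert (\<lambda>v w. of_nat c * H v w) \<alpha>)"
  obtains \<beta> k S where "semicharacter E (\<lambda>v w. of_nat d * H v w) \<beta>" "k \<ge> 1"
    "embedding_sections E (tensor_power (appell_humbert (\<lambda>v w. of_nat d * H v w) \<beta>) k) S"
proof -
  let ?K = "\<lambda>n v w. of_nat n * H v w"
  have e: "e\<^sub>1 \<in> E" "e\<^sub>2 \<in> E" using basis by (simp_all add: unimodular_basis_def)
  have "\<exists>\<phi>. \<alpha> x = cis \<phi>" if "x \<in> E" for x
  proof -
    have "norm (\<alpha> x) = 1" using \<alpha> that unfolding semicharacter_def by blast
    then have "\<alpha> x = cis (Arg (\<alpha> x))" using rcis_cmod_Arg[of "\<alpha> x"] by (simp add: rcis_def)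
    then show ?thesis ..
  qed
  then obtain \<phi>\<^sub>1 \<phi>\<^sub>2 where \<phi>: "\<alpha> e\<^sub>1 = cis \<phi>\<^sub>1" "\<alpha> e\<^sub>2 = cis \<phi>\<^sub>2" using e by metis
  obtain \<beta> where \<beta>: "semicharacter E (?K d) \<beta>" "\<beta> e\<^sub>1 = cis (real d * \<phi>\<^sub>1 / real c)" "\<beta> e\<^sub>2 = cis (real d * \<phi>\<^sub>2 / real c)"
    by (rule elliptic_semicharacter[OF H basis])
  have pow: "\<beta> \<gamma> ^ c = \<alpha> \<gamma> ^ d" if "\<gamma> \<in> E" for \<gamma>
  proof (rule semicharacter_eqI[OF E basis _ _ _ _ that])
    show "semicharacter E (\<lambda>v w. of_nat c * ?K d v w) (\<lambda>\<gamma>. \<beta> \<gamma> ^ c)"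
      by (rule semicharacter_power[OF \<beta>(1)])
    have "(\<lambda>v w. of_nat c * ?K d v w) = (\<lambda>v w. of_nat d * ?K c v w)"
      by (simp add: mult.left_commute)
    then show "semicharacter E (\<lambda>v w. of_nat c * ?K d v w) (\<lambda>\<gamma>. \<alpha> \<gamma> ^ d)"
      using semicharacter_power[OF \<alpha>, of d] by (simp only:)
    show "\<beta> e\<^sub>1 ^ c = \<alpha> e\<^sub>1 ^ d" "\<beta> e\<^sub>2 ^ c = \<alpha> e\<^sub>2 ^ d"
      using c by (simp_all add: \<beta> \<phi> Complex.DeMoivre)
  qed
  obtain l where l: "l \<ge> 1" "very_ample E (tensor_power (appell_humbert (?K c) \<alpha>) l)"
    using ample unfolding ample_def by blast
  obtain S where S: "embedding_sections E (tensor_power (appell_humbert (?K c) \<alpha>) l) S"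
    by (rule very_ample_imp_embedding_sections[OF l(2)])
  have "embedding_sections E (tensor_power (tensor_power (appell_humbert (?K c) \<alpha>) l) d) (monomials S d)"
    using embedding_sections_power[OF S, of d] d by simp
  then have "embedding_sections E (tensor_power (appell_humbert (?K d) \<beta>) (c * l)) (monomials S d)"
  proof (rule embedding_sections_cong)
    fix \<gamma> v assume \<gamma>: "\<gamma> \<in> E"
    have "(\<beta> \<gamma> ^ c) ^ l = (\<alpha> \<gamma> ^ d) ^ l" using pow[OF \<gamma>] by simp
    then have "\<beta> \<gamma> ^ (c * l) = (\<alpha> \<gamma> ^ l) ^ d" by (simp only: power_mult[symmetric] mult.commute)
    then show "tensor_power (tensor_power (appell_humbert (?K c) \<alpha>) l) d \<gamma> v = tensor_power (appell_humbert (?K d) \<beta>) (c * l) \<gamma> v"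
      unfolding tensor_power_appell_humbert by (simp add: appell_humbert_def mult_ac)
  qed
  moreover have "c * l \<ge> 1" using c l(1) by simp
  ultimately show thesis using \<beta>(1) that by blast
qed

section \<open>Gluing along a cyclic subgroup\<close>

text \<open>
  The torus \<open>V / A\<close> is the quotient of \<open>E \<times> B\<close> by the subgroup generated by \<open>(P, Q)\<close>, where \<open>p\<close> and \<open>q\<close>
  are vectors over \<open>P\<close> and \<open>Q\<close>; the lattice \<open>E'\<close> is that of \<open>E / \<langle>P\<rangle>\<close>. The form \<open>H\<^sub>E\<close> is the principal
  one, and \<open>\<alpha>\<^sub>E\<close> belongs to its multiple \<open>d H\<^sub>E\<close>, which is the one that descends.
\<close>

locale gluing =
  fixes E :: "(complex ^ 1) set" and B :: "(complex ^ 'm) set"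
    and H\<^sub>E :: "complex ^ 1 \<Rightarrow> complex ^ 1 \<Rightarrow> complex" and H\<^sub>B :: "complex ^ 'm \<Rightarrow> complex ^ 'm \<Rightarrow> complex"
    and \<alpha>\<^sub>E :: "complex ^ 1 \<Rightarrow> complex" and \<alpha>\<^sub>B :: "complex ^ 'm \<Rightarrow> complex"
    and e\<^sub>1 e\<^sub>2 p :: "complex ^ 1" and q :: "complex ^ 'm" and d :: nat
  assumes lattice_E: "lattice E" and lattice_B: "lattice B"
    and H\<^sub>E: "neron_severi E H\<^sub>E" and H\<^sub>B: "neron_severi B H\<^sub>B"
    and \<alpha>\<^sub>E: "semicharacter E (\<lambda>v w. of_nat d * H\<^sub>E v w) \<alpha>\<^sub>E" and \<alpha>\<^sub>B: "semicharacter B H\<^sub>B \<alpha>\<^sub>B"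
    and basis: "unimodular_basis E H\<^sub>E e\<^sub>1 e\<^sub>2"
    and d: "d > 0"
    and p: "\<And>k :: int. of_int k *\<^sub>R p \<in> E \<longleftrightarrow> int d dvd k"
    and q: "\<And>k :: int. of_int k *\<^sub>R q \<in> B \<longleftrightarrow> int d dvd k"
    and q_kernel: "\<And>b. b \<in> B \<Longrightarrow> Im (H\<^sub>B q b) \<in> \<int>"
    and H\<^sub>B_nondegenerate: "\<And>w. (\<And>w'. H\<^sub>B w w' = 0) \<Longrightarrow> w = 0"
begin

definition g where "g = vjoin p q"

definition A where "A = {x + of_int k *\<^sub>R g | x k. x \<in> vprod E B}"

definition E' where "E' = {x + of_int k *\<^sub>R p | x k. x \<in> E}"

definition H where "H x y = of_nat d * H\<^sub>E (vfst x) (vfst y) + H\<^sub>B (vsnd x) (vsnd y)"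

lemmas E = add_subgroup_lattice[OF lattice_E] and B = add_subgroup_lattice[OF lattice_B]

lemma span_E: "span E = UNIV" and span_B: "span B = UNIV"
  using lattice_E lattice_B by (simp_all add: lattice_def)

lemma product: "add_subgroup (vprod E B)"
  by (rule add_subgroup_vprod[OF E B])

lemma vfst_g [simp]: "vfst g = p" and vsnd_g [simp]: "vsnd g = q"
  by (simp_all add: g_def)

lemma dp: "real d *\<^sub>R p \<in> E" and dq: "real d *\<^sub>R q \<in> B"
  using p[of "int d"] q[of "int d"] by simp_all

lemma multiple_g: "of_int k *\<^sub>R g \<in> vprod E B \<longleftrightarrow> int d dvd k"
  by (simp add: vprod_iff p q)

lemma A_cases:
  assumes "x \<in> A"
  obtains y k where "y \<in> vprod E B" "x = y + of_int k *\<^sub>R g"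
  using assms unfolding A_def by blast

lemma A_intro: "y \<in> vprod E B \<Longrightarrow> y + of_int k *\<^sub>R g \<in> A"
  unfolding A_def by blast

lemma vprod_subset_A: "vprod E B \<subseteq> A"
  using A_intro[of _ 0] by auto

lemma add_subgroup_A: "add_subgroup A"
  unfolding add_subgroup_def
proof (intro conjI ballI)
  show "0 \<in> A" using vprod_subset_A add_subgroup_zero[OF product] by blast
  fix x y assume "x \<in> A" "y \<in> A"
  then obtain x' y' and k l :: int where *: "x' \<in> vprod E B" "x = x' + of_int k *\<^sub>R g"
    "y' \<in> vprod E B" "y = y' + of_int l *\<^sub>R g"
    by (elim A_cases)
  have "x - y = (x' - y') + of_int (k - l) *\<^sub>R g"
    by (simp add: * scaleR_diff_left)
  then show "x - y \<in> A"
    using A_intro[OF add_subgroup_diff[OF product *(1,3)], of "k - l"] by simp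
qed

lemma multiple_A:
  assumes "x \<in> A"
  shows "real d *\<^sub>R x \<in> vprod E B"
proof -
  obtain y k where y: "y \<in> vprod E B" "x = y + of_int k *\<^sub>R g" using assms by (rule A_cases)
  have "real d *\<^sub>R x = real d *\<^sub>R y + of_int (int d * k) *\<^sub>R g"
    by (simp add: y scaleR_add_right)
  moreover have "of_int (int d * k) *\<^sub>R g \<in> vprod E B" by (subst multiple_g) simp
  ultimately show ?thesis
    using add_subgroup_add[OF product add_subgroup_scale_nat[OF product y(1)]] by simp
qed

lemma lattice_A: "lattice A"
proof -
  have product_lattice: "lattice (vprod E B)" by (rule lattice_vprod[OF lattice_E lattice_B])
  then obtain e where e: "e > 0" "\<And>x. x \<in> vprod E B \<Longrightarrow> x \<noteq> 0 \<Longrightarrow> e \<le> norm x"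
    using discrete_lattice unfolding discrete_vectors_def by blast
  have "e / real d \<le> norm x" if "x \<in> A" "x \<noteq> 0" for x
    using e(2)[OF multiple_A[OF that(1)]] that(2) d by (simp add: field_simps)
  moreover have "e / real d > 0" using e(1) d by simp
  ultimately have "\<exists>e>0. \<forall>x\<in>A. x \<noteq> 0 \<longrightarrow> e \<le> norm x" by blast
  moreover have "span A = UNIV"
    using span_mono[OF vprod_subset_A] product_lattice by (auto simp: lattice_def)
  ultimately show ?thesis
    using add_subgroup_A by (simp add: lattice_def add_subgroup_def)
qed

lemma span_A: "span A = UNIV"
  using lattice_A by (simp add: lattice_def)

lemma vfst_A: "vfst ` A = E'"
proof
  show "vfst ` A \<subseteq> E'"
  proof
    fix v assume "v \<in> vfst ` A"
    then obtain x where x: "x \<in> A" "v = vfst x" by blast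
    obtain y and k :: int where "y \<in> vprod E B" "x = y + of_int k *\<^sub>R g"
      using x(1) by (rule A_cases)
    then have "vfst y \<in> E" "v = vfst y + of_int k *\<^sub>R p" by (simp_all add: x(2) vprod_iff)
    then show "v \<in> E'" unfolding E'_def by blast
  qed
  show "E' \<subseteq> vfst ` A"
  proof
    fix v assume "v \<in> E'"
    then obtain x k where x: "x \<in> E" "v = x + of_int k *\<^sub>R p" unfolding E'_def by blast
    have "vjoin x 0 + of_int k *\<^sub>R g \<in> A"
      by (rule A_intro) (simp add: vprod_iff x add_subgroup_zero[OF B])
    moreover have "vfst (vjoin x 0 + of_int k *\<^sub>R g) = v" by (simp add: x)
    ultimately show "v \<in> vfst ` A" by (metis imageI)
  qed
qed

lemma vjoin_0_in_A: "vjoin v 0 \<in> A \<longleftrightarrow> v \<in> E"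
proof
  assume "vjoin v 0 \<in> A"
  then obtain y k where y: "y \<in> vprod E B" "vjoin v 0 = y + of_int k *\<^sub>R g" by (rule A_cases)
  have *: "v = vfst y + of_int k *\<^sub>R p" "0 = vsnd y + of_int k *\<^sub>R q"
    using arg_cong[OF y(2), of vfst] arg_cong[OF y(2), of vsnd] by simp_all
  have "of_int k *\<^sub>R q = - vsnd y" using *(2) by (simp add: eq_neg_iff_add_eq_0 add.commute)
  then have "of_int k *\<^sub>R q \<in> B" using y(1) by (simp add: vprod_iff add_subgroup_minus[OF B])
  then have "of_int k *\<^sub>R p \<in> E" by (simp add: p q)
  then show "v \<in> E" using * y(1) by (simp add: vprod_iff add_subgroup_add[OF E])
next
  assume "v \<in> E"
  then show "vjoin v 0 \<in> A"
    using vprod_subset_A by (auto simp: vprod_iff add_subgroup_zero[OF B])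
qed

lemma vjoin_0_right_in_A: "vjoin 0 w \<in> A \<longleftrightarrow> w \<in> B"
proof
  assume "vjoin 0 w \<in> A"
  then obtain y k where y: "y \<in> vprod E B" "vjoin 0 w = y + of_int k *\<^sub>R g" by (rule A_cases)
  have *: "0 = vfst y + of_int k *\<^sub>R p" "w = vsnd y + of_int k *\<^sub>R q"
    using arg_cong[OF y(2), of vfst] arg_cong[OF y(2), of vsnd] by simp_all
  have "of_int k *\<^sub>R p = - vfst y" using *(1) by (simp add: eq_neg_iff_add_eq_0 add.commute)
  then have "of_int k *\<^sub>R p \<in> E" using y(1) by (simp add: vprod_iff add_subgroup_minus[OF E])
  then have "of_int k *\<^sub>R q \<in> B" by (simp add: p q)
  then show "w \<in> B" using * y(1) by (simp add: vprod_iff add_subgroup_add[OF B])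
next
  assume "w \<in> B"
  then show "vjoin 0 w \<in> A"
    using vprod_subset_A by (auto simp: vprod_iff add_subgroup_zero[OF E])
qed

subsection \<open>The polarisation\<close>

lemma unimodular:
  assumes "\<And>\<gamma>. \<gamma> \<in> E \<Longrightarrow> Im (H\<^sub>E z \<gamma>) \<in> \<int>"
  shows "z \<in> E"
proof -
  have e: "e\<^sub>1 \<in> E" "e\<^sub>2 \<in> E" "Im (H\<^sub>E e\<^sub>1 e\<^sub>2) = 1" using basis by (simp_all add: unimodular_basis_def)
  obtain a :: int where a: "Im (H\<^sub>E z e\<^sub>2) = of_int a" using assms[OF e(2)] by (auto elim: Ints_cases)
  obtain b :: int where "Im (H\<^sub>E z e\<^sub>1) = of_int b" using assms[OF e(1)] by (auto elim: Ints_cases)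
  then have b: "Im (H\<^sub>E e\<^sub>1 z) = of_int (- b)" using neron_severi_Im_swap[OF H\<^sub>E, of e\<^sub>1 z] by simp
  have z: "z = of_int a *\<^sub>R e\<^sub>1 + of_int (- b) *\<^sub>R e\<^sub>2"
    using elliptic_form_relation[OF H\<^sub>E, of e\<^sub>1 e\<^sub>2 z] unfolding e(3) a b by (simp only: scaleR_one)
  show ?thesis
    unfolding z
    by (rule add_subgroup_add[OF E add_subgroup_scale_int[OF E e(1)] add_subgroup_scale_int[OF E e(2)]])
qed

text \<open>
  Since \<open>p\<close> has order exactly \<open>d\<close>, the coordinates of \<open>d p\<close> and \<open>d\<close> have no common factor, so Bezout
  coefficients give a lattice vector pairing with \<open>d p\<close> to 1 modulo \<open>d\<close>.
\<close>

lemma dual_vector: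
  obtains P' and t :: int where "P' \<in> E" "Im (H\<^sub>E P' (real d *\<^sub>R p)) = of_int (1 - t * int d)"
proof -
  have e: "e\<^sub>1 \<in> E" "e\<^sub>2 \<in> E" "Im (H\<^sub>E e\<^sub>1 e\<^sub>2) = 1" using basis by (simp_all add: unimodular_basis_def)
  obtain a b :: int where ab: "real d *\<^sub>R p = of_int a *\<^sub>R e\<^sub>1 + of_int b *\<^sub>R e\<^sub>2"
    using basis dp unfolding unimodular_basis_def by blast
  define c where "c = gcd (gcd a b) (int d)"
  have cpos: "c > 0" using d by (simp add: c_def)
  obtain a' where a': "a = c * a'" using gcd_dvd1[of "gcd a b" "int d"] unfolding c_def by (metis dvd_def gcd_dvd1 dvd_trans)
  obtain b' where b': "b = c * b'" using gcd_dvd1[of "gcd a b" "int d"] unfolding c_def by (metis dvd_def gcd_dvd2 dvd_trans)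
  obtain d' where d': "int d = c * d'" unfolding c_def using gcd_dvd2[of "gcd a b" "int d"] by (metis dvd_def)
  have "of_int c *\<^sub>R (of_int d' *\<^sub>R p) = of_int (int d) *\<^sub>R p" unfolding d' by simp
  also have "\<dots> = of_int c *\<^sub>R (of_int a' *\<^sub>R e\<^sub>1 + of_int b' *\<^sub>R e\<^sub>2)"
    using ab by (simp add: a' b' scaleR_add_right)
  finally have "of_int d' *\<^sub>R p = of_int a' *\<^sub>R e\<^sub>1 + of_int b' *\<^sub>R e\<^sub>2"
    using cpos by (metis scaleR_cancel_left of_int_eq_0_iff less_irrefl)
  then have "of_int d' *\<^sub>R p \<in> E"
    using add_subgroup_add[OF E add_subgroup_scale_int[OF E e(1)] add_subgroup_scale_int[OF E e(2)]] by simp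
  then have "int d dvd d'" by (simp add: p)
  then have "c * d' dvd 1 * d'" by (simp add: d'[symmetric])
  moreover have "d' \<noteq> 0" using d d' by auto
  ultimately have "c dvd 1" by (simp only: dvd_mult_cancel_right) simp
  then have c1: "c = 1" using cpos by simp
  obtain u v where uv: "u * a + v * b = gcd a b" using bezout_int by blast
  obtain s t where st: "s * gcd a b + t * int d = 1" using bezout_int[of "gcd a b" "int d"] c1 unfolding c_def by metis
  have one: "s * v * b + s * u * a = 1 - t * int d" using uv st by (simp add: algebra_simps flip: uv)
  define P' where "P' = of_int (s * v) *\<^sub>R e\<^sub>1 + of_int (- (s * u)) *\<^sub>R e\<^sub>2"
  have "P' \<in> E"
    unfolding P'_def by (rule add_subgroup_add[OF E add_subgroup_scale_int[OF E e(1)] add_subgroup_scale_int[OF E e(2)]])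
  moreover have "Im (H\<^sub>E P' (real d *\<^sub>R p)) = of_int (s * v * b + s * u * a)"
    unfolding ab P'_def
    by (simp add: neron_severi_linear[OF H\<^sub>E] neron_severi_Im_swap[OF H\<^sub>E, of e\<^sub>2 e\<^sub>1] e(3)
        neron_severi_linear[OF H\<^sub>E])
  ultimately show thesis using that one by metis
qed

text \<open>
  In \<open>E[d]\<close>, the orthogonal complement of \<open>P\<close> is generated by \<open>P\<close>. The relation between \<open>P'\<close>, \<open>d p\<close> and
  \<open>d z\<close> expresses \<open>d z\<close>, up to the factor \<open>1 - t d\<close>, by the other two, and the coefficient of \<open>P'\<close>
  is a multiple of \<open>d\<close>.
\<close>

lemma orthogonal_to_p:
  assumes z: "real d *\<^sub>R z \<in> E" and int: "real d * Im (H\<^sub>E z p) \<in> \<int>"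
  obtains e and k :: int where "e \<in> E" "z = e + of_int k *\<^sub>R p"
proof -
  obtain P' and t :: int where P': "P' \<in> E" "Im (H\<^sub>E P' (real d *\<^sub>R p)) = of_int (1 - t * int d)"
    by (rule dual_vector)
  obtain n :: int where n: "real d * Im (H\<^sub>E z p) = of_int n" using int by (auto elim: Ints_cases)
  obtain m :: int where m: "Im (H\<^sub>E P' (real d *\<^sub>R z)) = of_int m"
    using neron_severi_integral[OF H\<^sub>E P'(1) z] by (auto elim: Ints_cases)
  have "Im (H\<^sub>E (real d *\<^sub>R z) (real d *\<^sub>R p)) = real d * of_int n"
    by (simp add: neron_severi_linear[OF H\<^sub>E] n)
  from elliptic_form_relation[OF H\<^sub>E, of P' "real d *\<^sub>R p" "real d *\<^sub>R z", unfolded this P'(2) m]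
  have "of_int (1 - t * int d) *\<^sub>R real d *\<^sub>R z = (real d * of_int n) *\<^sub>R P' + of_int m *\<^sub>R real d *\<^sub>R p" .
  then have "real d *\<^sub>R (of_int (1 - t * int d) *\<^sub>R z) = real d *\<^sub>R (of_int n *\<^sub>R P' + of_int m *\<^sub>R p)"
    by (simp only: scaleR_add_right scaleR_scaleR mult.commute)
  then have "of_int (1 - t * int d) *\<^sub>R z = of_int n *\<^sub>R P' + of_int m *\<^sub>R p"
    using d by (simp only: scaleR_cancel_left of_nat_eq_0_iff) simp
  then have "z = (of_int t *\<^sub>R (real d *\<^sub>R z) + of_int n *\<^sub>R P') + of_int m *\<^sub>R p"
    by (simp add: scaleR_diff_left algebra_simps)
  moreover have "of_int t *\<^sub>R (real d *\<^sub>R z) + of_int n *\<^sub>R P' \<in> E"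
    using E z P'(1) by (intro add_subgroup_add add_subgroup_scale_int)
  ultimately show thesis using that by blast
qed

text \<open>
  The form \<open>d H\<^sub>E\<close> is integral on the overlattice \<open>E'\<close> of index \<open>d\<close>, hence unimodular on it: \<open>E'\<close> is its
  own dual.
\<close>

lemma E'_self_dual: "(\<forall>\<gamma>\<in>E'. real d * Im (H\<^sub>E x \<gamma>) \<in> \<int>) \<longleftrightarrow> x \<in> E'"
proof
  assume *: "\<forall>\<gamma>\<in>E'. real d * Im (H\<^sub>E x \<gamma>) \<in> \<int>"
  have E_sub: "\<gamma> \<in> E'" if "\<gamma> \<in> E" for \<gamma>
  proof -
    have "\<gamma> + of_int 0 *\<^sub>R p \<in> E'" unfolding E'_def using that by blast
    then show ?thesis by simp
  qed
  have "0 + of_int 1 *\<^sub>R p \<in> E'"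
    unfolding E'_def using add_subgroup_zero[OF E] by blast
  then have p: "p \<in> E'" by simp
  have "real d *\<^sub>R x \<in> E"
    by (rule unimodular) (use * E_sub in \<open>simp add: neron_severi_scaleR_left[OF H\<^sub>E]\<close>)
  moreover have "real d * Im (H\<^sub>E x p) \<in> \<int>" using * p by blast
  ultimately obtain e and k :: int where "e \<in> E" "x = e + of_int k *\<^sub>R p"
    by (rule orthogonal_to_p)
  then show "x \<in> E'" unfolding E'_def by blast
next
  assume "x \<in> E'"
  then obtain e and k :: int where e: "e \<in> E" "x = e + of_int k *\<^sub>R p" unfolding E'_def by blast
  show "\<forall>\<gamma>\<in>E'. real d * Im (H\<^sub>E x \<gamma>) \<in> \<int>"
  proof
    fix \<gamma> assume "\<gamma> \<in> E'"
    then obtain e' and k' :: int where e': "e' \<in> E" "\<gamma> = e' + of_int k' *\<^sub>R p" unfolding E'_def by blast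
    have "real d * Im (H\<^sub>E x \<gamma>) = real d * Im (H\<^sub>E e e') + of_int k' * Im (H\<^sub>E e (real d *\<^sub>R p))
        + of_int k * Im (H\<^sub>E (real d *\<^sub>R p) e')"
      unfolding e e'
      by (simp add: neron_severi_linear[OF H\<^sub>E] algebra_simps)
    also have "\<dots> \<in> \<int>"
      by (intro Ints_add Ints_mult neron_severi_integral[OF H\<^sub>E] dp e(1) e'(1)) simp_all
    finally show "real d * Im (H\<^sub>E x \<gamma>) \<in> \<int>" .
  qed
qed

lemma
  shows H_add_left: "H (x + x') y = H x y + H x' y"
    and H_scaleR_left: "H (r *\<^sub>R x) y = of_real r * H x y"
    and H_add_right: "H x (y + y') = H x y + H x y'"
    and H_scaleR_right: "H x (r *\<^sub>R y) = of_real r * H x y"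
    and H_Im_swap: "Im (H y x) = - Im (H x y)"
    and H_Im_same: "Im (H x x) = 0"
proof -
  show "H (x + x') y = H x y + H x' y" "H (r *\<^sub>R x) y = of_real r * H x y"
    "H x (y + y') = H x y + H x y'" "H x (r *\<^sub>R y) = of_real r * H x y"
    by (simp_all add: H_def neron_severi_linear[OF H\<^sub>E] neron_severi_linear[OF H\<^sub>B] algebra_simps)
  show "Im (H y x) = - Im (H x y)"
    unfolding H_def by (simp add: neron_severi_Im_swap[OF H\<^sub>E, of "vfst y"] neron_severi_Im_swap[OF H\<^sub>B, of "vsnd y"])
  show "Im (H x x) = 0"
    unfolding H_def by (simp add: neron_severi_linear[OF H\<^sub>E] neron_severi_linear[OF H\<^sub>B])
qed

lemma H_g_integral:
  assumes "x \<in> vprod E B"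
  shows "Im (H g x) \<in> \<int>" and "Im (H x g) \<in> \<int>"
proof -
  have "Im (H g x) = Im (H\<^sub>E (real d *\<^sub>R p) (vfst x)) + Im (H\<^sub>B q (vsnd x))"
    by (simp add: H_def neron_severi_scaleR_left[OF H\<^sub>E])
  also have "\<dots> \<in> \<int>"
    using assms by (intro Ints_add neron_severi_integral[OF H\<^sub>E] q_kernel dp) (simp_all add: vprod_iff)
  finally show "Im (H g x) \<in> \<int>" .
  then show "Im (H x g) \<in> \<int>" using H_Im_swap[of x g] by simp
qed

text \<open>
  The form descends to the quotient because the generator \<open>g\<close> lies in the kernel of the product
  polarisation and a cyclic subgroup is isotropic.
\<close>

lemma neron_severi_H: "neron_severi A H"
  unfolding neron_severi_def
proof (intro conjI allI ballI)
  show "H (u + v) w = H u w + H v w" for u v w by (rule H_add_left)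
  show "H (c *s v) w = c * H v w" for c v w
    by (simp add: H_def neron_severi_scale_left[OF H\<^sub>E] neron_severi_scale_left[OF H\<^sub>B] algebra_simps)
  show "H w v = cnj (H v w)" for v w
    unfolding H_def
    by (simp add: neron_severi_cnj[OF H\<^sub>E, of "vfst w"] neron_severi_cnj[OF H\<^sub>B, of "vsnd w"])
  fix \<gamma> \<gamma>' assume "\<gamma> \<in> A" "\<gamma>' \<in> A"
  then obtain x y and k l :: int where *: "x \<in> vprod E B" "\<gamma> = x + of_int k *\<^sub>R g"
    "y \<in> vprod E B" "\<gamma>' = y + of_int l *\<^sub>R g"
    by (elim A_cases)
  have "Im (H \<gamma> \<gamma>') = real d * Im (H\<^sub>E (vfst x) (vfst y)) + Im (H\<^sub>B (vsnd x) (vsnd y))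
      + of_int l * Im (H x g) + of_int k * Im (H g y)"
    by (simp add: * H_add_left H_add_right H_scaleR_left H_scaleR_right H_Im_same)
      (simp add: H_def)
  also have "\<dots> \<in> \<int>"
    using * by (intro Ints_add Ints_mult H_g_integral neron_severi_integral[OF H\<^sub>E] neron_severi_integral[OF H\<^sub>B])
      (simp_all add: vprod_iff)
  finally show "Im (H \<gamma> \<gamma>') \<in> \<int>" .
qed

definition \<alpha>\<^sub>0 where "\<alpha>\<^sub>0 x = \<alpha>\<^sub>E (vfst x) * \<alpha>\<^sub>B (vsnd x)"

lemma neron_severi_product: "neron_severi (vprod E B) H"
  by (rule neron_severi_subset[OF neron_severi_H vprod_subset_A])

lemma semicharacter_product: "semicharacter (vprod E B) H \<alpha>\<^sub>0"
  unfolding semicharacter_def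
proof (intro conjI ballI)
  show "norm (\<alpha>\<^sub>0 \<gamma>) = 1" if "\<gamma> \<in> vprod E B" for \<gamma>
    using that \<alpha>\<^sub>E \<alpha>\<^sub>B by (simp add: \<alpha>\<^sub>0_def norm_mult vprod_iff semicharacter_def)
  fix \<gamma> \<gamma>' assume *: "\<gamma> \<in> vprod E B" "\<gamma>' \<in> vprod E B"
  have "\<alpha>\<^sub>E (vfst \<gamma> + vfst \<gamma>') = \<alpha>\<^sub>E (vfst \<gamma>) * \<alpha>\<^sub>E (vfst \<gamma>') * cis (pi * Im (of_nat d * H\<^sub>E (vfst \<gamma>) (vfst \<gamma>')))"
    using \<alpha>\<^sub>E * unfolding semicharacter_def vprod_iff by blast
  moreover have "\<alpha>\<^sub>B (vsnd \<gamma> + vsnd \<gamma>') = \<alpha>\<^sub>B (vsnd \<gamma>) * \<alpha>\<^sub>B (vsnd \<gamma>') * cis (pi * Im (H\<^sub>B (vsnd \<gamma>) (vsnd \<gamma>')))"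
    using \<alpha>\<^sub>B * unfolding semicharacter_def vprod_iff by blast
  moreover have "cis (pi * Im (H \<gamma> \<gamma>')) = cis (pi * Im (of_nat d * H\<^sub>E (vfst \<gamma>) (vfst \<gamma>')))
      * cis (pi * Im (H\<^sub>B (vsnd \<gamma>) (vsnd \<gamma>')))"
    by (simp add: H_def cis_mult distrib_left)
  ultimately show "\<alpha>\<^sub>0 (\<gamma> + \<gamma>') = \<alpha>\<^sub>0 \<gamma> * \<alpha>\<^sub>0 \<gamma>' * cis (pi * Im (H \<gamma> \<gamma>'))"
    by (simp add: \<alpha>\<^sub>0_def)
qed

text \<open>
  A semicharacter of the product extends to the overlattice: on \<open>g\<close> it takes a \<open>d\<close>-th root \<open>cis \<zeta>\<close> of
  its value at \<open>d g\<close>, and the cocycle condition determines the rest.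
\<close>

lemma semicharacter_extension:
  obtains \<alpha> where "semicharacter A H \<alpha>" "\<And>x. x \<in> vprod E B \<Longrightarrow> \<alpha> x = \<alpha>\<^sub>0 x"
proof -
  have dg: "real d *\<^sub>R g \<in> vprod E B" using multiple_g[of "int d"] by simp
  have "norm (\<alpha>\<^sub>0 (real d *\<^sub>R g)) = 1"
    using semicharacter_product dg unfolding semicharacter_def by blast
  then have "\<alpha>\<^sub>0 (real d *\<^sub>R g) = cis (Arg (\<alpha>\<^sub>0 (real d *\<^sub>R g)))"
    using rcis_cmod_Arg[of "\<alpha>\<^sub>0 (real d *\<^sub>R g)"] by (simp add: rcis_def)
  moreover define \<zeta> where "\<zeta> = Arg (\<alpha>\<^sub>0 (real d *\<^sub>R g)) / real d"
  ultimately have \<zeta>: "\<alpha>\<^sub>0 (real d *\<^sub>R g) = cis (real d * \<zeta>)" using d by simp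
  \<comment> \<open>The value at \<open>x + k g\<close> forced by the cocycle condition; here \<open>Im (H g g) = 0\<close>.\<close>
  define val where "val x k = \<alpha>\<^sub>0 x * cis (of_int k * \<zeta> + pi * (of_int k * Im (H x g)))" for x and k :: int
  have mult: "\<alpha>\<^sub>0 (x + y) = \<alpha>\<^sub>0 x * \<alpha>\<^sub>0 y * cis (pi * Im (H x y))" if "x \<in> vprod E B" "y \<in> vprod E B" for x y
    using semicharacter_product that unfolding semicharacter_def by blast
  \<comment> \<open>Two decompositions of a vector differ by a multiple \<open>j\<close> of \<open>d g\<close>, and \<open>cis \<zeta>\<close> is a \<open>d\<close>-th root of
    \<open>\<alpha>\<^sub>0 (d g)\<close>.\<close>
  have shift: "val x k = val y l"
    if xy: "x \<in> vprod E B" "y \<in> vprod E B" "x + of_int k *\<^sub>R g = y + of_int l *\<^sub>R g" for x y k l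
  proof -
    have y: "y = x + of_int (k - l) *\<^sub>R g" using xy(3) by (simp add: scaleR_diff_left algebra_simps)
    then have "of_int (k - l) *\<^sub>R g = y - x" by simp
    then have "of_int (k - l) *\<^sub>R g \<in> vprod E B" using add_subgroup_diff[OF product xy(2,1)] by simp
    then obtain j where j: "k - l = int d * j" using multiple_g by blast
    have jg: "of_int (k - l) *\<^sub>R g = of_int j *\<^sub>R (real d *\<^sub>R g)" by (simp add: j mult.commute)
    have k: "k = l + int d * j" using j by simp
    have "\<alpha>\<^sub>0 y = \<alpha>\<^sub>0 x * \<alpha>\<^sub>0 (of_int j *\<^sub>R (real d *\<^sub>R g)) * cis (pi * Im (H x (of_int j *\<^sub>R (real d *\<^sub>R g))))"
      unfolding y jg by (rule mult[OF xy(1) add_subgroup_scale_int[OF product dg]])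
    also have "\<alpha>\<^sub>0 (of_int j *\<^sub>R (real d *\<^sub>R g)) = cis (of_int j * (real d * \<zeta>))"
      by (rule semicharacter_isotropic_line[OF semicharacter_product product neron_severi_product dg \<zeta>])
    finally have "\<alpha>\<^sub>0 y = \<alpha>\<^sub>0 x * cis (of_int j * (real d * \<zeta>) + pi * (of_int j * (real d * Im (H x g))))"
      by (simp add: H_scaleR_right cis_mult mult.assoc)
    moreover have "Im (H y g) = Im (H x g)"
      by (simp add: y H_add_left H_scaleR_left H_Im_same)
    ultimately have "val y l = \<alpha>\<^sub>0 x * cis ((of_int j * (real d * \<zeta>) + pi * (of_int j * (real d * Im (H x g))))
        + (of_int l * \<zeta> + pi * (of_int l * Im (H x g))))"
      by (simp add: val_def mult.assoc cis_mult)
    also have "\<dots> = val x k"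
      unfolding val_def k by (rule arg_cong[where f = "\<lambda>t. \<alpha>\<^sub>0 x * cis t"]) (simp add: algebra_simps)
    finally show ?thesis ..
  qed
  define \<alpha> where "\<alpha> \<gamma> = (SOME z. \<exists>x k. x \<in> vprod E B \<and> \<gamma> = x + of_int k *\<^sub>R g \<and> z = val x k)" for \<gamma>
  have \<alpha>: "\<alpha> (x + of_int k *\<^sub>R g) = val x k" if "x \<in> vprod E B" for x k
  proof -
    have "\<exists>x' k'. x' \<in> vprod E B \<and> x + of_int k *\<^sub>R g = x' + of_int k' *\<^sub>R g \<and> \<alpha> (x + of_int k *\<^sub>R g) = val x' k'"
      unfolding \<alpha>_def by (rule someI_ex) (use that in blast)
    then show ?thesis using shift that by metis
  qed
  have "semicharacter A H \<alpha>"
    unfolding semicharacter_def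
  proof (intro conjI ballI)
    fix \<gamma> assume "\<gamma> \<in> A"
    then obtain x and k :: int where *: "x \<in> vprod E B" "\<gamma> = x + of_int k *\<^sub>R g" by (rule A_cases)
    have "norm (\<alpha>\<^sub>0 x) = 1" using semicharacter_product *(1) unfolding semicharacter_def by blast
    then show "norm (\<alpha> \<gamma>) = 1" by (simp add: *(2) \<alpha>[OF *(1)] val_def norm_mult)
  next
    fix \<gamma> \<gamma>' assume "\<gamma> \<in> A" "\<gamma>' \<in> A"
    then obtain x y and k l :: int where *: "x \<in> vprod E B" "\<gamma> = x + of_int k *\<^sub>R g"
      "y \<in> vprod E B" "\<gamma>' = y + of_int l *\<^sub>R g"
      by (elim A_cases)
    define a b c where "a = Im (H x g)" and "b = Im (H y g)" and "c = Im (H x y)"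
    have sum: "\<gamma> + \<gamma>' = (x + y) + of_int (k + l) *\<^sub>R g" by (simp add: * scaleR_add_left)
    have form: "Im (H \<gamma> \<gamma>') = c + of_int l * a - of_int k * b"
      by (simp add: * H_add_left H_add_right H_scaleR_left H_scaleR_right H_Im_same a_def b_def c_def
          H_Im_swap[of g y])
    have "\<alpha> (\<gamma> + \<gamma>') = \<alpha>\<^sub>0 x * \<alpha>\<^sub>0 y * cis (pi * c + (of_int (k + l) * \<zeta> + pi * (of_int (k + l) * (a + b))))"
      unfolding sum \<alpha>[OF add_subgroup_add[OF product *(1,3)]]
      by (simp add: val_def mult[OF *(1,3)] H_add_left cis_mult mult.assoc a_def b_def c_def)
    also have "pi * c + (of_int (k + l) * \<zeta> + pi * (of_int (k + l) * (a + b)))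
        = (of_int k * \<zeta> + pi * (of_int k * a)) + (of_int l * \<zeta> + pi * (of_int l * b))
          + pi * (c + of_int l * a - of_int k * b) + 2 * pi * (of_int k * b)"
      by (simp add: algebra_simps)
    also have "\<alpha>\<^sub>0 x * \<alpha>\<^sub>0 y * cis \<dots> = \<alpha> \<gamma> * \<alpha> \<gamma>' * cis (pi * Im (H \<gamma> \<gamma>')) * cis (2 * pi * (of_int k * b))"
      unfolding form unfolding * \<alpha>[OF *(1)] \<alpha>[OF *(3)] val_def a_def b_def
      by (simp add: cis_mult[symmetric])
    also have "cis (2 * pi * (of_int k * b)) = 1"
      unfolding b_def by (intro cis_multiple_2pi Ints_mult H_g_integral *(3)) simp
    finally show "\<alpha> (\<gamma> + \<gamma>') = \<alpha> \<gamma> * \<alpha> \<gamma>' * cis (pi * Im (H \<gamma> \<gamma>'))" by simp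
  qed
  moreover have "\<alpha> x = \<alpha>\<^sub>0 x" if "x \<in> vprod E B" for x
    using \<alpha>[OF that, of 0] by (simp add: val_def)
  ultimately show thesis by (rule that)
qed

end

subsection \<open>Kernels of polarisations\<close>

text \<open>
  The map \<open>F\<close> is just additive, not complex linear, because isomorphisms between kernels of
  polarisations involve imaginary parts of forms.
\<close>

lemma subquotient_isomorphic:
  fixes \<Lambda> :: "(complex ^ 'n) set" and \<Lambda>' :: "(complex ^ 'm) set"
  assumes \<Lambda>: "add_subgroup \<Lambda>" "add_subgroup \<Lambda>'"
    and F: "\<And>u v. F (u + v) = F u + F v" "F ` X \<subseteq> Y"
    and ker: "\<And>x. x \<in> X \<Longrightarrow> F x \<in> \<Lambda>' \<longleftrightarrow> x \<in> \<Lambda>"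
    and X: "add_subgroup X" "\<Lambda> \<subseteq> X"
    and surj: "\<And>y. y \<in> Y \<Longrightarrow> \<exists>x\<in>X. y - F x \<in> \<Lambda>'"
  shows "(torus \<Lambda>)\<lparr>carrier := point \<Lambda> ` X\<rparr> \<cong> (torus \<Lambda>')\<lparr>carrier := point \<Lambda>' ` Y\<rparr>" (is "?G \<cong> ?G'")
proof -
  have F_diff: "F (u - v) = F u - F v" for u v
    using F(1)[of "u - v" v] by (simp add: algebra_simps)
  define f where "f S = point \<Lambda>' (F (SOME x. x \<in> S \<and> x \<in> X))" for S
  have f: "f (point \<Lambda> x) = point \<Lambda>' (F x)" if x: "x \<in> X" for x
  proof -
    have "x \<in> point \<Lambda> x \<and> x \<in> X" using in_point[OF \<Lambda>(1)] x by blast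
    then have s: "(SOME x'. x' \<in> point \<Lambda> x \<and> x' \<in> X) \<in> point \<Lambda> x \<and> (SOME x'. x' \<in> point \<Lambda> x \<and> x' \<in> X) \<in> X"
      by (rule someI)
    define y where "y = (SOME x'. x' \<in> point \<Lambda> x \<and> x' \<in> X)"
    have y: "y - x \<in> \<Lambda>" using s by (simp add: y_def point_eq)
    then have "F (y - x) \<in> \<Lambda>'" using ker X(2) by blast
    then show ?thesis by (simp add: f_def point_eq_iff[OF \<Lambda>(2)] F_diff y_def)
  qed
  have "f \<in> iso ?G ?G'"
  proof (rule isoI)
    show "f \<in> hom ?G ?G'"
    proof (rule homI)
      show "f x \<in> carrier ?G'"
        if "x \<in> carrier ?G" for x
        using that F(2) by (auto simp: f)
      fix x y assume "x \<in> carrier ?G" "y \<in> carrier ?G"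
      then obtain u v where "u \<in> X" "v \<in> X" "x = point \<Lambda> u" "y = point \<Lambda> v" by auto
      then show "f (x \<otimes>\<^bsub>?G\<^esub> y)
          = f x \<otimes>\<^bsub>?G'\<^esub> f y"
        by (simp add: mult_torus \<Lambda> f F(1) add_subgroup_add[OF X(1)])
    qed
    show "bij_betw f (carrier ?G) (carrier ?G')"
      unfolding bij_betw_def
    proof
      show "inj_on f (carrier ?G)"
      proof (rule inj_onI)
        fix x y assume "x \<in> carrier ?G"
          "y \<in> carrier ?G" and eq: "f x = f y"
        then obtain u v where uv: "u \<in> X" "v \<in> X" "x = point \<Lambda> u" "y = point \<Lambda> v" by auto
        then have "F (u - v) \<in> \<Lambda>'" using eq by (simp add: f F_diff point_eq_iff[OF \<Lambda>(2)])
        then have "u - v \<in> \<Lambda>" using ker add_subgroup_diff[OF X(1) uv(1,2)] by blast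
        then show "x = y" by (simp add: uv point_eq_iff[OF \<Lambda>(1)])
      qed
      show "f ` carrier ?G = carrier ?G'"
      proof
        show "f ` carrier ?G \<subseteq> carrier ?G'"
          using F(2) by (auto simp: f)
        show "carrier ?G' \<subseteq> f ` carrier ?G"
        proof
          fix z assume "z \<in> carrier ?G'"
          then obtain y where y: "y \<in> Y" "z = point \<Lambda>' y" by auto
          obtain x where x: "x \<in> X" "y - F x \<in> \<Lambda>'" using surj[OF y(1)] by blast
          have "z = f (point \<Lambda> x)" using x by (simp add: y(2) f point_eq_iff[OF \<Lambda>(2)])
          then show "z \<in> f ` carrier ?G" using x(1) by simp
        qed
      qed
    qed
  qed
  then show ?thesis unfolding is_iso_def by blast
qed

lemma group_points:
  fixes \<Lambda> :: "(complex ^ 'n) set"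
  assumes \<Lambda>: "add_subgroup \<Lambda>" and X: "add_subgroup X"
  shows "group ((torus \<Lambda>)\<lparr>carrier := point \<Lambda> ` X\<rparr>)"
proof -
  interpret comm_group "torus \<Lambda>" by (rule comm_group_torus[OF \<Lambda>])
  have "subgroup (point \<Lambda> ` X) (torus \<Lambda>)"
  proof (rule subgroupI)
    show "point \<Lambda> ` X \<subseteq> carrier (torus \<Lambda>)" by (auto simp: carrier_torus)
    show "point \<Lambda> ` X \<noteq> {}" using add_subgroup_zero[OF X] by blast
    show "inv\<^bsub>torus \<Lambda>\<^esub> a \<in> point \<Lambda> ` X" if "a \<in> point \<Lambda> ` X" for a
      using that by (auto simp: inv_torus[OF \<Lambda>] add_subgroup_minus[OF X])
    show "a \<otimes>\<^bsub>torus \<Lambda>\<^esub> b \<in> point \<Lambda> ` X" if "a \<in> point \<Lambda> ` X" "b \<in> point \<Lambda> ` X" for a b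
      using that by (auto simp: mult_torus[OF \<Lambda>] add_subgroup_add[OF X])
  qed
  then show ?thesis by (rule subgroup.subgroup_is_group) (rule group_torus[OF \<Lambda>])
qed

lemma add_subgroup_dual:
  fixes \<Lambda> :: "(complex ^ 'n) set"
  assumes "neron_severi \<Lambda> K"
  shows "add_subgroup {x. \<forall>\<gamma>\<in>\<Lambda>. Im (K x \<gamma>) \<in> \<int>}"
  by (simp add: add_subgroup_def neron_severi_zero_left[OF assms] neron_severi_diff_left[OF assms])

context gluing
begin

text \<open>
  The kernel of the polarisation of the quotient is \<open>g\<^sup>\<bottom> / \<langle>g\<rangle>\<close> inside \<open>E[d] \<times> K(L\<^sub>B)\<close>. Each \<open>y\<close> in \<open>K(L\<^sub>B)\<close>
  is completed to an element of \<open>g\<^sup>\<bottom>\<close> by the multiple of \<open>P' / d\<close> that cancels its pairing with \<open>q\<close>; this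
  multiple depends linearly on \<open>y\<close>. The elements so obtained represent every class modulo \<open>g\<close> exactly
  once because \<open>P' / d\<close> and \<open>p\<close> generate \<open>E[d]\<close>.
\<close>

lemma kernel_isomorphic:
  "(torus B)\<lparr>carrier := point B ` {y. \<forall>b\<in>B. Im (H\<^sub>B y b) \<in> \<int>}\<rparr> \<cong>
   (torus A)\<lparr>carrier := point A ` {x. \<forall>\<gamma>\<in>A. Im (H x \<gamma>) \<in> \<int>}\<rparr>"
proof -
  obtain P' and t :: int where P': "P' \<in> E" "Im (H\<^sub>E P' (real d *\<^sub>R p)) = of_int (1 - t * int d)"
    by (rule dual_vector)
  have dR: "real d > 0" "real d \<noteq> 0" using d by simp_all
  define p' where "p' = (1 / real d) *\<^sub>R P'"
  have dp': "real d *\<^sub>R p' = P'" using dR by (simp add: p'_def)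
  have pairing: "real d * Im (H\<^sub>E p' p) = 1 / real d - of_int t"
  proof -
    have "real d * Im (H\<^sub>E P' p) = of_int (1 - t * int d)"
      using P'(2) by (simp add: neron_severi_scaleR_right[OF H\<^sub>E])
    then have "Im (H\<^sub>E P' p) = 1 / real d - of_int t" using dR by (simp add: field_simps)
    then show ?thesis using dR by (simp add: p'_def neron_severi_scaleR_left[OF H\<^sub>E])
  qed
  define c where "c y = real d * Im (H\<^sub>B y q)" for y
  define F where "F y = vjoin (- c y *\<^sub>R p') y" for y
  let ?X = "{y. \<forall>b\<in>B. Im (H\<^sub>B y b) \<in> \<int>}" and ?Y = "{x. \<forall>\<gamma>\<in>A. Im (H x \<gamma>) \<in> \<int>}"
  have q_swap: "Im (H\<^sub>B b q) \<in> \<int>" if "b \<in> B" for b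
    using q_kernel[OF that] neron_severi_Im_swap[OF H\<^sub>B, of b q] by simp
  have c_int: "c y \<in> \<int>" if "y \<in> ?X" for y
  proof -
    have "Im (H\<^sub>B y (real d *\<^sub>R q)) \<in> \<int>" using that dq by blast
    then show ?thesis by (simp add: c_def neron_severi_scaleR_right[OF H\<^sub>B])
  qed
  have c_diff: "c (y - of_int k *\<^sub>R q) = c y" for y k
    by (simp add: c_def neron_severi_linear[OF H\<^sub>B])
  have F_add: "F (u + v) = F u + F v" for u v
    by (simp add: F_def c_def vjoin_def vec_eq_iff neron_severi_add_left[OF H\<^sub>B] algebra_simps split: sum.split)
  have mult_p': "of_int n *\<^sub>R P' \<in> E" for n by (rule add_subgroup_scale_int[OF E P'(1)])
  have FY: "F y \<in> ?Y" if y: "y \<in> ?X" for y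
  proof -
    obtain n :: int where n: "c y = of_int n" using c_int[OF y] by (auto elim: Ints_cases)
    have "Im (H (F y) \<gamma>) \<in> \<int>" if "\<gamma> \<in> A" for \<gamma>
    proof -
      obtain x and k :: int where x: "x \<in> vprod E B" "\<gamma> = x + of_int k *\<^sub>R g" using \<open>\<gamma> \<in> A\<close> by (rule A_cases)
      have "Im (H (F y) g) = - c y * (real d * Im (H\<^sub>E p' p)) + Im (H\<^sub>B y q)"
        by (simp add: H_def F_def neron_severi_linear[OF H\<^sub>E])
      also have "\<dots> = c y * of_int t" using dR by (simp add: pairing c_def field_simps)
      finally have "Im (H (F y) g) \<in> \<int>" by (simp add: n)
      moreover have "Im (H (F y) x) = - c y * Im (H\<^sub>E P' (vfst x)) + Im (H\<^sub>B y (vsnd x))"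
        by (simp add: H_def F_def neron_severi_linear[OF H\<^sub>E] dp'[symmetric])
      then have "Im (H (F y) x) \<in> \<int>"
        using x(1) y neron_severi_integral[OF H\<^sub>E P'(1)] by (simp add: n vprod_iff)
      ultimately show ?thesis by (simp add: x(2) H_add_right H_scaleR_right)
    qed
    then show ?thesis by blast
  qed
  have ker: "F y \<in> A \<longleftrightarrow> y \<in> B" if y: "y \<in> ?X" for y
  proof -
    have B_fst: "c b *\<^sub>R p' \<in> E" if b: "b \<in> B" for b
    proof -
      obtain n :: int where n: "Im (H\<^sub>B b q) = of_int n" using q_swap[OF b] by (auto elim: Ints_cases)
      have "c b *\<^sub>R p' = of_int n *\<^sub>R P'" by (simp add: c_def n dp'[symmetric] mult.commute)
      then show ?thesis using mult_p'[of n] by simp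
    qed
    show ?thesis
    proof
      assume "F y \<in> A"
      then obtain x and k :: int where x: "x \<in> vprod E B" "F y = x + of_int k *\<^sub>R g" by (rule A_cases)
      have *: "- c y *\<^sub>R p' = vfst x + of_int k *\<^sub>R p" "y = vsnd x + of_int k *\<^sub>R q"
        using arg_cong[OF x(2), of vfst] arg_cong[OF x(2), of vsnd] by (simp_all add: F_def)
      have xB: "vfst x \<in> E" "vsnd x \<in> B" using x(1) by (simp_all add: vprod_iff)
      have "c y = c (vsnd x)" using c_diff[of y k] *(2) by simp
      then have "c y *\<^sub>R p' \<in> E" using B_fst[OF xB(2)] by simp
      moreover have "of_int k *\<^sub>R p = - (c y *\<^sub>R p') - vfst x" using *(1) by (simp add: algebra_simps)
      ultimately have "of_int k *\<^sub>R p \<in> E"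
        using xB(1) by (simp add: add_subgroup_diff[OF E] add_subgroup_minus[OF E])
      then have "of_int k *\<^sub>R q \<in> B" by (simp add: p q)
      then show "y \<in> B" using *(2) xB(2) by (simp add: add_subgroup_add[OF B])
    next
      assume "y \<in> B"
      then have "F y \<in> vprod E B" using B_fst by (simp add: F_def vprod_iff add_subgroup_minus[OF E])
      then show "F y \<in> A" using vprod_subset_A by blast
    qed
  qed
  have surj: "\<exists>y\<in>?X. x - F y \<in> A" if x: "x \<in> ?Y" for x
  proof -
    have xA: "Im (H x \<gamma>) \<in> \<int>" if "\<gamma> \<in> A" for \<gamma> using x that by blast
    define y where "y = vsnd x"
    have y: "y \<in> ?X"
    proof -
      have "Im (H\<^sub>B y b) \<in> \<int>" if "b \<in> B" for b
        using xA[of "vjoin 0 b"] that by (simp add: vjoin_0_right_in_A H_def y_def neron_severi_zero_right[OF H\<^sub>E])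
      then show ?thesis by blast
    qed
    obtain n :: int where n: "c y = of_int n" using c_int[OF y] by (auto elim: Ints_cases)
    define z where "z = vfst x + c y *\<^sub>R p'"
    have "real d *\<^sub>R vfst x \<in> E"
    proof (rule unimodular)
      fix \<gamma> assume "\<gamma> \<in> E"
      then show "Im (H\<^sub>E (real d *\<^sub>R vfst x) \<gamma>) \<in> \<int>"
        using xA[of "vjoin \<gamma> 0"] by (simp add: vjoin_0_in_A H_def neron_severi_zero_right[OF H\<^sub>B] neron_severi_scaleR_left[OF H\<^sub>E])
    qed
    moreover have "real d *\<^sub>R z = real d *\<^sub>R vfst x + of_int n *\<^sub>R P'"
      by (simp add: z_def n dp'[symmetric] scaleR_add_right)
    ultimately have dz: "real d *\<^sub>R z \<in> E" by (simp add: add_subgroup_add[OF E] mult_p')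
    have "0 + of_int 1 *\<^sub>R g \<in> A" by (rule A_intro[OF add_subgroup_zero[OF product]])
    then have "Im (H x g) \<in> \<int>" using xA by simp
    moreover have "real d * Im (H\<^sub>E z p) = Im (H x g) - of_int (n * t)"
    proof -
      have "real d * Im (H\<^sub>E z p) = real d * Im (H\<^sub>E (vfst x) p) + c y * (real d * Im (H\<^sub>E p' p))"
        by (simp add: z_def neron_severi_linear[OF H\<^sub>E] algebra_simps)
      also have "\<dots> = real d * Im (H\<^sub>E (vfst x) p) + (c y / real d - of_int (n * t))"
        unfolding pairing by (simp add: n algebra_simps)
      also have "c y / real d = Im (H\<^sub>B y q)" using dR by (simp add: c_def)
      finally show ?thesis by (simp add: H_def y_def)
    qed
    ultimately have "real d * Im (H\<^sub>E z p) \<in> \<int>" by simp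
    with dz obtain e and k :: int where e: "e \<in> E" "z = e + of_int k *\<^sub>R p" by (rule orthogonal_to_p)
    define y' where "y' = y - of_int k *\<^sub>R q"
    have "of_int k *\<^sub>R q \<in> ?X"
      using q_kernel by (simp add: neron_severi_scaleR_left[OF H\<^sub>B])
    then have y': "y' \<in> ?X"
      unfolding y'_def using add_subgroup_diff[OF add_subgroup_dual[OF H\<^sub>B] y] by blast
    have "x - F y' = vjoin e 0 + of_int k *\<^sub>R g"
    proof -
      have "vfst (x - F y') = vfst (vjoin e 0 + of_int k *\<^sub>R g)"
        using e(2) by (simp add: F_def y'_def c_diff z_def algebra_simps)
      moreover have "vsnd (x - F y') = vsnd (vjoin e 0 + of_int k *\<^sub>R g)"
        by (simp add: F_def y'_def y_def)
      ultimately show ?thesis by (metis vjoin_vfst_vsnd)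
    qed
    moreover have "vjoin e 0 + of_int k *\<^sub>R g \<in> A"
      by (rule A_intro) (simp add: vprod_iff e(1) add_subgroup_zero[OF B])
    ultimately show ?thesis using y' by (intro bexI[of _ y']) simp_all
  qed
  show ?thesis
  proof (rule subquotient_isomorphic[where F = F, OF B add_subgroup_A F_add _ ker _ _ surj])
    show "F ` ?X \<subseteq> ?Y" using FY by blast
    show "add_subgroup ?X" by (rule add_subgroup_dual[OF H\<^sub>B])
    show "B \<subseteq> ?X" using neron_severi_integral[OF H\<^sub>B] by blast
  qed
qed

subsection \<open>Ampleness and complementary subvarieties\<close>

text \<open>
  On the lattice of \<open>E \<times> B\<close> the bundle is the external product of the two given ones; the exponents
  \<open>k\<close> and \<open>l\<close> of their very ample powers are replaced by the common multiple \<open>k l\<close>.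
\<close>

lemma ample_A:
  assumes \<alpha>: "semicharacter A H \<alpha>" "\<And>x. x \<in> vprod E B \<Longrightarrow> \<alpha> x = \<alpha>\<^sub>0 x"
    and SE: "embedding_sections E (tensor_power (appell_humbert (\<lambda>v w. of_nat d * H\<^sub>E v w) \<alpha>\<^sub>E) k) S"
    and SB: "embedding_sections B (tensor_power (appell_humbert H\<^sub>B \<alpha>\<^sub>B) l) T"
    and kl: "k \<ge> 1" "l \<ge> 1"
  shows "ample A (appell_humbert H \<alpha>)"
proof -
  let ?L = "appell_humbert H \<alpha>" and ?LE = "appell_humbert (\<lambda>v w. of_nat d * H\<^sub>E v w) \<alpha>\<^sub>E" and ?LB = "appell_humbert H\<^sub>B \<alpha>\<^sub>B"
  have "embedding_sections (vprod E B)
      (box_bundle (tensor_power (tensor_power ?LE k) l) (tensor_power (tensor_power ?LB l) k))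
      (box_sections (monomials S l) (monomials T k))"
    by (rule embedding_sections_box[OF E B embedding_sections_power[OF SE kl(2)] embedding_sections_power[OF SB kl(1)]])
  then have emb: "embedding_sections (vprod E B) (tensor_power ?L (k * l)) (box_sections (monomials S l) (monomials T k))"
  proof (rule embedding_sections_cong)
    fix \<gamma> v assume \<gamma>: "\<gamma> \<in> vprod E B"
    have "?L \<gamma> v = ?LE (vfst \<gamma>) (vfst v) * ?LB (vsnd \<gamma>) (vsnd v)"
      by (simp add: appell_humbert_def \<alpha>(2)[OF \<gamma>] \<alpha>\<^sub>0_def H_def distrib_left exp_add mult_ac)
    then show "box_bundle (tensor_power (tensor_power ?LE k) l) (tensor_power (tensor_power ?LB l) k) \<gamma> v
        = tensor_power ?L (k * l) \<gamma> v"
      by (simp add: box_bundle_def tensor_power_def power_mult_distrib power_mult[symmetric] mult.commute)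
  qed
  define R where "R = (\<lambda>j. real j *\<^sub>R g) ` {..<d}"
  have R: "coset_representatives (vprod E B) A R"
    unfolding coset_representatives_def
  proof (intro conjI ballI impI)
    show "finite R" by (simp add: R_def)
    show "0 \<in> R" using d by (auto simp: R_def intro!: image_eqI[of _ _ 0])
    show "R \<subseteq> A"
      using A_intro[OF add_subgroup_zero[OF product], of "int _"] by (auto simp: R_def)
    show "\<exists>r\<in>R. \<gamma> - r \<in> vprod E B" if \<gamma>: "\<gamma> \<in> A" for \<gamma>
    proof -
      obtain x and m :: int where x: "x \<in> vprod E B" "\<gamma> = x + of_int m *\<^sub>R g" using \<gamma> by (rule A_cases)
      define j where "j = nat (m mod int d)"
      have j: "int j = m mod int d" using d by (simp add: j_def)
      then have jd: "j < d" using d by (metis of_nat_0_less_iff of_nat_less_iff pos_mod_bound)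
      have "\<gamma> - real j *\<^sub>R g = x + of_int (m - int j) *\<^sub>R g" by (simp add: x(2) scaleR_diff_left)
      moreover have "of_int (m - int j) *\<^sub>R g \<in> vprod E B" unfolding multiple_g j by (simp add: minus_mod_eq_mult_div)
      ultimately have "\<gamma> - real j *\<^sub>R g \<in> vprod E B" using add_subgroup_add[OF product x(1)] by simp
      then show ?thesis using jd by (auto simp: R_def)
    qed
    fix r r' assume "r \<in> R" "r' \<in> R" and diff: "r - r' \<in> vprod E B"
    then obtain i j where ij: "i < d" "j < d" "r = real i *\<^sub>R g" "r' = real j *\<^sub>R g" by (auto simp: R_def)
    have "of_int (int i - int j) *\<^sub>R g \<in> vprod E B" using diff by (simp add: ij scaleR_diff_left)
    then have "int d dvd int i - int j" by (simp only: multiple_g)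
    moreover have "\<bar>int i - int j\<bar> < int d" using ij by linarith
    ultimately have "int i - int j = 0" by (metis dvd_imp_le_int abs_of_nat not_less)
    then show "r = r'" by (simp add: ij)
  qed
  have f: "factor_of_automorphy A (tensor_power ?L (k * l))"
    by (rule factor_of_automorphy_power[OF factor_of_automorphy_appell_humbert[OF neron_severi_H \<alpha>(1)]])
  have "very_ample A (tensor_power (tensor_power ?L (k * l)) (2 * card R))"
    by (rule embedding_sections_imp_very_ample[OF embedding_sections_quotient[OF product add_subgroup_A vprod_subset_A R f emb]])
  moreover have "tensor_power (tensor_power ?L (k * l)) (2 * card R) = tensor_power ?L (k * l * (2 * card R))"
    by (rule ext, rule ext) (simp add: tensor_power_def power_mult)
  moreover have "k * l * (2 * card R) \<ge> 1"
  proof -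
    have "card R > 0" using R by (auto simp: coset_representatives_def card_gt_0_iff)
    then show ?thesis using kl by (simp add: Suc_le_eq)
  qed
  ultimately show ?thesis unfolding ample_def by (metis (no_types))
qed

text \<open>
  A complex line in the radical of \<open>H\<^sub>E\<close> would pair integrally with \<open>E\<close>, hence lie in the lattice.
\<close>

lemma H\<^sub>E_nondegenerate:
  assumes "\<And>w. H\<^sub>E v w = 0"
  shows "v = 0"
proof -
  have "clinear (\<lambda>z::complex ^ 1. z $ 1 *s v)"
    by (rule clinearI) (simp_all add: vec_eq_iff distrib_right)
  moreover have "z $ 1 *s v \<in> E" for z :: "complex ^ 1"
    by (rule unimodular) (simp add: neron_severi_scale_left[OF H\<^sub>E] assms)
  ultimately have "(1 :: complex ^ 1) $ 1 *s v = 0"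
    using clinear_discrete_zero[of "\<lambda>z::complex ^ 1. z $ 1 *s v" E 1] discrete_lattice[OF lattice_E] by blast
  then show ?thesis by simp
qed

text \<open>
  The form is an orthogonal sum, so polarising maps and restrictions act on the summands separately.
  Hence the symmetric idempotents are the coordinate projections, which add up to the identity.
\<close>

lemma complementary_A:
  assumes \<alpha>: "semicharacter A H \<alpha>" and ab: "abelian_variety E" "abelian_variety B"
  shows "complementary E (\<lambda>v. vjoin v 0) B (\<lambda>w. vjoin 0 w) A (appell_humbert H \<alpha>)"
proof -
  let ?L = "appell_humbert H \<alpha>"
  have lin: "clinear (\<lambda>v. vjoin v 0)" "clinear (\<lambda>w. vjoin 0 w)"
    by (rule clinear_vjoin[OF clinear_ident clinear_zero], rule clinear_vjoin[OF clinear_zero clinear_ident])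
  have idem: "symmetric_idempotent \<Gamma> \<iota> A ?L v = \<iota> (\<pi> v)"
    if \<Gamma>: "add_subgroup \<Gamma>" "span \<Gamma> = UNIV" and \<iota>: "clinear \<iota>" "\<And>v. \<iota> v \<in> A \<longleftrightarrow> v \<in> \<Gamma>"
      and \<pi>: "\<And>v w. H v (\<iota> w) = K (\<pi> v) w" "\<And>u w. H (\<iota> u) (\<iota> w) = K u w"
      and K: "neron_severi \<Gamma> K" "\<And>v. (\<And>w. K v w = 0) \<Longrightarrow> v = 0"
    for \<Gamma> :: "(complex ^ 'k) set" and \<iota> \<pi> K v
  proof -
    have "pullback \<iota> ?L = appell_humbert K (\<lambda>\<gamma>. \<alpha> (\<iota> \<gamma>))"
      by (rule ext, rule ext) (simp add: pullback_def appell_humbert_def \<pi>(2))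
    moreover have "semicharacter \<Gamma> K (\<lambda>\<gamma>. \<alpha> (\<iota> \<gamma>))"
      using \<alpha> by (simp add: semicharacter_def \<iota>(2) vec.linear_add[OF \<iota>(1)] \<pi>(2))
    ultimately have \<phi>: "polarising_map \<Gamma> (pullback \<iota> ?L) = (\<lambda>x. \<chi> j. K x (axis j 1))"
      by (simp add: polarising_map_eq[OF \<Gamma> K(1)])
    have inj: "inj (\<lambda>x. (\<chi> j. K x (axis j 1)) :: complex ^ 'k)"
    proof (rule injI)
      fix x y assume eq: "(\<chi> j. K x (axis j 1)) = ((\<chi> j. K y (axis j 1)) :: complex ^ 'k)"
      have "K (x - y) w = 0" for w
        using arg_cong[OF eq, of "\<lambda>l. apair l w"]
        by (simp add: apair_polarising[OF K(1)] neron_severi_diff_left[OF K(1)])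
      then show "x = y" using K(2)[of "x - y"] by simp
    qed
    have "dual_map \<iota> (polarising_map A ?L v) = (\<chi> j. K (\<pi> v) (axis j 1))"
      by (simp add: dual_map_def polarising_map_eq[OF add_subgroup_A span_A neron_severi_H \<alpha>]
          apair_polarising[OF neron_severi_H] \<pi>(1))
    then show ?thesis
      by (simp add: symmetric_idempotent_def \<phi> inv_into_f_f[OF inj])
  qed
  have "symmetric_idempotent E (\<lambda>v. vjoin v 0) A ?L v = vjoin (vfst v) 0" for v
    by (rule idem[OF E span_E lin(1) vjoin_0_in_A _ _ neron_severi_multiple[OF H\<^sub>E, of d]])
      (use d H\<^sub>E_nondegenerate in \<open>simp_all add: H_def neron_severi_zero_right[OF H\<^sub>B]\<close>)
  moreover have "symmetric_idempotent B (\<lambda>w. vjoin 0 w) A ?L v = vjoin 0 (vsnd v)" for v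
    by (rule idem[OF B span_B lin(2) vjoin_0_right_in_A _ _ H\<^sub>B])
      (use H\<^sub>B_nondegenerate in \<open>simp_all add: H_def neron_severi_zero_right[OF H\<^sub>E]\<close>)
  moreover have "vjoin (vfst v) 0 + vjoin 0 (vsnd v) = v" for v :: "complex ^ (1 + 'm)"
    by (auto simp: vfst_def vsnd_def vjoin_def vec_eq_iff split: sum.split)
  ultimately show ?thesis
    unfolding complementary_def abelian_subvariety_def
    using ab lin vjoin_0_in_A vjoin_0_right_in_A by simp
qed

end

subsection \<open>The dual torus\<close>

lemma add_subgroup_dual_torus: "add_subgroup (dual_torus \<Lambda>)"
  unfolding add_subgroup_def dual_torus_def
  by (simp add: apair_diff_left) (simp add: apair_def)

text \<open>A small form is smaller than 1, hence 0, on finitely many lattice vectors spanning the space.\<close>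

lemma discrete_dual_torus:
  fixes \<Lambda> :: "(complex ^ 'n) set"
  assumes "span \<Lambda> = UNIV"
  shows "discrete_vectors (dual_torus \<Lambda>)"
proof -
  obtain C where C: "C \<subseteq> \<Lambda>" "independent C" "\<Lambda> \<subseteq> span C"
    using maximal_independent_subset by blast
  have fin: "finite C" using C(2) independent_imp_finite by blast
  have sp: "span C = UNIV"
    using assms span_mono[OF C(3)] unfolding span_span by auto
  define r where "r = 1 + (\<Sum>b\<in>C. \<Sum>i\<in>UNIV. norm (b $ i))"
  have r: "r \<ge> 1" unfolding r_def by (simp add: sum_nonneg)
  have small: "l = 0" if l: "l \<in> dual_torus \<Lambda>" "norm l < 1 / r" for l
  proof (rule apair_eq_zero[OF sp])
    fix b assume b: "b \<in> C"
    have "norm (apair l b) \<le> (\<Sum>i\<in>UNIV. norm (l $ i) * norm (b $ i))"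
      unfolding apair_def by (rule order_trans[OF norm_sum]) (simp add: norm_mult)
    also have "\<dots> \<le> (\<Sum>i\<in>UNIV. norm l * norm (b $ i))"
      by (intro sum_mono mult_right_mono Finite_Cartesian_Product.norm_nth_le) simp
    also have "\<dots> = norm l * (\<Sum>i\<in>UNIV. norm (b $ i))" by (simp add: sum_distrib_left)
    also have "\<dots> \<le> norm l * r"
    proof (rule mult_left_mono)
      have "(\<Sum>i\<in>UNIV. norm (b $ i)) \<le> (\<Sum>b\<in>C. \<Sum>i\<in>UNIV. norm (b $ i))"
        by (rule member_le_sum[OF b _ fin]) (simp add: sum_nonneg)
      then show "(\<Sum>i\<in>UNIV. norm (b $ i)) \<le> r" by (simp add: r_def)
    qed simp
    also have "\<dots> < 1" using l(2) r by (simp add: field_simps)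
    finally have "\<bar>Im (apair l b)\<bar> < 1" using abs_Im_le_cmod[of "apair l b"] by linarith
    moreover have "Im (apair l b) \<in> \<int>" using l(1) b C(1) unfolding dual_torus_def by blast
    ultimately show "Im (apair l b) = 0" using Ints_nonzero_abs_less1 by blast
  qed
  have "1 / r \<le> norm l" if "l \<in> dual_torus \<Lambda>" "l \<noteq> 0" for l
  proof (rule leI, rule notI)
    assume "norm l < 1 / r"
    then show False using small[OF that(1)] that(2) by blast
  qed
  moreover have "1 / r > 0" using r by simp
  ultimately show ?thesis unfolding discrete_vectors_def by blast
qed

context gluing
begin

text \<open>
  An isomorphism from the dual of \<open>A\<close> to \<open>A\<close> maps the dual of \<open>A / B = E'\<close> into \<open>E\<close>: its component in
  the direction of \<open>B\<close> vanishes because there are no homomorphisms from \<open>E\<close> to \<open>B\<close>. Since \<open>E'\<close> is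
  self-dual, this would identify \<open>E'\<close> with \<open>E\<close>.
\<close>

lemma dual_not_isomorphic:
  assumes hom: "hom_trivial E B" and E': "\<not> torus_isomorphic E' E"
  shows "\<not> torus_isomorphic (dual_torus A) A"
proof
  assume iso: "torus_isomorphic (dual_torus A) A"
  obtain M N where M: "clinear M" "M ` dual_torus A \<subseteq> A" and N: "clinear N" "N ` A \<subseteq> dual_torus A"
    and NM: "\<And>v. N (M v) = v"
    by (rule torus_isomorphicE[OF add_subgroup_dual_torus discrete_dual_torus[OF span_A] add_subgroup_A
          discrete_lattice[OF lattice_A] iso]) blast
  define \<phi> :: "complex ^ 1 \<Rightarrow> complex ^ (1 + 'm)"
    where "\<phi> x = vjoin (\<chi> j. of_nat d * H\<^sub>E x (axis j 1)) 0" for x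
  have \<phi>_lin: "clinear \<phi>"
    unfolding \<phi>_def
    by (intro clinear_vjoin clinear_zero)
      (rule clinearI, simp_all add: vec_eq_iff neron_severi_add_left[OF H\<^sub>E] neron_severi_scale_left[OF H\<^sub>E] algebra_simps)
  have apair_\<phi>: "apair (\<phi> x) \<gamma> = of_nat d * H\<^sub>E x (vfst \<gamma>)" for x \<gamma>
  proof -
    have split: "apair (vjoin l 0) \<gamma> = apair l (vfst \<gamma>)" for l
      unfolding apair_def
      by (subst UNIV_Plus_UNIV[symmetric], subst sum.Plus) (simp_all add: vjoin_def vfst_def)
    show ?thesis
      unfolding \<phi>_def split by (rule apair_polarising[OF neron_severi_multiple[OF H\<^sub>E]])
  qed
  have \<phi>_dual: "\<phi> x \<in> dual_torus A \<longleftrightarrow> x \<in> E'" for x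
    using E'_self_dual[of x] unfolding vfst_A[symmetric] by (simp add: dual_torus_def apair_\<phi>)
  have \<phi>_inj: "x = 0" if "\<phi> x = 0" for x
  proof (rule H\<^sub>E_nondegenerate)
    fix w
    have "of_nat d * H\<^sub>E x w = 0"
      using apair_\<phi>[of x "vjoin w 0"] that by (simp add: apair_def)
    then show "H\<^sub>E x w = 0" using d by simp
  qed
  have E_sub: "x \<in> E'" if "x \<in> E" for x
  proof -
    have "x + of_int 0 *\<^sub>R p \<in> E'" unfolding E'_def using that by blast
    then show ?thesis by simp
  qed
  have M\<phi>: "clinear (\<lambda>x. M (\<phi> x))"
    by (rule clinearI) (simp_all add: vec.linear_add[OF \<phi>_lin] vec.linear_scale[OF \<phi>_lin] vec.linear_add[OF M(1)] vec.linear_scale[OF M(1)])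
  have "real d *\<^sub>R vsnd (M (\<phi> x)) = 0" for x
  proof (rule hom_trivialD[OF hom E B discrete_lattice[OF lattice_B]])
    show "clinear (\<lambda>x. real d *\<^sub>R vsnd (M (\<phi> x)))"
      by (rule clinearI) (simp_all add: vec.linear_add[OF M\<phi>] vec.linear_scale[OF M\<phi>] scaleR_add_right, simp add: vec_eq_iff)
    show "(\<lambda>x. real d *\<^sub>R vsnd (M (\<phi> x))) ` E \<subseteq> B"
    proof
      fix y assume "y \<in> (\<lambda>x. real d *\<^sub>R vsnd (M (\<phi> x))) ` E"
      then obtain x where x: "x \<in> E" "y = real d *\<^sub>R vsnd (M (\<phi> x))" by blast
      have "M (\<phi> x) \<in> A" using M(2) \<phi>_dual E_sub[OF x(1)] by blast
      from multiple_A[OF this] show "y \<in> B" by (simp add: x(2) vprod_iff)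
    qed
  qed
  then have snd0: "vsnd (M (\<phi> x)) = 0" for x using d by simp
  define \<mu> where "\<mu> = vfst (M (\<phi> 1)) $ 1"
  have M_eq: "M (\<phi> x) = vjoin (\<mu> *s x) 0" for x
  proof -
    have x: "x = x $ 1 *s 1" by (simp add: vec_eq_iff forall_1)
    have "vfst (M (\<phi> x)) = x $ 1 *s vfst (M (\<phi> 1))"
      by (subst x) (simp only: vec.linear_scale[OF M\<phi>] vfst_simps)
    also have "\<dots> = \<mu> *s x" by (simp add: vec_eq_iff forall_1 \<mu>_def)
    finally have "M (\<phi> x) = vjoin (\<mu> *s x) (vsnd (M (\<phi> x)))" by (metis vjoin_vfst_vsnd)
    then show ?thesis by (simp add: snd0)
  qed
  have \<mu>: "\<mu> \<noteq> 0"
  proof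
    assume "\<mu> = 0"
    then have "M (\<phi> 1) = 0" by (simp add: M_eq)
    then have "\<phi> 1 = 0" using NM[of "\<phi> 1"] by (simp add: vec.linear_0[OF N(1)])
    then have "(1 :: complex ^ 1) = 0" by (rule \<phi>_inj)
    then show False by simp
  qed
  have "add_subgroup E'"
    unfolding add_subgroup_def vfst_A[symmetric]
  proof (intro conjI ballI)
    show "0 \<in> vfst ` A" using add_subgroup_zero[OF add_subgroup_A] by (metis imageI vfst_simps(4))
    show "x - y \<in> vfst ` A" if "x \<in> vfst ` A" "y \<in> vfst ` A" for x y
      using that add_subgroup_diff[OF add_subgroup_A] by (auto simp flip: vfst_simps(2))
  qed
  then have "torus_isomorphic E' E"
  proof (rule torus_isomorphicI[OF _ E])
    show "clinear (\<lambda>x. \<mu> *s x)" "clinear (\<lambda>x. (1 / \<mu>) *s x)"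
      by (rule clinearI; simp add: vec_eq_iff algebra_simps)+
    show "(\<lambda>x. \<mu> *s x) ` E' \<subseteq> E"
    proof
      fix y assume "y \<in> (\<lambda>x. \<mu> *s x) ` E'"
      then obtain x where x: "x \<in> E'" "y = \<mu> *s x" by blast
      have "M (\<phi> x) \<in> A" using M(2) \<phi>_dual x(1) by blast
      then show "y \<in> E" by (simp add: M_eq vjoin_0_in_A x(2))
    qed
    show "(\<lambda>x. (1 / \<mu>) *s x) ` E \<subseteq> E'"
    proof
      fix y assume "y \<in> (\<lambda>x. (1 / \<mu>) *s x) ` E"
      then obtain x where x: "x \<in> E" "y = (1 / \<mu>) *s x" by blast
      have "M (\<phi> y) = vjoin x 0" using \<mu> by (simp add: M_eq x(2) vec_eq_iff)
      then have "M (\<phi> y) \<in> A" using x(1) by (simp add: vjoin_0_in_A)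
      then have "N (M (\<phi> y)) \<in> dual_torus A" using N(2) by blast
      then have "\<phi> y \<in> dual_torus A" by (simp only: NM)
      then show "y \<in> E'" by (simp add: \<phi>_dual)
    qed
  qed (use \<mu> in \<open>simp_all add: vec_eq_iff\<close>)
  with E' show False by blast
qed

end

section \<open>Types of polarisations\<close>

lemma finite_cyclic_product:
  assumes "type_sequence ds"
  shows "finite (carrier (cyclic_product ds))"
proof -
  have "0 < ds ! i" if "i < length ds" for i
    using assms that by (simp add: type_sequence_def)
  then show ?thesis
    unfolding cyclic_product_def carrier_product_group
    by (intro finite_PiE) (simp_all add: carrier_integer_mod_group)
qed

text \<open>The factor \<open>\<int> / 1\<close> is trivial, so it may be inserted.\<close>

lemma cyclic_product_Cons_1: "cyclic_product ds \<cong> cyclic_product (1 # ds)"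
proof -
  let ?n = "length ds"
  define f where "f x = (\<lambda>i\<in>{..<Suc ?n}. case i of 0 \<Rightarrow> 0 | Suc j \<Rightarrow> x j)" for x :: "nat \<Rightarrow> int"
  define h where "h x = (\<lambda>i\<in>{..<?n}. x (Suc i))" for x :: "nat \<Rightarrow> int"
  have one: "carrier (integer_mod_group (Suc 0)) = {0}"
    by (auto simp: carrier_integer_mod_group)
  have mem: "x \<in> carrier (cyclic_product es) \<longleftrightarrow>
      (\<forall>i<length es. x i \<in> carrier (integer_mod_group (es ! i))) \<and> (\<forall>i\<ge>length es. x i = undefined)"
    for x es
    by (auto simp: cyclic_product_def PiE_def Pi_def extensional_def)
  have mult: "x \<otimes>\<^bsub>cyclic_product es\<^esub> y = (\<lambda>i\<in>{..<length es}. x i \<otimes>\<^bsub>integer_mod_group (es ! i)\<^esub> y i)" for x y es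
    by (simp add: cyclic_product_def product_group_def)
  have f_mem: "f x \<in> carrier (cyclic_product (1 # ds))" if "x \<in> carrier (cyclic_product ds)" for x
    using that by (auto simp: mem f_def one split: nat.split)
  have h_mem: "h x \<in> carrier (cyclic_product ds)" if "x \<in> carrier (cyclic_product (1 # ds))" for x
    using that by (fastforce simp: mem h_def)
  have hf: "h (f x) = x" if "x \<in> carrier (cyclic_product ds)" for x
    using that by (auto simp: mem h_def f_def fun_eq_iff)
  have fh: "f (h x) = x" if "x \<in> carrier (cyclic_product (1 # ds))" for x
  proof
    fix i
    have "x 0 \<in> carrier (integer_mod_group ((1 # ds) ! 0))"
      using that unfolding mem by (metis length_Cons zero_less_Suc)
    then have "x 0 = 0" by (simp add: one)
    then show "f (h x) i = x i"
      using that unfolding mem by (cases i) (auto simp: h_def f_def)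
  qed
  have "f \<in> iso (cyclic_product ds) (cyclic_product (1 # ds))"
  proof (rule isoI)
    show "f \<in> hom (cyclic_product ds) (cyclic_product (1 # ds))"
    proof (rule homI[OF f_mem])
      fix x y
      show "f (x \<otimes>\<^bsub>cyclic_product ds\<^esub> y) = f x \<otimes>\<^bsub>cyclic_product (1 # ds)\<^esub> f y"
        unfolding mult
      proof (rule ext)
        fix i
        have "f (\<lambda>i\<in>{..<?n}. x i \<otimes>\<^bsub>integer_mod_group (ds ! i)\<^esub> y i) 0 = 0"
          "f x 0 \<otimes>\<^bsub>integer_mod_group (Suc 0)\<^esub> f y 0 = 0"
          by (simp_all add: f_def integer_mod_group_def)
        then show "f (\<lambda>i\<in>{..<?n}. x i \<otimes>\<^bsub>integer_mod_group (ds ! i)\<^esub> y i) i =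
            (\<lambda>i\<in>{..<length (1 # ds)}. f x i \<otimes>\<^bsub>integer_mod_group ((1 # ds) ! i)\<^esub> f y i) i"
          by (cases i) (simp_all add: f_def)
      qed
    qed
    show "bij_betw f (carrier (cyclic_product ds)) (carrier (cyclic_product (1 # ds)))"
      by (rule bij_betw_byWitness[of _ h]) (use hf fh f_mem h_mem in auto)
  qed
  then show ?thesis unfolding is_iso_def by blast
qed

lemma DirProd_cong_iso:
  assumes "G \<cong> G'" "K \<cong> K'"
  shows "G \<times>\<times> K \<cong> G' \<times>\<times> K'"
proof -
  obtain f h where "f \<in> iso G G'" "h \<in> iso K K'" using assms unfolding is_iso_def by blast
  then have "(\<lambda>(x, y). (f x, h y)) \<in> iso (G \<times>\<times> K) (G' \<times>\<times> K')"
    unfolding iso_def hom_def bij_betw_def inj_on_def by (auto simp: image_paired_Times)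
  then show ?thesis unfolding is_iso_def by blast
qed

text \<open>
  A degenerate form contains a whole complex line in the kernel of the polarisation; if the kernel
  is finite, a multiple of this line lies in the lattice.
\<close>

lemma finite_kernel_imp_nondegenerate:
  fixes \<Lambda> :: "(complex ^ 'n) set"
  assumes \<Lambda>: "lattice \<Lambda>" and H: "neron_severi \<Lambda> H"
    and fin: "finite (point \<Lambda> ` {x. \<forall>\<gamma>\<in>\<Lambda>. Im (H x \<gamma>) \<in> \<int>})" and zero: "\<And>w. H v w = 0"
  shows "v = 0"
proof -
  let ?X = "{x. \<forall>\<gamma>\<in>\<Lambda>. Im (H x \<gamma>) \<in> \<int>}"
  let ?G = "(torus \<Lambda>)\<lparr>carrier := point \<Lambda> ` ?X\<rparr>"
  have sub: "add_subgroup \<Lambda>" by (rule add_subgroup_lattice[OF \<Lambda>])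
  interpret group ?G by (rule group_points[OF sub add_subgroup_dual[OF H]])
  define N where "N = order ?G"
  have N: "N > 0" unfolding N_def using fin by (simp add: order_gt_0_iff_finite)
  have pow: "x [^]\<^bsub>?G\<^esub> n = x [^]\<^bsub>torus \<Lambda>\<^esub> n" for x and n :: nat
    by (simp add: nat_pow_def)
  have line: "real N *\<^sub>R (c *s v) \<in> \<Lambda>" for c
  proof -
    have "point \<Lambda> (c *s v) \<in> carrier ?G"
      by (simp add: neron_severi_scale_left[OF H] zero)
    then have "point \<Lambda> (c *s v) [^]\<^bsub>?G\<^esub> N = \<one>\<^bsub>?G\<^esub>"
      unfolding N_def by (rule pow_order_eq_1)
    then show ?thesis
      unfolding pow by (simp add: pow_torus[OF sub] one_torus point_eq_iff[OF sub])
  qed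
  have "clinear (\<lambda>z::complex ^ 1. real N *\<^sub>R (z $ 1 *s v))"
    by (rule clinearI) (simp_all add: vec_eq_iff algebra_simps)
  from clinear_discrete_zero[OF this discrete_lattice[OF \<Lambda>] line, of 1] show ?thesis
    using N by simp
qed

section \<open>Quotients not isomorphic to their duals\<close>

theorem theorem3p2:
  fixes E :: "(complex ^ 1) set" and B :: "(complex ^ 'm) set"
    and L\<^sub>B :: "'m factor" and ds :: "nat list"
    and P :: "(complex ^ 1) set" and Q :: "(complex ^ 'm) set"
    and A :: "(complex ^ (1 + 'm)) set"
  assumes "type_sequence (1 # ds)" and "last ds > 1"
    and "abelian_variety E"
    and "primitive_torsion_point E (last ds) P"
    and "\<not> torus_isomorphic (quotient_by_point E P) E"
    and "polarised B L\<^sub>B" and "polarisation_type B L\<^sub>B ds"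
    and "hom_trivial E B"
    and "Q \<in> ker_polarising B L\<^sub>B" and "primitive_torsion_point B (last ds) Q"
    and "A = quotient_by_point (vprod E B) (vprod P Q)"
  shows "abelian_variety A \<and>
     (\<exists>L. polarised A L \<and> polarisation_type A L (1 # ds) \<and>
          complementary E (\<lambda>v. vjoin v 0) B (\<lambda>w. vjoin 0 w) A L) \<and>
     \<not> torus_isomorphic (dual_torus A) A"
proof -
  define d where "d = last ds"
  have d: "d > 0" using assms(2) by (simp add: d_def)
  obtain L\<^sub>E where "polarised E L\<^sub>E" using assms(3) unfolding abelian_variety_def by blast
  then obtain K \<kappa> where lE: "lattice E" and K: "neron_severi E K" "semicharacter E K \<kappa>" "ample E (appell_humbert K \<kappa>)"
    unfolding polarised_def line_bundle_def by blast
  obtain H\<^sub>B \<alpha>\<^sub>B where lB: "lattice B" and H\<^sub>B: "neron_severi B H\<^sub>B" "semicharacter B H\<^sub>B \<alpha>\<^sub>B"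
    and LB: "L\<^sub>B = appell_humbert H\<^sub>B \<alpha>\<^sub>B" "ample B L\<^sub>B"
    using assms(6) unfolding polarised_def line_bundle_def by blast
  have E: "add_subgroup E" "span E = UNIV" and B: "add_subgroup B" "span B = UNIV"
    using lE lB by (simp_all add: add_subgroup_lattice) (simp_all add: lattice_def)
  obtain v w where "K v w \<noteq> 0" using ample_imp_form_nonzero[OF E K] by blast
  then obtain c :: nat and H\<^sub>E e\<^sub>1 e\<^sub>2 where c: "c > 0" and H\<^sub>E: "neron_severi E H\<^sub>E" "unimodular_basis E H\<^sub>E e\<^sub>1 e\<^sub>2"
    and K_eq: "\<And>v w. K v w = of_nat c * H\<^sub>E v w"
    by (rule elliptic_unimodular_basis[OF E K(1)]) blast
  have K_fun: "K = (\<lambda>v w. of_nat c * H\<^sub>E v w)" by (intro ext K_eq)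
  obtain \<alpha>\<^sub>E k S where \<alpha>\<^sub>E: "semicharacter E (\<lambda>v w. of_nat d * H\<^sub>E v w) \<alpha>\<^sub>E" and k: "k \<ge> 1"
    and S: "embedding_sections E (tensor_power (appell_humbert (\<lambda>v w. of_nat d * H\<^sub>E v w) \<alpha>\<^sub>E) k) S"
    by (rule elliptic_ample_multiple[OF E(1) H\<^sub>E c d K(2,3)[unfolded K_fun]]) blast
  obtain l where l: "l \<ge> 1" "very_ample B (tensor_power (appell_humbert H\<^sub>B \<alpha>\<^sub>B) l)"
    using LB unfolding ample_def by blast
  obtain T where T: "embedding_sections B (tensor_power (appell_humbert H\<^sub>B \<alpha>\<^sub>B) l) T"
    by (rule very_ample_imp_embedding_sections[OF l(2)])
  have ker_B: "ker_polarising B L\<^sub>B = point B ` {x. \<forall>b\<in>B. Im (H\<^sub>B x b) \<in> \<int>}"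
    unfolding LB by (rule ker_polarising_appell_humbert[OF B H\<^sub>B])
  obtain q where q: "Q = point B q" "\<And>b. b \<in> B \<Longrightarrow> Im (H\<^sub>B q b) \<in> \<int>"
    using assms(9) unfolding ker_B by blast
  obtain p where p: "P = point E p"
    using assms(4) unfolding primitive_torsion_point_def carrier_torus by blast
  have type_B: "length ds = CARD('m)" "type_sequence ds"
    "(torus B)\<lparr>carrier := ker_polarising B L\<^sub>B\<rparr> \<cong> cyclic_product ds \<times>\<times> cyclic_product ds"
    using assms(7) unfolding polarisation_type_def by blast+
  have fin: "finite (point B ` {x. \<forall>b\<in>B. Im (H\<^sub>B x b) \<in> \<int>})"
  proof -
    obtain f where "f \<in> iso ((torus B)\<lparr>carrier := ker_polarising B L\<^sub>B\<rparr>) (cyclic_product ds \<times>\<times> cyclic_product ds)"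
      using type_B(3) unfolding is_iso_def by blast
    then have "bij_betw f (ker_polarising B L\<^sub>B) (carrier (cyclic_product ds) \<times> carrier (cyclic_product ds))"
      by (simp add: iso_def)
    then show ?thesis
      using bij_betw_finite finite_cyclic_product[OF type_B(2)] unfolding ker_B by blast
  qed
  interpret G: gluing E B H\<^sub>E H\<^sub>B \<alpha>\<^sub>E \<alpha>\<^sub>B e\<^sub>1 e\<^sub>2 p q d
  proof
    show "of_int k *\<^sub>R p \<in> E \<longleftrightarrow> int d dvd k" for k
      using primitive_torsion_point_iff[OF E(1)] assms(4) unfolding p d_def by blast
    show "of_int k *\<^sub>R q \<in> B \<longleftrightarrow> int d dvd k" for k
      using primitive_torsion_point_iff[OF B(1)] assms(10) unfolding q(1) d_def by blast
    show "w = 0" if "\<And>w'. H\<^sub>B w w' = 0" for w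
      by (rule finite_kernel_imp_nondegenerate[OF lB H\<^sub>B(1) fin that])
  qed (fact lE lB H\<^sub>E H\<^sub>B \<alpha>\<^sub>E d q(2))+
  have "vprod P Q = point (vprod E B) (vjoin p q)"
    by (auto simp: p q(1) point_eq vprod_iff)
  then have A: "A = G.A"
    unfolding assms(11) G.A_def G.g_def by (simp add: quotient_by_point_eq[OF G.product])
  have E': "quotient_by_point E P = G.E'"
    unfolding G.E'_def p by (rule quotient_by_point_eq[OF E(1)])
  obtain \<alpha> where \<alpha>: "semicharacter G.A G.H \<alpha>" "\<And>x. x \<in> vprod E B \<Longrightarrow> \<alpha> x = G.\<alpha>\<^sub>0 x"
    by (rule G.semicharacter_extension[OF that])
  let ?L = "appell_humbert G.H \<alpha>"
  have pol: "polarised G.A ?L"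
    unfolding polarised_def line_bundle_def
    using G.lattice_A G.neron_severi_H \<alpha>(1) G.ample_A[OF \<alpha> S T k l(1)] by blast
  have ker_A: "ker_polarising G.A ?L = point G.A ` {x. \<forall>\<gamma>\<in>G.A. Im (G.H x \<gamma>) \<in> \<int>}"
    by (rule ker_polarising_appell_humbert[OF G.add_subgroup_A G.span_A G.neron_severi_H \<alpha>(1)])
  have "(torus G.A)\<lparr>carrier := ker_polarising G.A ?L\<rparr> \<cong> (torus B)\<lparr>carrier := ker_polarising B L\<^sub>B\<rparr>"
    unfolding ker_A ker_B
    by (rule group.iso_sym[OF group_points[OF B(1) add_subgroup_dual[OF H\<^sub>B(1)]] G.kernel_isomorphic])
  also note type_B(3)
  also have "cyclic_product ds \<times>\<times> cyclic_product ds \<cong> cyclic_product (1 # ds) \<times>\<times> cyclic_product (1 # ds)"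
    by (rule DirProd_cong_iso[OF cyclic_product_Cons_1 cyclic_product_Cons_1])
  finally have type: "polarisation_type G.A ?L (1 # ds)"
    using assms(1) type_B(1) by (simp add: polarisation_type_def)
  have "abelian_variety B" using assms(6) unfolding abelian_variety_def by blast
  then have "complementary E (\<lambda>v. vjoin v 0) B (\<lambda>w. vjoin 0 w) G.A ?L"
    by (rule G.complementary_A[OF \<alpha>(1) assms(3)])
  moreover have "\<not> torus_isomorphic (dual_torus G.A) G.A"
    using assms(5) unfolding E' by (rule G.dual_not_isomorphic[OF assms(8)])
  ultimately show ?thesis
    unfolding A abelian_variety_def using pol type by blast
qed

end
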